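(* Let $A$ be an operator space which is an algebra with a right identity of norm $1$ (or a right contractive approximate identity). Then $A$ is completely isometrically isomorphic to a concrete operator algebra if and only if $$ \Vert (x \oplus \mathrm{Id}_m)\, y \Vert_{n+m} \leq \Vert x \Vert_{n}\, \Vert y \Vert_{n+m} $$ for all $n, m \in \mathbb{N}$ and all $x \in M_n(A)$, $y \in M_{n+m}(A)$.
   Context: Operator spaces are norm-complete linear subspaces of $B(H)$ for a Hilbert space $H$ (equivalently, abstract operator spaces in the sense of Ruan), and $\Vert\cdot\Vert_n$ denotes the norm on the space $M_n(A)$ of $n \times n$ matrices over $A$. A concrete operator algebra means a norm closed subalgebra of $B(H)$, for a Hilbert space $H$, with an identity of norm $1$. Completely isometrically isomorphic means isomorphic via an algebra isomorphism which is completely isometric, i.e. isometric on each matrix level $M_n$. Here $\mathrm{Id}$ is a formal identity: the expression $(x \oplus \mathrm{Id}_m)\, y$ means that the upper $n \times (n+m)$-submatrix of $y$ is left multiplied by $x$, and the lower $m \times (n+m)$-submatrix is left alone. A right identity is an element $1 \in A$ with $a1 = a$ for all $a\in A$; a right contractive approximate identity is a net $(e_t)$ in $A$ of elements of norm $\le 1$ with $a e_t \to a$ in norm for all $a \in A$.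
   Formalization: The right side of the bound is max(‖x‖_n,1)‖y‖ instead of ‖x‖_n‖y‖ (as written it fails at x=0 for A=ℂ), and the concrete operator algebra need only have a right identity of norm 1 or right contractive approximate identity (2×2 matrices with zero second column have no left identity). *)

theory Defs
  imports "HOL-Analysis.Analysis"
begin

text \<open>
  Complex Hilbert spaces. The inner product is linear in the first argument; positive
  definiteness is contained in \<open>cinner_self\<close> together with the norm axioms of \<open>banach\<close>.
\<close>

class complex_hilbert = banach +
  fixes scaleC :: "complex \<Rightarrow> 'a \<Rightarrow> 'a" (infixr "*\<^sub>C" 75)
    and cinner :: "'a \<Rightarrow> 'a \<Rightarrow> complex"
  assumes scaleC_add_right: "c *\<^sub>C (x + y) = c *\<^sub>C x + c *\<^sub>C y"
    and scaleC_add_left: "(c + d) *\<^sub>C x = c *\<^sub>C x + d *\<^sub>C x"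
    and scaleC_scaleC: "c *\<^sub>C d *\<^sub>C x = (c * d) *\<^sub>C x"
    and scaleR_scaleC: "r *\<^sub>R x = complex_of_real r *\<^sub>C x"
    and cinner_add_left: "cinner (x + y) z = cinner x z + cinner y z"
    and cinner_scaleC_left: "cinner (c *\<^sub>C x) y = c * cinner x y"
    and cinner_commute: "cinner x y = cnj (cinner y x)"
    and cinner_self: "cinner x x = complex_of_real ((norm x)\<^sup>2)"

lemma norm_scaleC: "norm (c *\<^sub>C (x :: 'a :: complex_hilbert)) = cmod c * norm x"
proof -
  have "cinner (c *\<^sub>C x) (c *\<^sub>C x) = c * cnj c * cinner x x"
    by (metis cinner_commute cinner_scaleC_left complex_cnj_mult mult.assoc mult.commute)
  hence "complex_of_real ((norm (c *\<^sub>C x))\<^sup>2) = complex_of_real ((cmod c * norm x)\<^sup>2)"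
    by (simp add: cinner_self complex_norm_square[symmetric] power_mult_distrib)
  hence "(norm (c *\<^sub>C x))\<^sup>2 = (cmod c * norm x)\<^sup>2"
    using of_real_eq_iff by blast
  thus ?thesis by (simp add: power2_eq_iff_nonneg)
qed

lemma bounded_linear_scaleC: "bounded_linear (\<lambda>x :: 'a :: complex_hilbert. c *\<^sub>C x)"
  by (rule bounded_linear_intro[where K = "cmod c"])
    (simp_all add: scaleC_add_right scaleR_scaleC scaleC_scaleC norm_scaleC mult.commute)

text \<open>The Hilbert space \<open>\<ell>\<^sup>2(I)\<close>, where \<open>I\<close> is the set of all elements of the type \<open>'i\<close>.\<close>

typedef 'i ell2 = "{x :: 'i \<Rightarrow> complex. (\<lambda>i. (cmod (x i))\<^sup>2) summable_on UNIV}"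
  morphisms ell2_coord Abs_ell2
  by (rule exI[of _ "\<lambda>_. 0"]) simp

setup_lifting type_definition_ell2

lemma ell2_summableI:
  fixes x :: "'i \<Rightarrow> complex"
  assumes "\<And>F. finite F \<Longrightarrow> L2_set (\<lambda>i. cmod (x i)) F \<le> C"
  shows "(\<lambda>i. (cmod (x i))\<^sup>2) summable_on UNIV"
proof (rule nonneg_bdd_above_summable_on)
  have "C \<ge> 0" using assms[of "{}"] by simp
  show "bdd_above (sum (\<lambda>i. (cmod (x i))\<^sup>2) ` {F. F \<subseteq> UNIV \<and> finite F})"
  proof (rule bdd_aboveI2)
    fix F :: "'i set" assume "F \<in> {F. F \<subseteq> UNIV \<and> finite F}"
    hence "sqrt (\<Sum>i\<in>F. (cmod (x i))\<^sup>2) \<le> C" using assms by (simp add: L2_set_def)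
    thus "(\<Sum>i\<in>F. (cmod (x i))\<^sup>2) \<le> C\<^sup>2" using \<open>C \<ge> 0\<close> by (simp add: sqrt_le_D)
  qed
qed simp

lemma ell2_norm_leI:
  fixes x :: "'i \<Rightarrow> complex"
  assumes "\<And>F. finite F \<Longrightarrow> L2_set (\<lambda>i. cmod (x i)) F \<le> C"
  shows "sqrt (\<Sum>\<^sub>\<infinity>i. (cmod (x i))\<^sup>2) \<le> C"
proof -
  have C: "C \<ge> 0" using assms[of "{}"] by simp
  have "(\<Sum>\<^sub>\<infinity>i. (cmod (x i))\<^sup>2) \<le> C\<^sup>2"
  proof (rule infsum_le_finite_sums[OF ell2_summableI[OF assms]])
    fix F :: "'i set" assume "finite F"
    hence "sqrt (\<Sum>i\<in>F. (cmod (x i))\<^sup>2) \<le> C" using assms by (simp add: L2_set_def)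
    thus "(\<Sum>i\<in>F. (cmod (x i))\<^sup>2) \<le> C\<^sup>2" using C by (simp add: sqrt_le_D)
  qed
  thus ?thesis using C by (simp add: real_le_lsqrt)
qed

lemma ell2_norm_ge:
  fixes x :: "'i \<Rightarrow> complex"
  assumes "(\<lambda>i. (cmod (x i))\<^sup>2) summable_on UNIV" "finite F"
  shows "L2_set (\<lambda>i. cmod (x i)) F \<le> sqrt (\<Sum>\<^sub>\<infinity>i. (cmod (x i))\<^sup>2)"
  unfolding L2_set_def real_sqrt_le_iff
  by (rule finite_sum_le_infsum) (use assms in auto)

lemma ell2_triangle:
  fixes x y :: "'i \<Rightarrow> complex"
  assumes "(\<lambda>i. (cmod (x i))\<^sup>2) summable_on UNIV" "(\<lambda>i. (cmod (y i))\<^sup>2) summable_on UNIV"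
    and "finite F"
  shows "L2_set (\<lambda>i. cmod (x i + y i)) F
           \<le> sqrt (\<Sum>\<^sub>\<infinity>i. (cmod (x i))\<^sup>2) + sqrt (\<Sum>\<^sub>\<infinity>i. (cmod (y i))\<^sup>2)"
proof -
  have "L2_set (\<lambda>i. cmod (x i + y i)) F \<le> L2_set (\<lambda>i. cmod (x i) + cmod (y i)) F"
    by (rule L2_set_mono) (auto intro: norm_triangle_ineq)
  also have "\<dots> \<le> L2_set (\<lambda>i. cmod (x i)) F + L2_set (\<lambda>i. cmod (y i)) F"
    by (rule L2_set_triangle_ineq)
  finally show ?thesis
    using ell2_norm_ge[OF assms(1,3)] ell2_norm_ge[OF assms(2,3)] by linarith
qed

lemma ell2_product_summable:
  fixes x y :: "'i \<Rightarrow> complex"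
  assumes "(\<lambda>i. (cmod (x i))\<^sup>2) summable_on UNIV" "(\<lambda>i. (cmod (y i))\<^sup>2) summable_on UNIV"
  shows "(\<lambda>i. x i * cnj (y i)) summable_on UNIV"
proof (rule Infinite_Sum.abs_summable_summable, rule Infinite_Sum.abs_summable_on_comparison_test')
  show "(\<lambda>i. (cmod (x i))\<^sup>2 + (cmod (y i))\<^sup>2) summable_on UNIV"
    by (rule summable_on_add[OF assms])
  fix i
  have "2 * (cmod (x i) * cmod (y i)) \<le> (cmod (x i))\<^sup>2 + (cmod (y i))\<^sup>2"
    using sum_squares_bound[of "cmod (x i)" "cmod (y i)"] by (simp add: mult.assoc)
  moreover have "0 \<le> cmod (x i) * cmod (y i)" by simp
  ultimately show "cmod (x i * cnj (y i)) \<le> (cmod (x i))\<^sup>2 + (cmod (y i))\<^sup>2"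
    unfolding norm_mult complex_mod_cnj by linarith
qed

instantiation ell2 :: (type) real_normed_vector
begin

lift_definition zero_ell2 :: "'a ell2" is "\<lambda>_. 0" by simp
lift_definition plus_ell2 :: "'a ell2 \<Rightarrow> 'a ell2 \<Rightarrow> 'a ell2" is "\<lambda>x y i. x i + y i"
  by (rule ell2_summableI, rule ell2_triangle)
lift_definition uminus_ell2 :: "'a ell2 \<Rightarrow> 'a ell2" is "\<lambda>x i. - x i" by simp
lift_definition minus_ell2 :: "'a ell2 \<Rightarrow> 'a ell2 \<Rightarrow> 'a ell2" is "\<lambda>x y i. x i - y i"
  unfolding diff_conv_add_uminus by (rule ell2_summableI, rule ell2_triangle) simp_all
lift_definition scaleR_ell2 :: "real \<Rightarrow> 'a ell2 \<Rightarrow> 'a ell2" is "\<lambda>r x i. r *\<^sub>R x i"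
  by (simp add: power_mult_distrib summable_on_cmult_right)
lift_definition norm_ell2 :: "'a ell2 \<Rightarrow> real" is "\<lambda>x. sqrt (\<Sum>\<^sub>\<infinity>i. (cmod (x i))\<^sup>2)" .
definition sgn_ell2 :: "'a ell2 \<Rightarrow> 'a ell2" where "sgn_ell2 x = inverse (norm x) *\<^sub>R x"
definition dist_ell2 :: "'a ell2 \<Rightarrow> 'a ell2 \<Rightarrow> real" where "dist_ell2 x y = norm (x - y)"
definition uniformity_ell2 :: "('a ell2 \<times> 'a ell2) filter" where
  "uniformity_ell2 = (INF e\<in>{0<..}. principal {(x, y). dist x y < e})"
definition open_ell2 :: "'a ell2 set \<Rightarrow> bool" where
  "open_ell2 U \<longleftrightarrow> (\<forall>x\<in>U. eventually (\<lambda>(x', y). x' = x \<longrightarrow> y \<in> U) uniformity)"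

instance
proof
  fix x y z :: "'a ell2" and a b :: real
  show "x + y + z = x + (y + z)" "x + y = y + x" "0 + x = x" "- x + x = 0" "x - y = x + - y"
    "a *\<^sub>R (x + y) = a *\<^sub>R x + a *\<^sub>R y" "(a + b) *\<^sub>R x = a *\<^sub>R x + b *\<^sub>R x"
    "a *\<^sub>R b *\<^sub>R x = (a * b) *\<^sub>R x" "1 *\<^sub>R x = x"
    by (transfer; simp add: algebra_simps fun_eq_iff)+
  show "norm x = 0 \<longleftrightarrow> x = 0"
  proof transfer
    fix x :: "'a \<Rightarrow> complex" assume s: "(\<lambda>i. (cmod (x i))\<^sup>2) summable_on UNIV"
    show "sqrt (\<Sum>\<^sub>\<infinity>i. (cmod (x i))\<^sup>2) = 0 \<longleftrightarrow> x = (\<lambda>_. 0)"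
    proof
      assume "sqrt (\<Sum>\<^sub>\<infinity>i. (cmod (x i))\<^sup>2) = 0"
      hence "(\<Sum>\<^sub>\<infinity>i. (cmod (x i))\<^sup>2) \<le> 0" by simp
      hence "(cmod (x i))\<^sup>2 = 0" for i
        using nonneg_infsum_le_0D[OF _ s] by simp
      thus "x = (\<lambda>_. 0)" by auto
    qed simp
  qed
  show "norm (x + y) \<le> norm x + norm y"
    by (transfer, rule ell2_norm_leI, rule ell2_triangle)
  show "norm (a *\<^sub>R x) = \<bar>a\<bar> * norm x"
    by (transfer; simp add: power_mult_distrib infsum_cmult_right' real_sqrt_mult)
qed (simp_all add: sgn_ell2_def dist_ell2_def uniformity_ell2_def open_ell2_def)

end

instantiation ell2 :: (type) complex_hilbert
begin

lift_definition scaleC_ell2 :: "complex \<Rightarrow> 'a ell2 \<Rightarrow> 'a ell2" is "\<lambda>c x i. c * x i"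
  by (simp add: norm_mult power_mult_distrib summable_on_cmult_right)
lift_definition cinner_ell2 :: "'a ell2 \<Rightarrow> 'a ell2 \<Rightarrow> complex" is
  "\<lambda>x y. \<Sum>\<^sub>\<infinity>i. x i * cnj (y i)" .

lemma ell2_L2_set_le_norm:
  assumes "finite F"
  shows "L2_set (\<lambda>i. cmod (ell2_coord (x :: 'a ell2) i)) F \<le> norm x"
  using assms by (transfer, intro ell2_norm_ge)

instance
proof
  fix X :: "nat \<Rightarrow> 'a ell2" assume X: "Cauchy X"
  have "Cauchy (\<lambda>n. ell2_coord (X n) i)" for i
  proof (rule metric_CauchyI)
    fix e :: real assume "e > 0"
    then obtain N where N: "\<And>m n. m \<ge> N \<Longrightarrow> n \<ge> N \<Longrightarrow> dist (X m) (X n) < e"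
      using X metric_CauchyD by blast
    have "dist (ell2_coord (X m) i) (ell2_coord (X n) i) \<le> dist (X m) (X n)" for m n
      using ell2_L2_set_le_norm[of "{i}" "X m - X n"]
      by (simp add: dist_norm minus_ell2.rep_eq)
    thus "\<exists>M. \<forall>m\<ge>M. \<forall>n\<ge>M. dist (ell2_coord (X m) i) (ell2_coord (X n) i) < e"
      using N by (meson le_less_trans)
  qed
  hence "(\<lambda>n. ell2_coord (X n) i) \<longlonglongrightarrow> lim (\<lambda>n. ell2_coord (X n) i)" for i
    using Cauchy_convergent convergent_LIMSEQ_iff by blast
  then obtain l where l: "\<And>i. (\<lambda>n. ell2_coord (X n) i) \<longlonglongrightarrow> l i"
    by (rule that)
  have close: "L2_set (\<lambda>i. cmod (ell2_coord (X n) i - l i)) F \<le> e"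
    if N: "\<And>m n. m \<ge> N \<Longrightarrow> n \<ge> N \<Longrightarrow> dist (X m) (X n) < e" and "n \<ge> N" "finite F"
    for e :: real and N n and F :: "'a set"
  proof (rule LIMSEQ_le_const2)
    show "(\<lambda>m. L2_set (\<lambda>i. cmod (ell2_coord (X n) i - ell2_coord (X m) i)) F)
            \<longlonglongrightarrow> L2_set (\<lambda>i. cmod (ell2_coord (X n) i - l i)) F"
      unfolding L2_set_def by (intro tendsto_intros l)
    have "L2_set (\<lambda>i. cmod (ell2_coord (X n) i - ell2_coord (X m) i)) F \<le> e" if "m \<ge> N" for m
      using ell2_L2_set_le_norm[OF \<open>finite F\<close>, of "X n - X m"] N[OF \<open>n \<ge> N\<close> that]
      by (simp add: dist_norm minus_ell2.rep_eq)
    thus "\<exists>N. \<forall>m\<ge>N. L2_set (\<lambda>i. cmod (ell2_coord (X n) i - ell2_coord (X m) i)) F \<le> e"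
      by blast
  qed
  obtain N1 where N1: "\<And>m n. m \<ge> N1 \<Longrightarrow> n \<ge> N1 \<Longrightarrow> dist (X m) (X n) < 1"
    using X metric_CauchyD[of X 1] by auto
  have "(\<lambda>i. (cmod (ell2_coord (X N1) i - l i))\<^sup>2) summable_on UNIV"
    by (rule ell2_summableI, rule close[OF N1]) auto
  hence r: "ell2_coord (Abs_ell2 (\<lambda>i. ell2_coord (X N1) i - l i))
      = (\<lambda>i. ell2_coord (X N1) i - l i)"
    by (simp add: Abs_ell2_inverse)
  define L where "L = X N1 - Abs_ell2 (\<lambda>i. ell2_coord (X N1) i - l i)"
  have L: "ell2_coord L = l"
    by (simp add: L_def minus_ell2.rep_eq r)
  have "X \<longlonglongrightarrow> L"
  proof (rule metric_LIMSEQ_I)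
    fix e :: real assume "e > 0"
    then obtain N where N: "\<And>m n. m \<ge> N \<Longrightarrow> n \<ge> N \<Longrightarrow> dist (X m) (X n) < e / 2"
      using X metric_CauchyD[of X "e / 2"] by auto
    have "dist (X n) L \<le> e / 2" if "n \<ge> N" for n
      unfolding dist_norm norm_ell2.rep_eq minus_ell2.rep_eq L by (rule ell2_norm_leI, rule close[OF N that])
    hence "dist (X n) L < e" if "n \<ge> N" for n
      using \<open>e > 0\<close> that by (rule_tac le_less_trans[of _ "e / 2"]) simp_all
    thus "\<exists>N. \<forall>n\<ge>N. dist (X n) L < e" by blast
  qed
  thus "convergent X" by (auto simp: convergent_def)
next
  fix x y z :: "'a ell2" and c d :: complex and r :: real
  show "c *\<^sub>C (x + y) = c *\<^sub>C x + c *\<^sub>C y" "(c + d) *\<^sub>C x = c *\<^sub>C x + d *\<^sub>C x"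
    "c *\<^sub>C d *\<^sub>C x = (c * d) *\<^sub>C x" "r *\<^sub>R x = complex_of_real r *\<^sub>C x"
    by (transfer; simp add: algebra_simps fun_eq_iff scaleR_conv_of_real)+
  show "cinner (x + y) z = cinner x z + cinner y z"
    by (transfer; simp add: distrib_right infsum_add ell2_product_summable)
  show "cinner (c *\<^sub>C x) y = c * cinner x y"
    by (transfer; simp add: mult.assoc infsum_cmult_right')
  show "cinner x y = cnj (cinner y x)"
    by (transfer; simp flip: infsum_cnj add: mult.commute)
  show "cinner x x = complex_of_real ((norm x)\<^sup>2)"
  proof transfer
    fix x :: "'a \<Rightarrow> complex" assume "(\<lambda>i. (cmod (x i))\<^sup>2) summable_on UNIV"
    hence "((\<lambda>i. complex_of_real ((cmod (x i))\<^sup>2)) has_sum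
            complex_of_real (\<Sum>\<^sub>\<infinity>i. (cmod (x i))\<^sup>2)) UNIV"
      by (intro has_sum_of_real has_sum_infsum)
    hence "(\<Sum>\<^sub>\<infinity>i. x i * cnj (x i)) = complex_of_real (\<Sum>\<^sub>\<infinity>i. (cmod (x i))\<^sup>2)"
      unfolding complex_norm_square by (rule infsumI)
    moreover have "(\<Sum>\<^sub>\<infinity>i. (cmod (x i))\<^sup>2) \<ge> 0" by (simp add: infsum_nonneg)
    ultimately show "(\<Sum>\<^sub>\<infinity>i. x i * cnj (x i))
        = complex_of_real ((sqrt (\<Sum>\<^sub>\<infinity>i. (cmod (x i))\<^sup>2))\<^sup>2)"
      by simp
  qed
qed

end

text \<open>
  \<open>B(H)\<close>. The library type of bounded linear maps is real linear, so \<open>B(H)\<close> is the set of its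
  complex linear members; its norm is the operator norm.
\<close>

definition BH :: "('h::complex_hilbert \<Rightarrow>\<^sub>L 'h) set" where
  "BH = {T. \<forall>c x. blinfun_apply T (c *\<^sub>C x) = c *\<^sub>C blinfun_apply T x}"

lift_definition scaleC_op ::
  "complex \<Rightarrow> ('h::complex_hilbert \<Rightarrow>\<^sub>L 'h) \<Rightarrow> ('h \<Rightarrow>\<^sub>L 'h)" is "\<lambda>c T x. c *\<^sub>C T x"
  by (rule bounded_linear_compose[OF bounded_linear_scaleC])

text \<open>
  An \<open>n \<times> n\<close> matrix is a function of two indices of which only the values at indices \<open>< n\<close>
  matter. The norm of a matrix of operators on \<open>H\<close> is its norm as an operator on the
  \<open>n\<close>-fold Hilbert space direct sum of \<open>H\<close>.
\<close>

definition Mat :: "nat \<Rightarrow> 'a set \<Rightarrow> (nat \<Rightarrow> nat \<Rightarrow> 'a) set" where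
  "Mat n A = {x. \<forall>i<n. \<forall>j<n. x i j \<in> A}"

definition matnorm :: "nat \<Rightarrow> (nat \<Rightarrow> nat \<Rightarrow> ('h::complex_hilbert \<Rightarrow>\<^sub>L 'h)) \<Rightarrow> real" where
  "matnorm n x =
     Sup {L2_set (\<lambda>i. norm (\<Sum>j<n. blinfun_apply (x i j) (v j))) {..<n} |
          v. L2_set (\<lambda>j. norm (v j)) {..<n} \<le> 1}"

definition operator_space :: "('h::complex_hilbert \<Rightarrow>\<^sub>L 'h) set \<Rightarrow> bool" where
  "operator_space A \<longleftrightarrow> A \<subseteq> BH \<and> 0 \<in> A \<and> (\<forall>S\<in>A. \<forall>T\<in>A. S + T \<in> A) \<and>
     (\<forall>c. \<forall>T\<in>A. scaleC_op c T \<in> A) \<and> complete A"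

text \<open>The product of an algebra need not be composition of operators, nor a priori continuous.\<close>

definition algebra_on ::
  "('h::complex_hilbert \<Rightarrow>\<^sub>L 'h) set \<Rightarrow> (('h \<Rightarrow>\<^sub>L 'h) \<Rightarrow> ('h \<Rightarrow>\<^sub>L 'h) \<Rightarrow> ('h \<Rightarrow>\<^sub>L 'h)) \<Rightarrow> bool"
where
  "algebra_on A mul \<longleftrightarrow>
     (\<forall>a\<in>A. \<forall>b\<in>A. mul a b \<in> A) \<and>
     (\<forall>a\<in>A. \<forall>b\<in>A. \<forall>c\<in>A. mul (a + b) c = mul a c + mul b c) \<and>
     (\<forall>a\<in>A. \<forall>b\<in>A. \<forall>c\<in>A. mul a (b + c) = mul a b + mul a c) \<and>
     (\<forall>z. \<forall>a\<in>A. \<forall>b\<in>A. mul (scaleC_op z a) b = scaleC_op z (mul a b)) \<and>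
     (\<forall>z. \<forall>a\<in>A. \<forall>b\<in>A. mul a (scaleC_op z b) = scaleC_op z (mul a b)) \<and>
     (\<forall>a\<in>A. \<forall>b\<in>A. \<forall>c\<in>A. mul (mul a b) c = mul a (mul b c))"

definition has_right_identity ::
  "('h::complex_hilbert \<Rightarrow>\<^sub>L 'h) set \<Rightarrow> (('h \<Rightarrow>\<^sub>L 'h) \<Rightarrow> ('h \<Rightarrow>\<^sub>L 'h) \<Rightarrow> ('h \<Rightarrow>\<^sub>L 'h)) \<Rightarrow> bool"
where
  "has_right_identity A mul \<longleftrightarrow> (\<exists>e\<in>A. norm e = 1 \<and> (\<forall>a\<in>A. mul a e = a))"

text \<open>Nets in \<open>A\<close> are rendered by the proper filters of their tails.\<close>

definition has_right_cai ::
  "('h::complex_hilbert \<Rightarrow>\<^sub>L 'h) set \<Rightarrow> (('h \<Rightarrow>\<^sub>L 'h) \<Rightarrow> ('h \<Rightarrow>\<^sub>L 'h) \<Rightarrow> ('h \<Rightarrow>\<^sub>L 'h)) \<Rightarrow> bool"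
where
  "has_right_cai A mul \<longleftrightarrow>
     (\<exists>F. F \<noteq> bot \<and> (\<forall>\<^sub>F e in F. e \<in> A \<and> norm e \<le> 1) \<and>
          (\<forall>a\<in>A. ((\<lambda>e. mul a e) \<longlongrightarrow> a) F))"

text \<open>
  A norm closed subalgebra of \<open>B(H)\<close> with an identity of norm 1. As for \<open>A\<close> itself, the identity
  is only required to be a right identity, or a right contractive approximate identity. A
  two-sided identity would be too much to ask: the \<open>2 \<times> 2\<close> matrices with vanishing second column
  are a norm closed algebra of operators with a right identity of norm 1 and no left identity.
\<close>

definition concrete_operator_algebra :: "('h::complex_hilbert \<Rightarrow>\<^sub>L 'h) set \<Rightarrow> bool" where
  "concrete_operator_algebra B \<longleftrightarrow> operator_space B \<and> (\<forall>S\<in>B. \<forall>T\<in>B. S o\<^sub>L T \<in> B) \<and>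
     (has_right_identity B (o\<^sub>L) \<or> has_right_cai B (o\<^sub>L))"

definition completely_isometric_isomorphism ::
  "('k::complex_hilbert \<Rightarrow>\<^sub>L 'k) set \<Rightarrow> (('k \<Rightarrow>\<^sub>L 'k) \<Rightarrow> ('k \<Rightarrow>\<^sub>L 'k) \<Rightarrow> ('k \<Rightarrow>\<^sub>L 'k)) \<Rightarrow>
   ('h::complex_hilbert \<Rightarrow>\<^sub>L 'h) set \<Rightarrow> (('k \<Rightarrow>\<^sub>L 'k) \<Rightarrow> ('h \<Rightarrow>\<^sub>L 'h)) \<Rightarrow> bool"
where
  "completely_isometric_isomorphism A mul B \<phi> \<longleftrightarrow>
     bij_betw \<phi> A B \<and>
     (\<forall>a\<in>A. \<forall>b\<in>A. \<phi> (a + b) = \<phi> a + \<phi> b) \<and>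
     (\<forall>z. \<forall>a\<in>A. \<phi> (scaleC_op z a) = scaleC_op z (\<phi> a)) \<and>
     (\<forall>a\<in>A. \<forall>b\<in>A. \<phi> (mul a b) = \<phi> a o\<^sub>L \<phi> b) \<and>
     (\<forall>n\<ge>1. \<forall>x\<in>Mat n A. matnorm n (\<lambda>i j. \<phi> (x i j)) = matnorm n x)"

definition is_operator_algebra_on ::
  "'h::complex_hilbert itself \<Rightarrow> ('k::complex_hilbert \<Rightarrow>\<^sub>L 'k) set \<Rightarrow>
   (('k \<Rightarrow>\<^sub>L 'k) \<Rightarrow> ('k \<Rightarrow>\<^sub>L 'k) \<Rightarrow> ('k \<Rightarrow>\<^sub>L 'k)) \<Rightarrow> bool"
where
  "is_operator_algebra_on (_ :: 'h itself) A mul \<longleftrightarrow>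
     (\<exists>(B :: ('h \<Rightarrow>\<^sub>L 'h) set) \<phi>.
        concrete_operator_algebra B \<and> completely_isometric_isomorphism A mul B \<phi>)"

text \<open>
  The Hilbert space on which \<open>A\<close> is to be represented is existentially quantified, and a
  quantifier cannot range over types; \<open>\<ell>\<^sup>2\<close> over the following index set is a host for all of them.
  Indeed, if \<open>A \<noteq> {0}\<close> is completely isometrically isomorphic to a subalgebra \<open>B\<close> of \<open>B(H)\<close>, then
  \<open>H\<close> has a closed subspace of Hilbert dimension at most \<open>card A\<close> which reduces \<open>B\<close> and on which
  the compressions have the same matrix norms; this subspace embeds isometrically in \<open>\<ell>\<^sup>2\<close>, and the
  operators are extended by 0 on the orthogonal complement.
\<close>

type_synonym 'k host = "('k \<Rightarrow>\<^sub>L 'k) set set ell2"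

definition oplus_Id_mult ::
  "('a \<Rightarrow> 'a \<Rightarrow> 'a::comm_monoid_add) \<Rightarrow> nat \<Rightarrow> (nat \<Rightarrow> nat \<Rightarrow> 'a) \<Rightarrow> (nat \<Rightarrow> nat \<Rightarrow> 'a) \<Rightarrow>
   (nat \<Rightarrow> nat \<Rightarrow> 'a)"
where
  "oplus_Id_mult mul n x y = (\<lambda>i j. if i < n then \<Sum>k<n. mul (x i k) (y k j) else y i j)"

text \<open>
  The factor \<open>max (matnorm n x) 1\<close> is the norm of \<open>x \<oplus> Id\<^sub>m\<close>. For \<open>x\<close> of norm at least 1 it is
  just \<open>matnorm n x\<close>, but it cannot be replaced by \<open>matnorm n x\<close> throughout, because the lower rows
  of \<open>y\<close> survive when \<open>x = 0\<close>; see \<open>naive_bound_imp_zero\<close> below.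
\<close>

definition oplus_Id_bound ::
  "('h::complex_hilbert \<Rightarrow>\<^sub>L 'h) set \<Rightarrow> (('h \<Rightarrow>\<^sub>L 'h) \<Rightarrow> ('h \<Rightarrow>\<^sub>L 'h) \<Rightarrow> ('h \<Rightarrow>\<^sub>L 'h)) \<Rightarrow> bool"
where
  "oplus_Id_bound A mul \<longleftrightarrow>
     (\<forall>n\<ge>1. \<forall>m\<ge>1. \<forall>x\<in>Mat n A. \<forall>y\<in>Mat (n + m) A.
        matnorm (n + m) (oplus_Id_mult mul n x y) \<le> max (matnorm n x) 1 * matnorm (n + m) y)"

lemma matnorm_bdd_above:
  fixes x :: "nat \<Rightarrow> nat \<Rightarrow> ('h::complex_hilbert \<Rightarrow>\<^sub>L 'h)"
  shows "bdd_above {L2_set (\<lambda>i. norm (\<Sum>j<n. blinfun_apply (x i j) (v j))) {..<n} |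
     v. L2_set (\<lambda>j. norm (v j)) {..<n} \<le> 1}"
proof (rule bdd_aboveI, clarify)
  fix v :: "nat \<Rightarrow> 'h" assume v: "L2_set (\<lambda>j. norm (v j)) {..<n} \<le> 1"
  have "norm (\<Sum>j<n. blinfun_apply (x i j) (v j)) \<le> (\<Sum>j<n. norm (x i j))" for i
  proof (rule sum_norm_le)
    fix j assume "j \<in> {..<n}"
    hence "norm (v j) \<le> 1"
      using member_le_L2_set[of "{..<n}" j "\<lambda>j. norm (v j)"] v by simp
    thus "norm (blinfun_apply (x i j) (v j)) \<le> norm (x i j)"
      using norm_blinfun[of "x i j" "v j"] mult_left_le[of "norm (v j)" "norm (x i j)"] by simp
  qed
  thus "L2_set (\<lambda>i. norm (\<Sum>j<n. blinfun_apply (x i j) (v j))) {..<n}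
          \<le> L2_set (\<lambda>i. \<Sum>j<n. norm (x i j)) {..<n}"
    by (intro L2_set_mono) simp_all
qed

lemma norm_entry_le_matnorm:
  fixes x :: "nat \<Rightarrow> nat \<Rightarrow> ('h::complex_hilbert \<Rightarrow>\<^sub>L 'h)"
  assumes "p < n" "q < n"
  shows "norm (x p q) \<le> matnorm n x"
proof -
  have unit: "norm (blinfun_apply (x p q) u) \<le> matnorm n x" if "norm u \<le> 1" for u
  proof -
    define v where "v = (\<lambda>j. if j = q then u else 0)"
    have "L2_set (\<lambda>j. norm (v j)) {..<n} = norm u"
      using assms by (simp add: L2_set_def v_def if_distrib[of norm] if_distrib[of "\<lambda>t. t\<^sup>2"]
          cong: if_cong)
    hence "L2_set (\<lambda>i. norm (\<Sum>j<n. blinfun_apply (x i j) (v j))) {..<n} \<le> matnorm n x"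
      unfolding matnorm_def using that by (intro cSup_upper matnorm_bdd_above) auto
    moreover have "(\<Sum>j<n. blinfun_apply (x p j) (v j)) = blinfun_apply (x p q) u"
      using assms by (simp add: v_def if_distrib[of "blinfun_apply _"] cong: if_cong)
    moreover have "norm (\<Sum>j<n. blinfun_apply (x p j) (v j))
        \<le> L2_set (\<lambda>i. norm (\<Sum>j<n. blinfun_apply (x i j) (v j))) {..<n}"
      using assms
        member_le_L2_set[of "{..<n}" p "\<lambda>i. norm (\<Sum>j<n. blinfun_apply (x i j) (v j))"]
      by simp
    ultimately show ?thesis by simp
  qed
  have nn: "0 \<le> matnorm n x" using unit[of 0] by simp
  show ?thesis
  proof (rule norm_blinfun_bound[OF nn])
    fix u show "norm (blinfun_apply (x p q) u) \<le> matnorm n x * norm u"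
    proof (cases "u = 0")
      case False
      have "norm (blinfun_apply (x p q) (u /\<^sub>R norm u)) \<le> matnorm n x"
        by (rule unit) (use False in simp)
      thus ?thesis using False by (simp add: blinfun.scaleR_right field_simps)
    qed simp
  qed
qed

lemma matnorm_zero: "matnorm n (\<lambda>_ _. 0 :: 'h::complex_hilbert \<Rightarrow>\<^sub>L 'h) = 0"
proof -
  have zero: "L2_set (\<lambda>i. norm (\<Sum>j<n. blinfun_apply (0 :: 'h \<Rightarrow>\<^sub>L 'h) (v j))) {..<n} = 0"
    for v :: "nat \<Rightarrow> 'h"
    by (rule L2_set_0') simp
  have "L2_set (\<lambda>j. norm ((\<lambda>_. 0 :: 'h) j)) {..<n} \<le> 1"
    by (rule order_trans[OF eq_refl[OF L2_set_0']]) simp_all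
  hence "\<exists>v :: nat \<Rightarrow> 'h. L2_set (\<lambda>j. norm (v j)) {..<n} \<le> 1"
    by (rule exI[where P = "\<lambda>v :: nat \<Rightarrow> 'h. L2_set (\<lambda>j. norm (v j)) {..<n} \<le> 1"])
  hence "{0 :: real | v :: nat \<Rightarrow> 'h. L2_set (\<lambda>j. norm (v j)) {..<n} \<le> 1} = {0}"
    by blast
  thus ?thesis unfolding matnorm_def zero by (simp only: cSup_singleton)
qed

lemma naive_bound_imp_zero:
  assumes "operator_space A"
    and bound: "\<And>n m x y. \<lbrakk>n \<ge> 1; m \<ge> 1; x \<in> Mat n A; y \<in> Mat (n + m) A\<rbrakk> \<Longrightarrow>
      matnorm (n + m) (oplus_Id_mult mul n x y) \<le> matnorm n x * matnorm (n + m) y"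
  shows "A = {0}"
proof -
  have "0 \<in> A" using assms(1) by (simp add: operator_space_def)
  moreover have "a = 0" if "a \<in> A" for a
  proof -
    have "norm (oplus_Id_mult mul 1 (\<lambda>_ _. 0) (\<lambda>_ _. a) 1 1)
        \<le> matnorm (1 + 1) (oplus_Id_mult mul 1 (\<lambda>_ _. 0) (\<lambda>_ _. a))"
      by (rule norm_entry_le_matnorm) auto
    also have "\<dots> \<le> matnorm 1 (\<lambda>_ _. 0 :: 'a \<Rightarrow>\<^sub>L 'a) * matnorm (1 + 1) (\<lambda>_ _. a)"
      by (rule bound) (use that \<open>0 \<in> A\<close> in \<open>auto simp: Mat_def\<close>)
    finally show ?thesis by (simp add: matnorm_zero oplus_Id_mult_def)
  qed
  ultimately show ?thesis by auto
qed

end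

theory Submission
  imports Defs "HOL-Library.Poly_Mapping"
begin

text \<open>
  If \<open>A\<close> is an algebra of operators, then \<open>(x \<oplus> Id\<^sub>m) y\<close> is the product of \<open>y\<close> with a block diagonal
  operator of norm \<open>max \<parallel>x\<parallel> 1\<close>; this gives the bound. The converse needs a Hilbert space on which
  \<open>A\<close> acts by left multiplication, such that every matrix \<open>x\<close> over \<open>A\<close> acts with norm exactly
  \<open>\<parallel>x\<parallel>\<close>.

  Let \<open>A\<close> consist of operators on \<open>K\<close>. Every \<open>\<xi>\<close> in the unit ball of \<open>K\<^sup>p\<close> defines a positive form
  \<open>s\<^sub>\<xi>(u, v) = \<langle>u \<xi>, v \<xi>\<rangle>\<close> on the space \<open>A\<^sup>p\<close> of rows. The supremum over \<open>\<xi>\<close> of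
  \<open>s\<^sub>\<xi>(w) = \<Sum>\<^sub>i s\<^sub>\<xi>(w\<^sub>i, w\<^sub>i)\<close> is the squared norm of the column \<open>w\<close> of rows, so these forms see all
  matrix norms; but for a contractive matrix \<open>x\<close> over \<open>A\<close> the inequality \<open>s\<^sub>\<xi>(x v) \<le> s\<^sub>\<xi>(v)\<close> may fail.
  The bound says that it holds after taking suprema, even in the presence of further rows:
  \<open>sup\<^sub>\<xi> (s\<^sub>\<xi>(x v) + s\<^sub>\<xi>(w)) \<le> sup\<^sub>\<xi> (s\<^sub>\<xi>(v) + s\<^sub>\<xi>(w))\<close> for every column \<open>w\<close>
  (\<open>majorizing_unit_ball\<close>). The further rows are what makes the difference. A large multiple of
  \<open>w\<close> forces \<open>\<xi>\<close> into the face on which \<open>s\<^sub>\<xi>(w)\<close> is nearly maximal, and the inequality of suprema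
  survives the restriction to this face (\<open>majorizing_top_face\<close>). By Zorn's lemma the faces can be
  shrunk until \<open>s\<^sub>\<xi>(w)\<close> converges for every \<open>w\<close>; then the suprema are limits, and the limit form
  satisfies \<open>s(x v) \<le> s(v)\<close>. If the first face belongs to the rows of a matrix \<open>x\<^sub>0\<close>, then
  also \<open>s(x\<^sub>0) = \<parallel>x\<^sub>0\<parallel>\<^sup>2\<close> (\<open>converging_filter_exists\<close>, \<open>contractive_form_exists\<close>).

  The direct sum of these limit forms over all \<open>p\<close> and \<open>x\<^sub>0\<close> is embedded isometrically into a
  sequence space by a transfinite Gram-Schmidt process (\<open>isometric_embedding\<close>), where left
  multiplication extends to a representation of \<open>A\<close>. It is completely contractive by the
  inequality for \<open>s\<close>. It is completely isometric because \<open>x\<^sub>0\<close> maps the contractive vector with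
  entries \<open>e\<^sub>t \<otimes> \<epsilon>\<^sub>j\<close>, where \<open>(e\<^sub>t)\<close> is the right approximate identity, to vectors that approach the rows
  of \<open>x\<^sub>0\<close>, whose norm is \<open>\<parallel>x\<^sub>0\<parallel>\<close> (\<open>matnorm_rep_ge\<close>). The embedding uses at most one coordinate
  for each vector of the direct sum, and counting these vectors shows that sets of sets of operators
  suffice as coordinates (\<open>vectors_index\<close>).
\<close>

section \<open>Faces of a family of functions along a filter\<close>

text \<open>
  Zorn's lemma for filters: finer filters are smaller, and the infimum of a chain is its coarsest
  common refinement.
\<close>

lemma minimal_filter_exists:
  fixes F0 :: "'x filter"
  assumes "Q F0"
    and inf: "\<And>C. \<lbrakk>C \<noteq> {}; \<And>F. F \<in> C \<Longrightarrow> Q F; \<And>F G. F \<in> C \<Longrightarrow> G \<in> C \<Longrightarrow> F \<le> G \<or> G \<le> F\<rbrakk> \<Longrightarrow> Q (Inf C)"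
  obtains F where "F \<le> F0" "Q F" "\<And>G. G \<le> F \<Longrightarrow> Q G \<Longrightarrow> G = F"
proof -
  define S where "S = {F. F \<le> F0 \<and> Q F}"
  have "\<exists>m\<in>S. \<forall>a\<in>S. a \<le> m \<longrightarrow> a = m"
  proof (rule predicate_Zorn)
    show "partial_order_on S (relation_of (\<lambda>a b. b \<le> a) S)"
      by (rule partial_order_on_relation_ofI) auto
    fix C assume "C \<in> Chains (relation_of (\<lambda>a b. b \<le> a) S)"
    hence C: "F \<in> S" "F \<le> G \<or> G \<le> F" if "F \<in> C" "G \<in> C" for F G
      using that unfolding Chains_def relation_of_def by blast+
    show "\<exists>u\<in>S. \<forall>a\<in>C. u \<le> a"
    proof (cases "C = {}")
      case True
      thus ?thesis using \<open>Q F0\<close> by (auto simp: S_def)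
    next
      case False
      have "Q (Inf C)" by (rule inf[OF False]) (use C in \<open>auto simp: S_def\<close>)
      moreover have "Inf C \<le> F0"
        using False C unfolding S_def by (metis (no_types, lifting) Inf_lower2 equals0I mem_Collect_eq)
      ultimately show ?thesis by (intro bexI[of _ "Inf C"]) (auto simp: S_def Inf_lower)
    qed
  qed
  thus ?thesis using that unfolding S_def by (metis (no_types, lifting) mem_Collect_eq order_trans)
qed

text \<open>
  The filter \<open>F\<close> plays the role of a compact set of points, and eventual upper bounds that of
  suprema over this set: up to an arbitrarily small error, \<open>sup (g + k) \<le> sup (h + k)\<close> for all
  \<open>(g, h) \<in> R\<close> and all test functions \<open>k \<in> K\<close>. Stated through eventual bounds, it makes sense for
  arbitrary points and before any limit is known to exist.
\<close>

definition majorizing ::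
  "('x \<Rightarrow> real) set \<Rightarrow> (('x \<Rightarrow> real) \<times> ('x \<Rightarrow> real)) set \<Rightarrow> 'x filter \<Rightarrow> bool"
where
  "majorizing K R F \<longleftrightarrow> (\<forall>(g, h)\<in>R. \<forall>k\<in>K. \<forall>c c'. c < c' \<longrightarrow>
     (\<forall>\<^sub>F x in F. h x + k x \<le> c) \<longrightarrow> (\<forall>\<^sub>F x in F. g x + k x \<le> c'))"

lemma majorizingD:
  assumes "majorizing K R F" "(g, h) \<in> R" "k \<in> K" "c < c'" "\<forall>\<^sub>F x in F. h x + k x \<le> c"
  shows "\<forall>\<^sub>F x in F. g x + k x \<le> c'"
  using assms unfolding majorizing_def by blast

text \<open>
  The number \<open>L\<close> is the limes superior of \<open>w\<close> along \<open>F\<close>.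
\<close>

definition upper_limit :: "('x \<Rightarrow> real) \<Rightarrow> 'x filter \<Rightarrow> real \<Rightarrow> bool" where
  "upper_limit w F L \<longleftrightarrow>
     (\<forall>e>0. (\<forall>\<^sub>F x in F. w x \<le> L + e) \<and> (\<exists>\<^sub>F x in F. L - e \<le> w x))"

text \<open>
  The face of \<open>F\<close> exposed by \<open>w\<close>: the points are restricted to those at which \<open>w\<close> comes close to its
  limes superior \<open>L\<close>.
\<close>

definition top_face :: "('x \<Rightarrow> real) \<Rightarrow> real \<Rightarrow> 'x filter \<Rightarrow> 'x filter" where
  "top_face w L F = (INF e\<in>{0<..}. inf F (principal {x. L - e \<le> w x}))"

lemma eventually_top_face:
  "eventually P (top_face w L F) \<longleftrightarrow> (\<exists>e>0. \<forall>\<^sub>F x in F. L - e \<le> w x \<longrightarrow> P x)"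
proof -
  have "eventually P (top_face w L F) \<longleftrightarrow>
      (\<exists>e\<in>{0<..}. eventually P (inf F (principal {x. L - e \<le> w x})))"
    unfolding top_face_def
  proof (rule eventually_INF_base)
    fix a b :: real assume "a \<in> {0<..}" "b \<in> {0<..}"
    thus "\<exists>x\<in>{0<..}. inf F (principal {y. L - x \<le> w y})
        \<le> inf (inf F (principal {y. L - a \<le> w y})) (inf F (principal {y. L - b \<le> w y}))"
      by (intro bexI[of _ "min a b"]) (auto intro!: le_infI2 simp: le_infI1)
  qed auto
  thus ?thesis by (auto simp: eventually_inf_principal)
qed

lemma top_face_le: "top_face w L F \<le> F"
  by (rule filter_leI) (auto simp: eventually_top_face intro: exI[of _ 1] elim: eventually_mono)

lemma top_face_not_bot:
  assumes "upper_limit w F L"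
  shows "top_face w L F \<noteq> bot"
proof
  assume "top_face w L F = bot"
  hence "eventually (\<lambda>_. False) (top_face w L F)" by simp
  thus False using assms by (auto simp: eventually_top_face upper_limit_def frequently_def)
qed

lemma tendsto_top_face:
  assumes "upper_limit w F L"
  shows "(w \<longlongrightarrow> L) (top_face w L F)"
proof (rule tendstoI)
  fix e :: real assume "e > 0"
  hence "\<forall>\<^sub>F x in F. w x \<le> L + e / 2" using assms by (auto simp: upper_limit_def)
  hence "\<forall>\<^sub>F x in F. L - e / 2 \<le> w x \<longrightarrow> dist (w x) L < e"
    by eventually_elim (use \<open>e > 0\<close> in \<open>auto simp: dist_real_def\<close>)
  thus "\<forall>\<^sub>F x in top_face w L F. dist (w x) L < e"
    unfolding eventually_top_face using \<open>e > 0\<close> half_gt_zero by blast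
qed

lemma upper_limit_exists:
  assumes "F \<noteq> bot" and M: "\<forall>\<^sub>F x in F. \<bar>w x\<bar> \<le> M"
  obtains L where "upper_limit w F L"
proof -
  define S where "S = {c. \<forall>\<^sub>F x in F. w x \<le> c}"
  have "M \<in> S" unfolding S_def using M by (auto elim: eventually_mono)
  have low: "- M \<le> c" if "c \<in> S" for c
  proof (rule ccontr)
    assume "\<not> - M \<le> c"
    have "\<forall>\<^sub>F x in F. w x \<le> c" using that by (simp add: S_def)
    with M have "\<forall>\<^sub>F x in F. False" by eventually_elim (use \<open>\<not> - M \<le> c\<close> in auto)
    thus False using \<open>F \<noteq> bot\<close> by simp
  qed
  have bdd: "bdd_below S" using low by (auto simp: bdd_below_def)
  have "upper_limit w F (Inf S)"
    unfolding upper_limit_def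
  proof (intro allI impI conjI)
    fix e :: real assume "e > 0"
    then obtain c where "c \<in> S" "c < Inf S + e"
      using cInf_lessD[of S "Inf S + e"] \<open>M \<in> S\<close> by auto
    thus "\<forall>\<^sub>F x in F. w x \<le> Inf S + e" by (auto simp: S_def elim: eventually_mono)
    show "\<exists>\<^sub>F x in F. Inf S - e \<le> w x"
    proof (rule ccontr)
      assume "\<not> (\<exists>\<^sub>F x in F. Inf S - e \<le> w x)"
      hence "Inf S - e \<in> S" unfolding S_def frequently_def by (auto elim: eventually_mono)
      hence "Inf S \<le> Inf S - e" using bdd by (rule cInf_lower)
      thus False using \<open>e > 0\<close> by simp
    qed
  qed
  thus ?thesis ..
qed

text \<open>
  A bound \<open>h + k \<le> c\<close> on the face extends to a bound of \<open>h + (k + t w)\<close> on all of \<open>F\<close>, once \<open>t\<close> is so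
  large that the loss \<open>t e\<close> away from the face outweighs any excess of \<open>h + k\<close>. As \<open>k + t w\<close> is
  again a test function, \<open>h\<close> may be replaced by \<open>g\<close> there, and returning to the face, where
  \<open>t w\<close> is nearly \<open>t L\<close>, removes the extra term.
\<close>

lemma majorizing_top_face:
  assumes maj: "majorizing K R F"
    and w: "w \<in> K" "upper_limit w F L"
    and cone: "\<And>k t. k \<in> K \<Longrightarrow> t \<ge> 0 \<Longrightarrow> (\<lambda>x. k x + t * w x) \<in> K"
    and bdd: "\<And>g h k. (g, h) \<in> R \<Longrightarrow> k \<in> K \<Longrightarrow> \<exists>M. \<forall>\<^sub>F x in F. h x + k x \<le> M"
  shows "majorizing K R (top_face w L F)"
  unfolding majorizing_def
proof (clarify)
  fix g h k and c c' :: real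
  assume gh: "(g, h) \<in> R" and k: "k \<in> K" and "c < c'"
    and "\<forall>\<^sub>F x in top_face w L F. h x + k x \<le> c"
  then obtain e where e: "e > 0" "\<forall>\<^sub>F x in F. L - e \<le> w x \<longrightarrow> h x + k x \<le> c"
    by (auto simp: eventually_top_face)
  obtain M where M: "\<forall>\<^sub>F x in F. h x + k x \<le> M" using bdd[OF gh k] by blast
  \<comment> \<open>The weight of \<open>w\<close>, chosen so that \<open>M - t e \<le> c\<close>; the tolerance \<open>d\<close> depends on it.\<close>
  define t where "t = (\<bar>M\<bar> + \<bar>c\<bar>) / e"
  have t: "t \<ge> 0" "M - t * e \<le> c" using e(1) by (auto simp: t_def)
  define r where "r = (c' - c) / 4"
  have r: "r > 0" "c' = c + 4 * r" using \<open>c < c'\<close> by (auto simp: r_def field_simps)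
  define d where "d = r / (t + 1)"
  have d: "d > 0" using r t by (auto simp: d_def)
  have td: "t * d \<le> r"
  proof -
    have "t * d \<le> (t + 1) * d" using d by simp
    also have "\<dots> = r" using t by (simp add: d_def)
    finally show ?thesis .
  qed
  have "\<forall>\<^sub>F x in F. w x \<le> L + d" using w(2) d by (auto simp: upper_limit_def)
  with e(2) M have "\<forall>\<^sub>F x in F. h x + (k x + t * w x) \<le> c + t * L + t * d"
  proof eventually_elim
    case (elim x)
    show ?case
    proof (cases "L - e \<le> w x")
      case True
      hence "h x + k x \<le> c" using elim by simp
      moreover have "t * w x \<le> t * (L + d)" using elim t by (intro mult_left_mono) auto
      ultimately show ?thesis by (simp add: distrib_left)
    next
      case False
      hence "t * w x \<le> t * (L - e)" using t by (intro mult_left_mono) auto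
      moreover have "0 \<le> t * d" using t d by simp
      ultimately show ?thesis using elim t by (simp add: right_diff_distrib)
    qed
  qed
  moreover have "c + t * L + t * d < c + t * L + t * d + r" using r by simp
  ultimately have "\<forall>\<^sub>F x in F. g x + (k x + t * w x) \<le> c + t * L + t * d + r"
    using majorizingD[OF maj gh cone[OF k t(1)]] by blast
  hence "\<forall>\<^sub>F x in F. L - d \<le> w x \<longrightarrow> g x + k x \<le> c'"
  proof eventually_elim
    case (elim x)
    show ?case
    proof
      assume "L - d \<le> w x"
      hence "t * (L - d) \<le> t * w x" using t by (intro mult_left_mono)
      hence "t * L - t * d \<le> t * w x" by (simp add: right_diff_distrib)
      thus "g x + k x \<le> c'" using elim td r by linarith
    qed
  qed
  thus "\<forall>\<^sub>F x in top_face w L F. g x + k x \<le> c'"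
    unfolding eventually_top_face using d by blast
qed

text \<open>
  What holds eventually along the infimum of a chain holds eventually along some member, so
  both properties pass to the infimum.
\<close>

lemma majorizing_Inf_chain:
  assumes "C \<noteq> {}" and "\<And>F. F \<in> C \<Longrightarrow> majorizing K R F \<and> F \<noteq> bot"
    and chain: "\<And>F G. F \<in> C \<Longrightarrow> G \<in> C \<Longrightarrow> F \<le> G \<or> G \<le> F"
  shows "majorizing K R (Inf C) \<and> Inf C \<noteq> bot"
proof -
  have ev: "eventually P (Inf C) \<longleftrightarrow> (\<exists>F\<in>C. eventually P F)" for P
    by (rule eventually_Inf_base[OF assms(1)]) (use chain in \<open>metis inf.absorb_iff2 inf.orderE\<close>)
  have "majorizing K R (Inf C)"
    unfolding majorizing_def ev using assms(2) unfolding majorizing_def by fast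
  moreover have "\<not> eventually (\<lambda>_. False) (Inf C)" unfolding ev using assms(2) by simp
  ultimately show ?thesis by auto
qed

text \<open>
  Along a minimal majorizing filter every test function converges, since passing to its face
  changes nothing. The inequality between the upper bounds of \<open>g\<close> and \<open>h\<close> is then one between their
  limits.
\<close>

lemma converging_filter_exists:
  assumes "majorizing K R F0" "F0 \<noteq> bot"
    and cone: "\<And>k w t. k \<in> K \<Longrightarrow> w \<in> K \<Longrightarrow> t \<ge> 0 \<Longrightarrow> (\<lambda>x. k x + t * w x) \<in> K"
    and zero: "(\<lambda>_. 0) \<in> K"
    and R: "R \<subseteq> K \<times> K"
    and bdd: "\<And>k. k \<in> K \<Longrightarrow> \<exists>M. \<forall>\<^sub>F x in F0. \<bar>k x\<bar> \<le> M"
    and k0: "k0 \<in> K" "upper_limit k0 F0 L0"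
  obtains F where "F \<le> F0" "F \<noteq> bot" "(k0 \<longlongrightarrow> L0) F"
    "\<And>k. k \<in> K \<Longrightarrow> \<exists>L. (k \<longlongrightarrow> L) F"
    "\<And>g h a b. (g, h) \<in> R \<Longrightarrow> (g \<longlongrightarrow> a) F \<Longrightarrow> (h \<longlongrightarrow> b) F \<Longrightarrow> a \<le> b"
proof -
  have face: "majorizing K R (top_face w L G) \<and> top_face w L G \<noteq> bot"
    if "G \<le> F0" "majorizing K R G" "w \<in> K" "upper_limit w G L" for G w L
  proof -
    have "\<exists>M. \<forall>\<^sub>F x in G. h x + k x \<le> M" if "(g, h) \<in> R" "k \<in> K" for g h k
    proof -
      have "(\<lambda>x. h x + 1 * k x) \<in> K" using that R by (intro cone) auto
      from bdd[OF this] obtain M where "\<forall>\<^sub>F x in F0. \<bar>h x + 1 * k x\<bar> \<le> M" by blast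
      hence "\<forall>\<^sub>F x in F0. h x + k x \<le> M" by eventually_elim auto
      thus ?thesis using \<open>G \<le> F0\<close> by (auto simp: le_filter_def)
    qed
    thus ?thesis
      using majorizing_top_face[OF that(2-4) cone[OF _ that(3)]] top_face_not_bot[OF that(4)] by blast
  qed
  define F1 where "F1 = top_face k0 L0 F0"
  have F1: "majorizing K R F1 \<and> F1 \<noteq> bot" unfolding F1_def by (rule face) (use assms in auto)
  obtain F where F: "F \<le> F1" "majorizing K R F \<and> F \<noteq> bot"
    and minimal: "\<And>G. G \<le> F \<Longrightarrow> majorizing K R G \<and> G \<noteq> bot \<Longrightarrow> G = F"
    using minimal_filter_exists[of "\<lambda>F. majorizing K R F \<and> F \<noteq> bot", OF F1 majorizing_Inf_chain] by blast
  have "F \<le> F0" using F(1) top_face_le unfolding F1_def by (rule order_trans)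
  show ?thesis
  proof
    show "F \<le> F0" "F \<noteq> bot" by fact (use F in simp)
    show "(k0 \<longlongrightarrow> L0) F"
      using tendsto_top_face[OF k0(2)] F(1) unfolding F1_def by (rule tendsto_mono[rotated])
    show "\<exists>L. (k \<longlongrightarrow> L) F" if k: "k \<in> K" for k
    proof -
      obtain M where "\<forall>\<^sub>F x in F0. \<bar>k x\<bar> \<le> M" using bdd[OF k] by blast
      hence "\<forall>\<^sub>F x in F. \<bar>k x\<bar> \<le> M" using \<open>F \<le> F0\<close> by (simp add: le_filter_def)
      then obtain L where L: "upper_limit k F L" using upper_limit_exists F(2) by blast
      have "top_face k L F = F"
        by (rule minimal[OF top_face_le]) (use face[OF \<open>F \<le> F0\<close> _ k L] F in blast)
      thus ?thesis using tendsto_top_face[OF L] by auto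
    qed
    fix g h a b assume gh: "(g, h) \<in> R" and a: "(g \<longlongrightarrow> a) F" and b: "(h \<longlongrightarrow> b) F"
    show "a \<le> b"
    proof (rule dense_ge)
      fix c' assume "b < c'"
      then obtain c where "b < c" "c < c'" using dense by blast
      have "\<forall>\<^sub>F x in F. h x + 0 \<le> c"
        using order_tendstoD(2)[OF b \<open>b < c\<close>] by eventually_elim simp
      hence "\<forall>\<^sub>F x in F. g x + 0 \<le> c'"
        using majorizingD[OF _ gh zero \<open>c < c'\<close>] F(2) by blast
      thus "a \<le> c'" using tendsto_upperbound[OF a] F(2) by simp
    qed
  qed
qed

section \<open>Semi-inner product spaces and Hilbert spaces\<close>

text \<open>
  The minimum of the quadratic expression over \<open>t\<close> is attained at \<open>t = - b / C\<close>. Both the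
  Cauchy-Schwarz inequality and the near-orthogonality of near-minimizers of a distance are
  instances.
\<close>

lemma discriminant_bound:
  fixes b :: complex
  assumes "A \<ge> 0" "C \<ge> 0" and pos: "\<And>t. 0 \<le> A + 2 * Re (cnj t * b) + (cmod t)\<^sup>2 * C"
  shows "(cmod b)\<^sup>2 \<le> A * C"
proof -
  have r: "0 \<le> A - 2 * r * (cmod b)\<^sup>2 + r\<^sup>2 * (cmod b)\<^sup>2 * C" for r :: real
    using pos[of "- of_real r * b"]
    by (simp add: norm_mult power_mult_distrib cmod_power2 flip: power2_eq_square)
       (simp add: power2_eq_square algebra_simps)
  show ?thesis
  proof (cases "C = 0")
    case True
    have "(cmod b)\<^sup>2 = 0"
    proof (rule ccontr)
      assume ne: "(cmod b)\<^sup>2 \<noteq> 0"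
      have "0 \<le> A - 2 * ((A + 1) / (2 * (cmod b)\<^sup>2)) * (cmod b)\<^sup>2"
        using r[of "(A + 1) / (2 * (cmod b)\<^sup>2)"] True by simp
      also have "\<dots> = -1" using ne by (simp add: field_simps)
      finally show False by simp
    qed
    thus ?thesis using True by simp
  next
    case False
    hence "C > 0" using assms by simp
    have "0 \<le> A - 2 * (1 / C) * (cmod b)\<^sup>2 + (1 / C)\<^sup>2 * (cmod b)\<^sup>2 * C" by (rule r)
    also have "\<dots> = A - (cmod b)\<^sup>2 / C" using \<open>C > 0\<close> by (simp add: field_simps power2_eq_square)
    finally show ?thesis using \<open>C > 0\<close> by (simp add: field_simps)
  qed
qed

text \<open>
  The space is a subset \<open>V\<close> of a type, and the form may be degenerate: it will be a direct sum of
  forms on the elements of a given operator space, which is only known as a set.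
\<close>

locale semi_inner_space = vector_space scale
  for scale :: "complex \<Rightarrow> 'v::ab_group_add \<Rightarrow> 'v" +
  fixes V :: "'v set" and ip :: "'v \<Rightarrow> 'v \<Rightarrow> complex"
  assumes subspace_V: "subspace V"
    and ip_add_left: "\<lbrakk>x \<in> V; y \<in> V; z \<in> V\<rbrakk> \<Longrightarrow> ip (x + y) z = ip x z + ip y z"
    and ip_scale_left: "\<lbrakk>x \<in> V; y \<in> V\<rbrakk> \<Longrightarrow> ip (scale c x) y = c * ip x y"
    and ip_commute: "\<lbrakk>x \<in> V; y \<in> V\<rbrakk> \<Longrightarrow> ip x y = cnj (ip y x)"
    and ip_nonneg: "x \<in> V \<Longrightarrow> 0 \<le> Re (ip x x)"
begin

lemmas V_closed = subspace_0[OF subspace_V] subspace_add[OF subspace_V]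
  subspace_scale[OF subspace_V] subspace_diff[OF subspace_V] subspace_neg[OF subspace_V]

lemma ip_add_right: "\<lbrakk>x \<in> V; y \<in> V; z \<in> V\<rbrakk> \<Longrightarrow> ip x (y + z) = ip x y + ip x z"
  by (metis V_closed(2) complex_cnj_add ip_add_left ip_commute)

lemma ip_scale_right: "\<lbrakk>x \<in> V; y \<in> V\<rbrakk> \<Longrightarrow> ip x (scale c y) = cnj c * ip x y"
  by (metis V_closed(3) complex_cnj_mult ip_scale_left ip_commute)

lemma ip_diff_left: "\<lbrakk>x \<in> V; y \<in> V; z \<in> V\<rbrakk> \<Longrightarrow> ip (x - y) z = ip x z - ip y z"
  by (metis V_closed(4) add_diff_cancel_right' diff_add_cancel ip_add_left)

lemma ip_zero_left: "x \<in> V \<Longrightarrow> ip 0 x = 0"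
  using ip_diff_left[of x x x] by simp

lemma ip_self: "x \<in> V \<Longrightarrow> ip x x = of_real (Re (ip x x))"
  by (metis Reals_cnj_iff ip_commute of_real_Re)

lemma Re_ip_add_scale:
  assumes "x \<in> V" "y \<in> V"
  shows "Re (ip (x + scale t y) (x + scale t y)) =
    Re (ip x x) + 2 * Re (cnj t * ip x y) + (cmod t)\<^sup>2 * Re (ip y y)"
proof -
  have "ip (x + scale t y) (x + scale t y) =
      ip x x + cnj t * ip x y + cnj (cnj t * ip x y) + (t * cnj t) * ip y y"
    using assms ip_commute[of y x]
    by (simp add: ip_add_left ip_add_right ip_scale_left ip_scale_right V_closed algebra_simps)
  also have "t * cnj t = of_real ((cmod t)\<^sup>2)" by (simp only: complex_norm_square)
  finally show ?thesis by (simp del: complex_cnj_mult of_real_power)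
qed

lemma Cauchy_Schwarz:
  assumes "x \<in> V" "y \<in> V"
  shows "(cmod (ip x y))\<^sup>2 \<le> Re (ip x x) * Re (ip y y)"
proof (rule discriminant_bound)
  fix t
  show "0 \<le> Re (ip x x) + 2 * Re (cnj t * ip x y) + (cmod t)\<^sup>2 * Re (ip y y)"
    unfolding Re_ip_add_scale[OF assms, symmetric] by (intro ip_nonneg V_closed assms)
qed (use assms ip_nonneg in auto)

end

lemma scaleC_one [simp]: "1 *\<^sub>C (x :: 'a::complex_hilbert) = x"
  using scaleR_scaleC[of 1 x] by simp

lemma scaleC_0 [simp]: "c *\<^sub>C (0 :: 'a::complex_hilbert) = 0"
  using norm_scaleC[of c "0::'a"] by simp

lemma scaleC_zero_left [simp]: "0 *\<^sub>C (x :: 'a::complex_hilbert) = 0"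
  using norm_scaleC[of 0 x] by simp

lemma vector_space_scaleC: "vector_space ((*\<^sub>C) :: complex \<Rightarrow> 'a::complex_hilbert \<Rightarrow> 'a)"
  by unfold_locales (simp_all add: scaleC_add_left scaleC_add_right scaleC_scaleC)

interpretation hilbert: semi_inner_space "(*\<^sub>C) :: complex \<Rightarrow> 'a::complex_hilbert \<Rightarrow> 'a" UNIV cinner
proof -
  interpret vector_space "(*\<^sub>C) :: complex \<Rightarrow> 'a \<Rightarrow> 'a" by (rule vector_space_scaleC)
  show "semi_inner_space ((*\<^sub>C) :: complex \<Rightarrow> 'a \<Rightarrow> 'a) UNIV cinner"
    by unfold_locales
      (simp_all add: cinner_add_left cinner_scaleC_left cinner_self subspace_UNIV flip: cinner_commute)
qed

lemma cinner_bound: "cmod (cinner x y) \<le> norm x * norm (y :: 'a::complex_hilbert)"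
  using hilbert.Cauchy_Schwarz[of x y]
  by (simp add: cinner_self flip: power_mult_distrib of_real_power)

lemma bounded_linear_cinner_left: "bounded_linear (\<lambda>x. cinner x (y :: 'a::complex_hilbert))"
  by (rule bounded_linear_intro[where K = "norm y"])
    (simp_all add: cinner_add_left scaleR_scaleC cinner_scaleC_left scaleR_conv_of_real cinner_bound)

lemma bounded_linear_cinner_right: "bounded_linear (cinner (x :: 'a::complex_hilbert))"
  by (rule bounded_linear_intro[where K = "norm x"])
    (simp_all add: hilbert.ip_add_right scaleR_scaleC hilbert.ip_scale_right scaleR_conv_of_real
      cinner_bound mult.commute[of _ "norm x"])

lemma norm_diff_square:
  "(norm (x - y))\<^sup>2 = (norm x)\<^sup>2 - 2 * Re (cinner x y) + (norm (y :: 'a::complex_hilbert))\<^sup>2"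
  using hilbert.Re_ip_add_scale[of x y "-1"] by (simp add: cinner_self flip: of_real_power)

lemma hilbert_subspace_closure:
  assumes D: "hilbert.subspace (D :: 'a::complex_hilbert set)"
  shows "hilbert.subspace (closure D)"
  unfolding hilbert.subspace_def
proof (intro conjI ballI allI)
  show "0 \<in> closure D" using hilbert.subspace_0[OF D] closure_subset by auto
  fix x c assume "x \<in> closure D"
  then obtain X where X: "\<And>n. X n \<in> D" "X \<longlonglongrightarrow> x" by (auto simp: closure_sequential)
  have "(\<lambda>n. c *\<^sub>C X n) \<longlonglongrightarrow> c *\<^sub>C x"
    using bounded_linear.tendsto[OF bounded_linear_scaleC X(2)] .
  thus "c *\<^sub>C x \<in> closure D"
    unfolding closure_sequential using hilbert.subspace_scale[OF D X(1)]
    by (auto intro!: exI[of _ "\<lambda>n. c *\<^sub>C X n"])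
  fix y assume "y \<in> closure D"
  then obtain Y where "\<And>n. Y n \<in> D" "Y \<longlonglongrightarrow> y" by (auto simp: closure_sequential)
  thus "x + y \<in> closure D"
    unfolding closure_sequential using hilbert.subspace_add[OF D] X
    by (auto intro!: exI[of _ "\<lambda>n. X n + Y n"] tendsto_add)
qed

lift_definition ell2_unit :: "'i \<Rightarrow> 'i ell2" is "\<lambda>i j. if j = i then 1 else 0"
  by (rule finite_nonzero_values_imp_summable_on)
    (rule finite_subset[of _ "{i}" for i], auto split: if_splits)

lift_definition ell2_restrict :: "'i set \<Rightarrow> 'i ell2 \<Rightarrow> 'i ell2" is
  "\<lambda>J x i. if i \<in> J then x i else 0"
  by (erule summable_on_comparison_test) auto

lemma norm_ell2_square: "(norm (x :: 'i ell2))\<^sup>2 = (\<Sum>\<^sub>\<infinity>i. (cmod (ell2_coord x i))\<^sup>2)"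
  by (simp add: norm_ell2.rep_eq infsum_nonneg)

lemma cinner_ell2_unit: "cinner x (ell2_unit i) = ell2_coord x i"
proof -
  have "cinner x (ell2_unit i) = (\<Sum>\<^sub>\<infinity>j. ell2_coord x j * cnj (if j = i then 1 else 0))"
    by (simp add: cinner_ell2.rep_eq ell2_unit.rep_eq)
  also have "\<dots> = (\<Sum>\<^sub>\<infinity>j\<in>{i}. ell2_coord x j)"
    by (rule infsum_cong_neutral) auto
  finally show ?thesis by simp
qed

lemma norm_ell2_unit [simp]: "norm (ell2_unit i) = 1"
proof -
  have "complex_of_real ((norm (ell2_unit i))\<^sup>2) = 1"
    by (simp only: cinner_ell2_unit flip: cinner_self) (simp add: ell2_unit.rep_eq)
  hence "(norm (ell2_unit i))\<^sup>2 = 1" by (simp only: of_real_eq_1_iff)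
  thus ?thesis by (simp add: power2_eq_1_iff) (use norm_ge_zero[of "ell2_unit i"] in linarith)
qed

lemma tendsto_ell2_coord:
  "(X \<longlongrightarrow> x) F \<Longrightarrow> ((\<lambda>n. ell2_coord (X n) i) \<longlongrightarrow> ell2_coord x i) F"
  unfolding cinner_ell2_unit[symmetric]
  by (rule bounded_linear.tendsto[OF bounded_linear_cinner_left])

lemma norm_ell2_restrict: "norm (ell2_restrict J x) \<le> norm x"
proof -
  have "(norm (ell2_restrict J x))\<^sup>2 \<le> (norm x)\<^sup>2"
    unfolding norm_ell2_square ell2_restrict.rep_eq
  proof (rule infsum_mono)
    show "(\<lambda>i. (cmod (ell2_coord x i))\<^sup>2) summable_on UNIV" using ell2_coord by blast
    show "(\<lambda>i. (cmod (if i \<in> J then ell2_coord x i else 0))\<^sup>2) summable_on UNIV"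
      using ell2_coord[of "ell2_restrict J x"] by (simp add: ell2_restrict.rep_eq)
  qed auto
  thus ?thesis by simp
qed

lemma ell2_restrict_add: "ell2_restrict J (x + y) = ell2_restrict J x + ell2_restrict J y"
  by transfer (auto simp: fun_eq_iff)

lemma ell2_restrict_scaleC: "ell2_restrict J (c *\<^sub>C x) = c *\<^sub>C ell2_restrict J x"
  by transfer (auto simp: fun_eq_iff)

lemma ell2_restrict_ident:
  "(\<And>i. i \<notin> J \<Longrightarrow> ell2_coord x i = 0) \<Longrightarrow> ell2_restrict J x = x"
  by transfer (auto simp: fun_eq_iff)

lemma ell2_restrict_insert:
  "i \<notin> F \<Longrightarrow> ell2_restrict (insert i F) x = ell2_restrict F x + ell2_coord x i *\<^sub>C ell2_unit i"
  by transfer (auto simp: fun_eq_iff)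

lemma ell2_restrict_finite_approx:
  assumes "e > 0"
  obtains F where "finite F" "F \<subseteq> J" "dist (ell2_restrict F x) (ell2_restrict J x) < e"
proof -
  let ?f = "\<lambda>i. (cmod (ell2_coord x i))\<^sup>2"
  have s: "?f summable_on A" for A
    using ell2_coord[of x] by (auto intro: summable_on_subset_banach)
  obtain F where F: "finite F" "F \<subseteq> J" "dist (sum ?f F) (infsum ?f J) < e\<^sup>2"
  proof -
    have "e\<^sup>2 / 2 > 0" "e\<^sup>2 / 2 < e\<^sup>2" using \<open>e > 0\<close> by auto
    thus ?thesis
      using that has_sum_finite_approximation[OF has_sum_infsum[OF s], of "e\<^sup>2 / 2" J]
      by (meson le_less_trans)
  qed
  have "(norm (ell2_restrict F x - ell2_restrict J x))\<^sup>2 = infsum ?f (J - F)"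
    unfolding norm_ell2_square minus_ell2.rep_eq ell2_restrict.rep_eq
    by (rule infsum_cong_neutral) (use F in auto)
  also have "\<dots> = infsum ?f J - sum ?f F"
    using F by (subst infsum_Diff) (auto intro: s)
  also have "\<dots> < e\<^sup>2" using F(3) by (auto simp: dist_real_def)
  finally show ?thesis
    using that F \<open>e > 0\<close> by (simp add: dist_norm power2_less_imp_less)
qed

text \<open>
  The finite partial sums of the coordinate expansion over \<open>J\<close> lie in the closure and converge to
  the restriction. For the embedding below, restriction to \<open>J\<close> is thereby the orthogonal projection
  onto the closed range.
\<close>

lemma ell2_restrict_in_closure:
  assumes D: "hilbert.subspace D" and J: "\<And>i. i \<in> J \<Longrightarrow> ell2_unit i \<in> closure D"
  shows "ell2_restrict J x \<in> closure D"
proof -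
  have "ell2_restrict F x \<in> closure D" if "finite F" "F \<subseteq> J" for F
    using that
  proof (induction F)
    case empty
    have "ell2_restrict {} x = 0" by transfer simp
    thus ?case using hilbert.subspace_0[OF D] closure_subset by auto
  next
    case (insert i F)
    thus ?case using J hilbert_subspace_closure[OF D]
      by (simp add: ell2_restrict_insert hilbert.subspace_add hilbert.subspace_scale)
  qed
  thus ?thesis
    by (metis closure_approachable closure_closure ell2_restrict_finite_approx)
qed

section \<open>Isometric embedding of semi-inner product spaces into sequence spaces\<close>

context semi_inner_space
begin

text \<open>
  A partial isometric embedding into \<open>\<ell>\<^sup>2\<close>, given by its graph so that unions of chains can be formed.
  The last clause controls the coordinates in use: they are indexed by vectors in the domain,
  so that a new vector comes with a fresh coordinate, and their unit vectors are limits of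
  vectors in the range, so that the closed range consists of all vectors supported on them.
\<close>

definition isometric_graph :: "('v \<Rightarrow> 'i) \<Rightarrow> ('v \<times> 'i ell2) set \<Rightarrow> bool" where
  "isometric_graph \<iota> G \<longleftrightarrow> (\<forall>v x. (v, x) \<in> G \<longrightarrow> v \<in> V) \<and> (0, 0) \<in> G \<and>
     (\<forall>v x w y c. (v, x) \<in> G \<longrightarrow> (w, y) \<in> G \<longrightarrow> (v + scale c w, x + c *\<^sub>C y) \<in> G) \<and>
     (\<forall>v x w y. (v, x) \<in> G \<longrightarrow> (w, y) \<in> G \<longrightarrow> cinner x y = ip v w) \<and>
     (\<forall>v x i. (v, x) \<in> G \<longrightarrow> ell2_coord x i \<noteq> 0 \<longrightarrow>
        i \<in> \<iota> ` fst ` G \<and> ell2_unit i \<in> closure (snd ` G))"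

lemma isometric_graphD:
  assumes "isometric_graph \<iota> G"
  shows "(v, x) \<in> G \<Longrightarrow> v \<in> V" "(0, 0) \<in> G"
    "(v, x) \<in> G \<Longrightarrow> (w, y) \<in> G \<Longrightarrow> (v + scale c w, x + c *\<^sub>C y) \<in> G"
    "(v, x) \<in> G \<Longrightarrow> (w, y) \<in> G \<Longrightarrow> cinner x y = ip v w"
    "(v, x) \<in> G \<Longrightarrow> ell2_coord x i \<noteq> 0 \<Longrightarrow> i \<in> \<iota> ` fst ` G"
    "(v, x) \<in> G \<Longrightarrow> ell2_coord x i \<noteq> 0 \<Longrightarrow> ell2_unit i \<in> closure (snd ` G)"
  using assms unfolding isometric_graph_def by blast+

lemma isometric_graph_minus:
  assumes "isometric_graph \<iota> G" "(v, x) \<in> G" "(w, y) \<in> G"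
  shows "(v - w, x - y) \<in> G"
  using isometric_graphD(3)[OF assms, of "-1"]
  by simp

lemma isometric_graph_norm:
  assumes "isometric_graph \<iota> G" "(v, x) \<in> G"
  shows "(norm x)\<^sup>2 = Re (ip v v)"
  using isometric_graphD(4)[OF assms assms(2)] cinner_self[of x] by (metis Re_complex_of_real)

lemma isometric_graph_Union:
  assumes "C \<noteq> {}" "\<And>G. G \<in> C \<Longrightarrow> isometric_graph \<iota> G"
    and chain: "\<And>G H. G \<in> C \<Longrightarrow> H \<in> C \<Longrightarrow> G \<subseteq> H \<or> H \<subseteq> G"
  shows "isometric_graph \<iota> (\<Union>C)"
proof -
  have common: "\<exists>G\<in>C. p \<in> G \<and> q \<in> G" if "p \<in> \<Union>C" "q \<in> \<Union>C" for p q
    using that chain by (meson UnionE subsetD)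
  note D = isometric_graphD[OF assms(2)]
  show ?thesis
    unfolding isometric_graph_def
  proof (intro conjI allI impI)
    show "(0, 0) \<in> \<Union>C" using assms(1) D(2) by blast
    fix v x assume vx: "(v, x) \<in> \<Union>C"
    show "v \<in> V" using vx D(1) by blast
    fix i assume "ell2_coord x i \<noteq> 0"
    with vx obtain G where G: "G \<in> C" "i \<in> \<iota> ` fst ` G" "ell2_unit i \<in> closure (snd ` G)"
      using D(5,6) by blast
    have "closure (snd ` G) \<subseteq> closure (snd ` \<Union>C)" by (rule closure_mono) (use G in blast)
    thus "i \<in> \<iota> ` fst ` \<Union>C" "ell2_unit i \<in> closure (snd ` \<Union>C)" using G by blast+
  next
    fix v x w y c assume vx: "(v, x) \<in> \<Union>C" and wy: "(w, y) \<in> \<Union>C"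
    then obtain G where G: "G \<in> C" "(v, x) \<in> G" "(w, y) \<in> G" using common by blast
    show "(v + scale c w, x + c *\<^sub>C y) \<in> \<Union>C" using D(3)[OF G] G(1) by blast
    show "cinner x y = ip v w" by (rule D(4)[OF G])
  qed
qed

text \<open>
  The image of the orthogonal projection of \<open>v\<close> onto the domain. Since the domain need not
  be complete, the projection itself need not exist; but vectors of the domain that nearly
  minimize the distance to \<open>v\<close> have Cauchy images, because their differences from \<open>v\<close> are nearly
  orthogonal to the domain.
\<close>

lemma isometric_graph_projection:
  assumes G: "isometric_graph \<iota> G" and v: "v \<in> V"
  obtains u where "u \<in> closure (snd ` G)" "\<And>w y. (w, y) \<in> G \<Longrightarrow> cinner u y = ip v w"
    "\<And>i. i \<notin> \<iota> ` fst ` G \<Longrightarrow> ell2_coord u i = 0"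
    "(norm u)\<^sup>2 \<le> Re (ip v v)"
proof -
  note [simp] = isometric_graphD(1)[OF G] v V_closed
  define q where "q x = Re (ip x x)" for x
  have q_nonneg: "q x \<ge> 0" if "x \<in> V" for x using ip_nonneg[OF that] by (simp add: q_def)
  define d where "d = Inf ((\<lambda>w. q (v - w)) ` fst ` G)"
  have bdd: "bdd_below ((\<lambda>w. q (v - w)) ` fst ` G)"
    by (rule bdd_belowI[of _ 0]) (auto intro!: q_nonneg)
  have d: "d \<le> q (v - w)" if "(w, y) \<in> G" for w y
    unfolding d_def by (rule cInf_lower[OF _ bdd]) (use that in force)
  have "\<exists>p\<in>G. q (v - fst p) < d + (inverse (Suc n))\<^sup>2" for n
  proof -
    have "\<exists>a\<in>(\<lambda>w. q (v - w)) ` fst ` G. a < d + (inverse (Suc n))\<^sup>2"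
      by (rule cInf_lessD) (use isometric_graphD(2)[OF G] in \<open>auto simp flip: d_def\<close>)
    thus ?thesis by blast
  qed
  then obtain p where p: "\<And>n. p n \<in> G" "\<And>n. q (v - fst (p n)) < d + (inverse (Suc n))\<^sup>2" by metis
  define w x where "w n = fst (p n)" and "x n = snd (p n)" for n
  have wx: "(w n, x n) \<in> G" and [simp]: "w n \<in> V" for n
    using p(1)[of n] isometric_graphD(1)[OF G, of "w n" "x n"] by (simp_all add: w_def x_def)
  have orth: "cmod (ip (v - w n) z) \<le> inverse (Suc n) * norm y" if z: "(z, y) \<in> G" for z y n
  proof -
    have [simp]: "z \<in> V" using z by simp
    have "(cmod (ip (v - w n) z))\<^sup>2 \<le> (q (v - w n) - d) * q z"
    proof (rule discriminant_bound)
      show "0 \<le> q (v - w n) - d" using d[OF wx] by simp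
      show "0 \<le> q z" by (simp add: q_nonneg)
      fix t
      have "(w n + scale (- t) z, x n + (- t) *\<^sub>C y) \<in> G" by (rule isometric_graphD(3)[OF G wx z])
      from d[OF this] have "d \<le> q (v - w n + scale t z)"
        by (simp add: algebra_simps)
      also have "\<dots> = q (v - w n) + 2 * Re (cnj t * ip (v - w n) z) + (cmod t)\<^sup>2 * q z"
        unfolding q_def by (rule Re_ip_add_scale) simp_all
      finally show "0 \<le> q (v - w n) - d + 2 * Re (cnj t * ip (v - w n) z) + (cmod t)\<^sup>2 * q z"
        by simp
    qed
    also have "\<dots> \<le> (inverse (Suc n))\<^sup>2 * q z"
      using p(2)[of n] by (intro mult_right_mono) (auto simp: w_def q_nonneg)
    also have "q z = (norm y)\<^sup>2" using isometric_graph_norm[OF G z] by (simp add: q_def)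
    finally have "(cmod (ip (v - w n) z))\<^sup>2 \<le> (inverse (Suc n) * norm y)\<^sup>2"
      by (simp only: power_mult_distrib)
    thus ?thesis by (rule power2_le_imp_le) simp
  qed
  have close: "norm (x n - x m) \<le> inverse (Suc n) + inverse (Suc m)" for n m
  proof (cases "x n = x m")
    case False
    let ?z = "w n - w m" and ?y = "x n - x m"
    have z: "(?z, ?y) \<in> G" using isometric_graph_minus[OF G wx wx] .
    have "of_real ((norm ?y)\<^sup>2) = ip ?z ?z"
      using isometric_graphD(4)[OF G z z] by (simp add: cinner_self)
    also have "\<dots> = ip (v - w m) ?z - ip (v - w n) ?z"
      by (simp flip: ip_diff_left)
    finally have "(norm ?y)\<^sup>2 = cmod (ip (v - w m) ?z - ip (v - w n) ?z)"
      by (metis abs_of_nonneg norm_of_real zero_le_power2)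
    also have "\<dots> \<le> cmod (ip (v - w m) ?z) + cmod (ip (v - w n) ?z)" by (rule norm_triangle_ineq4)
    also have "\<dots> \<le> (inverse (Suc n) + inverse (Suc m)) * norm ?y"
      using orth[OF z, of m] orth[OF z, of n] by (simp add: distrib_right)
    finally show ?thesis using False by (simp add: power2_eq_square)
  qed simp
  have inv: "(\<lambda>n. inverse (real (Suc n))) \<longlonglongrightarrow> 0" by (rule LIMSEQ_inverse_real_of_nat)
  have "Cauchy x"
  proof (rule metric_CauchyI)
    fix e :: real assume "e > 0"
    then obtain N where N: "\<And>n. n \<ge> N \<Longrightarrow> inverse (real (Suc n)) < e / 2"
      using order_tendstoD(2)[OF inv, of "e / 2"] by (auto simp: eventually_sequentially)
    have "dist (x m) (x n) < e" if "m \<ge> N" "n \<ge> N" for m n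
      using close[of m n] N[OF that(1)] N[OF that(2)] by (simp add: dist_norm)
    thus "\<exists>N. \<forall>m\<ge>N. \<forall>n\<ge>N. dist (x m) (x n) < e" by blast
  qed
  then obtain u where u: "x \<longlonglongrightarrow> u" using Cauchy_convergent convergent_def by blast
  have ip_lim: "(\<lambda>n. ip (w n) z) \<longlonglongrightarrow> ip v z" if z: "(z, y) \<in> G" for z y
  proof -
    have [simp]: "z \<in> V" using z by simp
    have "(\<lambda>n. inverse (Suc n) * norm y) \<longlonglongrightarrow> 0"
      using tendsto_mult_left_zero[OF inv] by simp
    hence "(\<lambda>n. ip (v - w n) z) \<longlonglongrightarrow> 0"
      by (rule Lim_null_comparison[rotated]) (use orth[OF z] in simp)
    hence "(\<lambda>n. ip v z - ip (v - w n) z) \<longlonglongrightarrow> ip v z - 0" by (intro tendsto_intros)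
    thus ?thesis by (simp add: ip_diff_left)
  qed
  show ?thesis
  proof
    show "u \<in> closure (snd ` G)"
      unfolding closure_sequential using u wx by (intro exI[of _ x]) force
    show cu: "cinner u y = ip v z" if z: "(z, y) \<in> G" for z y
    proof (rule LIMSEQ_unique)
      show "(\<lambda>n. cinner (x n) y) \<longlonglongrightarrow> cinner u y"
        by (rule bounded_linear.tendsto[OF bounded_linear_cinner_left u])
      show "(\<lambda>n. cinner (x n) y) \<longlonglongrightarrow> ip v z"
        using ip_lim[OF z] isometric_graphD(4)[OF G wx z] by simp
    qed
    show "ell2_coord u i = 0" if "i \<notin> \<iota> ` fst ` G" for i
    proof (rule LIMSEQ_unique)
      show "(\<lambda>n. ell2_coord (x n) i) \<longlonglongrightarrow> ell2_coord u i" by (rule tendsto_ell2_coord[OF u])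
      have "ell2_coord (x n) i = 0" for n using isometric_graphD(5)[OF G wx] that by blast
      thus "(\<lambda>n. ell2_coord (x n) i) \<longlonglongrightarrow> 0" by simp
    qed
    have "(norm u)\<^sup>2 \<le> sqrt (Re (ip v v)) * norm u"
    proof (rule LIMSEQ_le)
      have "(\<lambda>n. cmod (cinner u (x n))) \<longlonglongrightarrow> cmod (cinner u u)"
        by (intro tendsto_norm bounded_linear.tendsto[OF bounded_linear_cinner_right] u)
      thus "(\<lambda>n. cmod (cinner u (x n))) \<longlonglongrightarrow> (norm u)\<^sup>2"
        by (simp add: cinner_self flip: of_real_power)
      show "(\<lambda>n. sqrt (Re (ip v v)) * norm (x n)) \<longlonglongrightarrow> sqrt (Re (ip v v)) * norm u"
        by (intro tendsto_intros u)
      have "cmod (cinner u (x n)) \<le> sqrt (Re (ip v v)) * norm (x n)" for n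
      proof -
        have "(cmod (ip v (w n)))\<^sup>2 \<le> (sqrt (Re (ip v v)) * norm (x n))\<^sup>2"
          using Cauchy_Schwarz[of v "w n"]
          by (simp add: power_mult_distrib isometric_graph_norm[OF G wx] ip_nonneg)
        thus ?thesis unfolding cu[OF wx] by (rule power2_le_imp_le) (simp add: ip_nonneg)
      qed
      thus "\<exists>N. \<forall>n\<ge>N. cmod (cinner u (x n)) \<le> sqrt (Re (ip v v)) * norm (x n)" by blast
    qed
    hence "norm u \<le> sqrt (Re (ip v v))"
      by (cases "u = 0") (simp_all add: power2_eq_square ip_nonneg)
    hence "(norm u)\<^sup>2 \<le> (sqrt (Re (ip v v)))\<^sup>2" by (intro power_mono) auto
    thus "(norm u)\<^sup>2 \<le> Re (ip v v)" by (simp add: ip_nonneg)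
  qed
qed

text \<open>
  One step of the Gram-Schmidt process: \<open>v\<close> is sent to its projection \<open>u\<close> plus a multiple \<open>r\<close> of
  the fresh unit vector at \<open>\<iota> v\<close> that makes up for the missing length. If \<open>r = 0\<close>, the new
  coordinate remains unused.
\<close>

lemma isometric_graph_extend:
  assumes G: "isometric_graph \<iota> G" and v: "v \<in> V" "v \<notin> fst ` G" and inj: "inj_on \<iota> V"
  obtains H where "isometric_graph \<iota> H" "G \<subseteq> H" "v \<in> fst ` H"
proof -
  note [simp] = isometric_graphD(1)[OF G] v(1) V_closed
  obtain u where u: "u \<in> closure (snd ` G)" "\<And>w y. (w, y) \<in> G \<Longrightarrow> cinner u y = ip v w"
    "\<And>i. i \<notin> \<iota> ` fst ` G \<Longrightarrow> ell2_coord u i = 0" "(norm u)\<^sup>2 \<le> Re (ip v v)"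
    using isometric_graph_projection[OF G v(1)] by blast
  have fresh: "\<iota> v \<notin> \<iota> ` fst ` G"
  proof
    assume "\<iota> v \<in> \<iota> ` fst ` G"
    then obtain w y where "(w, y) \<in> G" "\<iota> v = \<iota> w" by auto
    hence "v = w" using inj by (auto dest: inj_onD)
    thus False using v(2) \<open>(w, y) \<in> G\<close> by force
  qed
  define e where "e = ell2_unit (\<iota> v)"
  define r where "r = sqrt (Re (ip v v) - (norm u)\<^sup>2)"
  define z where "z = u + of_real r *\<^sub>C e"
  have e_orth: "cinner y e = 0" "cinner e y = 0" if "(w, y) \<in> G" for w y
  proof -
    show "cinner y e = 0"
      using isometric_graphD(5)[OF G that] fresh by (auto simp: e_def cinner_ell2_unit)
    thus "cinner e y = 0" by (subst cinner_commute) simp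
  qed
  have e_u: "cinner u e = 0" "cinner e u = 0" "cinner e e = 1"
  proof -
    show "cinner u e = 0" using u(3)[OF fresh] by (simp add: e_def cinner_ell2_unit)
    thus "cinner e u = 0" by (subst cinner_commute) simp
    show "cinner e e = 1" by (simp add: e_def cinner_self)
  qed
  have z_orth: "cinner z y = ip v w" if "(w, y) \<in> G" for w y
    using u(2)[OF that] e_orth[OF that] by (simp add: z_def cinner_add_left cinner_scaleC_left)
  have z_orth': "cinner y z = ip w v" if "(w, y) \<in> G" for w y
    using z_orth[OF that] that by (subst cinner_commute, subst ip_commute) simp_all
  have z_self: "cinner z z = ip v v"
  proof -
    have "cinner z z = of_real ((norm u)\<^sup>2) + of_real r * of_real r"
      by (simp add: z_def cinner_add_left cinner_scaleC_left hilbert.ip_add_right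
          hilbert.ip_scale_right e_u) (simp add: cinner_self)
    also have "\<dots> = of_real (Re (ip v v))"
      using u(4) by (simp add: r_def flip: of_real_mult of_real_add of_real_power)
    finally show ?thesis using ip_self[of v] by simp
  qed
  define H where "H = {(w + scale c v, y + c *\<^sub>C z) | w y c. (w, y) \<in> G}"
  have H_I: "(w + scale c v, y + c *\<^sub>C z) \<in> H" if "(w, y) \<in> G" for w y c
    unfolding H_def using that by blast
  have GH: "G \<subseteq> H"
  proof (rule subrelI)
    fix w y assume "(w, y) \<in> G"
    thus "(w, y) \<in> H" using H_I[of w y 0] by simp
  qed
  have vz: "(v, z) \<in> H" using H_I[OF isometric_graphD(2)[OF G], of 1] by simp
  have snd_H: "snd ` H = {y + c *\<^sub>C z | y c. y \<in> snd ` G}"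
    unfolding H_def by force
  have sub_G: "hilbert.subspace (snd ` G)"
    unfolding hilbert.subspace_def
  proof (intro conjI ballI allI)
    show "0 \<in> snd ` G" using isometric_graphD(2)[OF G] by force
    fix y c assume "y \<in> snd ` G"
    then obtain w where w: "(w, y) \<in> G" by auto
    have "(0 + scale c w, 0 + c *\<^sub>C y) \<in> G" by (rule isometric_graphD(3)[OF G isometric_graphD(2)[OF G] w])
    thus "c *\<^sub>C y \<in> snd ` G" by force
    fix y' assume "y' \<in> snd ` G"
    then obtain w' where w': "(w', y') \<in> G" by auto
    have "(w + scale 1 w', y + 1 *\<^sub>C y') \<in> G" by (rule isometric_graphD(3)[OF G w w'])
    thus "y + y' \<in> snd ` G" by force
  qed
  have cl: "closure (snd ` G) \<subseteq> closure (snd ` H)" using GH by (intro closure_mono) blast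
  have sub_H: "hilbert.subspace (closure (snd ` H))"
  proof (rule hilbert_subspace_closure)
    have "snd ` H = {y + c | y c. y \<in> snd ` G \<and> c \<in> hilbert.span {z}}"
      unfolding snd_H hilbert.span_singleton by blast
    thus "hilbert.subspace (snd ` H)"
      using hilbert.subspace_sums[OF sub_G hilbert.subspace_span] by simp
  qed
  have e_cl: "e \<in> closure (snd ` H)" if "r \<noteq> 0"
  proof -
    have "of_real r *\<^sub>C e = z - u" by (simp add: z_def)
    also have "\<dots> \<in> closure (snd ` H)"
    proof (rule hilbert.subspace_diff[OF sub_H])
      have "z \<in> snd ` H" using vz by (rule image_eqI[rotated]) simp
      thus "z \<in> closure (snd ` H)" by (rule subsetD[OF closure_subset])
      show "u \<in> closure (snd ` H)" using u(1) cl by blast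
    qed
    finally have "of_real (inverse r) *\<^sub>C of_real r *\<^sub>C e \<in> closure (snd ` H)"
      by (rule hilbert.subspace_scale[OF sub_H])
    thus ?thesis using that by (simp add: scaleC_scaleC flip: of_real_mult)
  qed
  have u_supp: "ell2_unit i \<in> closure (snd ` G)" if "ell2_coord u i \<noteq> 0" for i
  proof (rule ccontr)
    assume no: "ell2_unit i \<notin> closure (snd ` G)"
    obtain X where X: "\<And>n. X n \<in> snd ` G" "X \<longlonglongrightarrow> u"
      using u(1) by (auto simp: closure_sequential)
    have "ell2_coord (X n) i = 0" for n
      using X(1)[of n] isometric_graphD(6)[OF G] no by force
    hence "ell2_coord u i = 0"
      using tendsto_ell2_coord[OF X(2), of i] by (simp add: LIMSEQ_const_iff)
    thus False using that by simp
  qed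
  have "isometric_graph \<iota> H"
    unfolding isometric_graph_def
  proof (intro conjI allI impI)
    show "(0, 0) \<in> H" using GH isometric_graphD(2)[OF G] by blast
    fix a x assume "(a, x) \<in> H"
    then obtain a' x' s where eq: "(a', x') \<in> G" "a = a' + scale s v" "x = x' + s *\<^sub>C z"
      unfolding H_def by blast
    have [simp]: "a' \<in> V" using eq by simp
    show "a \<in> V" by (simp add: eq)
    {
      fix b y c assume "(b, y) \<in> H"
      then obtain b' y' t where eq': "(b', y') \<in> G" "b = b' + scale t v" "y = y' + t *\<^sub>C z"
        unfolding H_def by blast
      have [simp]: "b' \<in> V" using eq' by simp
      have "(a' + scale c b', x' + c *\<^sub>C y') \<in> G" by (rule isometric_graphD(3)[OF G eq(1) eq'(1)])
      moreover have "a + scale c b = (a' + scale c b') + scale (s + c * t) v"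
        by (simp add: eq eq' algebra_simps)
      moreover have "x + c *\<^sub>C y = (x' + c *\<^sub>C y') + (s + c * t) *\<^sub>C z"
        by (simp add: eq eq' scaleC_add_left scaleC_add_right scaleC_scaleC algebra_simps)
      ultimately show "(a + scale c b, x + c *\<^sub>C y) \<in> H" unfolding H_def by blast
      show "cinner x y = ip a b"
        by (simp add: eq(2,3) eq'(2,3) cinner_add_left cinner_scaleC_left hilbert.ip_add_right
            hilbert.ip_scale_right ip_add_left ip_add_right ip_scale_left ip_scale_right
            z_orth[OF eq'(1)] z_orth'[OF eq(1)] z_self isometric_graphD(4)[OF G eq(1) eq'(1)] algebra_simps)
    }
    fix i assume nz: "ell2_coord x i \<noteq> 0"
    have "ell2_coord x i = ell2_coord x' i + s * (ell2_coord u i + of_real r * (if i = \<iota> v then 1 else 0))"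
      by (simp add: eq z_def e_def plus_ell2.rep_eq scaleC_ell2.rep_eq ell2_unit.rep_eq)
    hence "ell2_coord x' i \<noteq> 0 \<or> ell2_coord u i \<noteq> 0 \<or> (r \<noteq> 0 \<and> i = \<iota> v)"
      using nz by (auto split: if_splits)
    hence "i \<in> \<iota> ` fst ` H \<and> ell2_unit i \<in> closure (snd ` H)"
    proof (elim disjE)
      assume "ell2_coord x' i \<noteq> 0"
      thus ?thesis using isometric_graphD(5,6)[OF G eq(1)] GH cl by blast
    next
      assume "ell2_coord u i \<noteq> 0"
      thus ?thesis using u(3) u_supp GH cl by blast
    next
      assume "r \<noteq> 0 \<and> i = \<iota> v"
      thus ?thesis using e_cl vz by (force simp: e_def)
    qed
    thus "i \<in> \<iota> ` fst ` H" "ell2_unit i \<in> closure (snd ` H)" by blast+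
  qed
  thus ?thesis using that GH vz by force
qed

text \<open>
  The Kolmogorov decomposition of the form, in an \<open>\<ell>\<^sup>2\<close> with as many coordinates as \<open>V\<close> has
  elements: a maximal isometric graph is defined on all of \<open>V\<close>. The completion of \<open>V\<close> appears as the
  set of vectors supported on \<open>J\<close>.
\<close>

theorem isometric_embedding:
  assumes inj: "inj_on (\<iota> :: 'v \<Rightarrow> 'i) V"
  obtains f :: "'v \<Rightarrow> 'i ell2" and J where
    "\<And>v w. v \<in> V \<Longrightarrow> w \<in> V \<Longrightarrow> f (v + w) = f v + f w"
    "\<And>v c. v \<in> V \<Longrightarrow> f (scale c v) = c *\<^sub>C f v"
    "\<And>v w. v \<in> V \<Longrightarrow> w \<in> V \<Longrightarrow> cinner (f v) (f w) = ip v w"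
    "\<And>v. v \<in> V \<Longrightarrow> ell2_restrict J (f v) = f v"
    "\<And>x. ell2_restrict J x \<in> closure (f ` V)"
proof -
  have "\<exists>M\<in>Collect (isometric_graph \<iota>). \<forall>X\<in>Collect (isometric_graph \<iota>). M \<subseteq> X \<longrightarrow> X = M"
  proof (rule subset_Zorn_nonempty)
    have "isometric_graph \<iota> {(0, 0)}"
      unfolding isometric_graph_def
      by (auto simp: V_closed ip_zero_left zero_ell2.rep_eq hilbert.ip_zero_left)
    thus "Collect (isometric_graph \<iota>) \<noteq> {}" by blast
    fix C assume "C \<noteq> {}" "subset.chain (Collect (isometric_graph \<iota>)) C"
    thus "\<Union>C \<in> Collect (isometric_graph \<iota>)"
      using isometric_graph_Union[of C \<iota>] by (auto simp: subset_chain_def)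
  qed
  then obtain G where G: "isometric_graph \<iota> G"
    and maximal: "\<And>H. isometric_graph \<iota> H \<Longrightarrow> G \<subseteq> H \<Longrightarrow> H = G" by blast
  have total: "\<exists>x. (v, x) \<in> G" if "v \<in> V" for v
    using isometric_graph_extend[OF G that _ inj] maximal by (metis imageE prod.collapse)
  define f where "f v = (SOME x. (v, x) \<in> G)" for v
  have f: "(v, f v) \<in> G" if "v \<in> V" for v
    unfolding f_def using total[OF that] by (rule someI_ex)
  have unique: "x = y" if "(v, x) \<in> G" "(v, y) \<in> G" for v x y
    using isometric_graph_norm[OF G isometric_graph_minus[OF G that]]
    by (simp add: ip_zero_left V_closed)
  have range: "snd ` G = f ` V"
  proof -
    have "y \<in> f ` V" if "(v, y) \<in> G" for v y
      using unique[OF that f] isometric_graphD(1)[OF G that] by blast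
    thus ?thesis using f by force
  qed
  define J where "J = {i. ell2_unit i \<in> closure (f ` V)}"
  have add: "f (v + scale c w) = f v + c *\<^sub>C f w" if "v \<in> V" "w \<in> V" for v w c
    by (rule unique[OF f isometric_graphD(3)[OF G f f]]) (use that V_closed in auto)
  have zero: "f 0 = 0" by (rule unique[OF f isometric_graphD(2)[OF G]]) (simp add: V_closed)
  show ?thesis
  proof (rule that[of f J])
    show "f (v + w) = f v + f w" if "v \<in> V" "w \<in> V" for v w
      using add[OF that, of 1] by simp
    show sc: "f (scale c v) = c *\<^sub>C f v" if "v \<in> V" for v c
      using add[OF V_closed(1) that, of c] zero by simp
    show "cinner (f v) (f w) = ip v w" if "v \<in> V" "w \<in> V" for v w
      by (rule isometric_graphD(4)[OF G f f]) fact+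
    show "ell2_restrict J (f v) = f v" if "v \<in> V" for v
      by (rule ell2_restrict_ident)
        (use isometric_graphD(6)[OF G f[OF that]] in \<open>auto simp: J_def range\<close>)
    have "hilbert.subspace (f ` V)"
      unfolding hilbert.subspace_def
    proof (intro conjI ballI allI)
      show "0 \<in> f ` V" using zero V_closed(1) by (metis image_eqI)
      fix x c assume "x \<in> f ` V"
      thus "c *\<^sub>C x \<in> f ` V" using sc V_closed by (auto simp flip: sc)
      fix y assume "y \<in> f ` V"
      then obtain v w where "v \<in> V" "w \<in> V" "x = f v" "y = f w" using \<open>x \<in> f ` V\<close> by blast
      thus "x + y \<in> f ` V" using add[of v w 1] V_closed(2)[of v w] by (metis image_eqI scaleC_one scale_one)
    qed
    thus "ell2_restrict J x \<in> closure (f ` V)" for x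
      by (rule ell2_restrict_in_closure) (simp add: J_def)
  qed
qed

end

section \<open>Operators induced on the embedded space\<close>

text \<open>
  Extension by continuity to the closure of \<open>D\<close>, and by means of the projection \<open>R\<close> onto this
  closure to the whole space.
\<close>

lemma bounded_extension_from_subspace:
  fixes D :: "'a::complex_hilbert set" and T R :: "'a \<Rightarrow> 'a"
  assumes D: "hilbert.subspace D"
    and T_add: "\<And>x y. x \<in> D \<Longrightarrow> y \<in> D \<Longrightarrow> T (x + y) = T x + T y"
    and T_scale: "\<And>x c. x \<in> D \<Longrightarrow> T (c *\<^sub>C x) = c *\<^sub>C T x"
    and T_bound: "\<And>x. x \<in> D \<Longrightarrow> norm (T x) \<le> C * norm x" and "C \<ge> 0"
    and R_closure: "\<And>x. R x \<in> closure D" and R_ident: "\<And>x. x \<in> D \<Longrightarrow> R x = x"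
    and R_add: "\<And>x y. R (x + y) = R x + R y" and R_scale: "\<And>x c. R (c *\<^sub>C x) = c *\<^sub>C R x"
    and R_bound: "\<And>x. norm (R x) \<le> norm x" and R_idem: "\<And>x. R (R x) = R x"
  obtains S where "S \<in> BH" "\<And>x. x \<in> D \<Longrightarrow> blinfun_apply S x = T x"
    "\<And>x. blinfun_apply S x = blinfun_apply S (R x)"
proof -
  define approx where "approx x y \<longleftrightarrow> (\<exists>X. (\<forall>n. X n \<in> D) \<and> X \<longlonglongrightarrow> x \<and> (\<lambda>n. T (X n)) \<longlonglongrightarrow> y)" for x y
  have T_diff: "T (x - y) = T x - T y" if "x \<in> D" "y \<in> D" for x y
    using T_add[OF hilbert.subspace_diff[OF D that] that(2)] by simp
  have approx_exists: "\<exists>y. approx x y" if x: "x \<in> closure D" for x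
  proof -
    obtain X where X: "\<And>n. X n \<in> D" "X \<longlonglongrightarrow> x" using x by (auto simp: closure_sequential)
    have "Cauchy (\<lambda>n. T (X n))"
    proof (rule metric_CauchyI)
      fix e :: real assume "e > 0"
      hence "e / (C + 1) > 0" using \<open>C \<ge> 0\<close> by simp
      then obtain N where N: "\<And>m n. m \<ge> N \<Longrightarrow> n \<ge> N \<Longrightarrow> dist (X m) (X n) < e / (C + 1)"
        using LIMSEQ_imp_Cauchy[OF X(2)] metric_CauchyD by blast
      have "dist (T (X m)) (T (X n)) < e" if "m \<ge> N" "n \<ge> N" for m n
      proof -
        have "dist (T (X m)) (T (X n)) \<le> C * dist (X m) (X n)"
          using T_bound[OF hilbert.subspace_diff[OF D X(1) X(1)], of m n] X(1)
          by (simp add: dist_norm T_diff)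
        also have "\<dots> \<le> (C + 1) * dist (X m) (X n)" by (intro mult_right_mono) auto
        also have "\<dots> < e" using N[OF that] \<open>C \<ge> 0\<close> by (simp add: field_simps)
        finally show ?thesis .
      qed
      thus "\<exists>N. \<forall>m\<ge>N. \<forall>n\<ge>N. dist (T (X m)) (T (X n)) < e" by blast
    qed
    thus ?thesis unfolding approx_def using X Cauchy_convergent convergent_def by blast
  qed
  have approx_bound: "norm y \<le> C * norm x" if xy: "approx x y" for x y
  proof -
    obtain X where X: "\<And>n. X n \<in> D" "X \<longlonglongrightarrow> x" "(\<lambda>n. T (X n)) \<longlonglongrightarrow> y"
      using xy by (auto simp: approx_def)
    show ?thesis
      by (rule LIMSEQ_le[OF tendsto_norm[OF X(3)] tendsto_mult_left[OF tendsto_norm[OF X(2)]]])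
        (use T_bound[OF X(1)] in blast)
  qed
  have approx_add: "approx (x + x') (y + y')" if xy: "approx x y" "approx x' y'" for x y x' y'
  proof -
    obtain X X' where "\<And>n. X n \<in> D" "X \<longlonglongrightarrow> x" "(\<lambda>n. T (X n)) \<longlonglongrightarrow> y"
      "\<And>n. X' n \<in> D" "X' \<longlonglongrightarrow> x'" "(\<lambda>n. T (X' n)) \<longlonglongrightarrow> y'"
      using xy by (auto simp: approx_def)
    thus ?thesis unfolding approx_def using hilbert.subspace_add[OF D]
      by (intro exI[of _ "\<lambda>n. X n + X' n"]) (simp add: T_add tendsto_add)
  qed
  have approx_scale: "approx (c *\<^sub>C x) (c *\<^sub>C y)" if xy: "approx x y" for x y c
  proof -
    obtain X where "\<And>n. X n \<in> D" "X \<longlonglongrightarrow> x" "(\<lambda>n. T (X n)) \<longlonglongrightarrow> y"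
      using xy by (auto simp: approx_def)
    thus ?thesis unfolding approx_def using hilbert.subspace_scale[OF D]
      by (intro exI[of _ "\<lambda>n. c *\<^sub>C X n"])
        (simp add: T_scale bounded_linear.tendsto[OF bounded_linear_scaleC])
  qed
  have approx_unique: "y = z" if "approx x y" "approx x z" for x y z
    using approx_bound[OF approx_add[OF that(1) approx_scale[OF that(2), of "-1"]]] by simp
  define g where "g x = (SOME y. approx (R x) y)" for x
  have g: "approx (R x) (g x)" for x
    unfolding g_def by (rule someI_ex[OF approx_exists[OF R_closure]])
  have g_eq: "g x = y" if "approx (R x) y" for x y using approx_unique[OF g that] .
  have g_scale: "g (c *\<^sub>C x) = c *\<^sub>C g x" for c x
    by (rule g_eq) (simp add: R_scale approx_scale g)
  have "bounded_linear g"
  proof (rule bounded_linear_intro[where K = C])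
    show "g (x + y) = g x + g y" for x y by (rule g_eq) (simp add: R_add approx_add g)
    show "g (r *\<^sub>R x) = r *\<^sub>R g x" for r x by (simp add: scaleR_scaleC g_scale)
    show "norm (g x) \<le> norm x * C" for x
      using order_trans[OF approx_bound[OF g] mult_left_mono[OF R_bound \<open>C \<ge> 0\<close>]]
      by (simp add: mult.commute)
  qed
  hence app: "blinfun_apply (Blinfun g) = g" by (rule bounded_linear_Blinfun_apply)
  show ?thesis
  proof (rule that[of "Blinfun g"])
    show "Blinfun g \<in> BH" by (simp add: BH_def app g_scale)
    show "blinfun_apply (Blinfun g) x = T x" if "x \<in> D" for x
      unfolding app by (rule g_eq) (use that in \<open>auto simp: approx_def R_ident intro!: exI[of _ "\<lambda>_. x"]\<close>)
    show "blinfun_apply (Blinfun g) x = blinfun_apply (Blinfun g) (R x)" for x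
      unfolding app by (rule g_eq) (use g[of "R x"] in \<open>simp add: R_idem\<close>)
  qed
qed

locale ell2_embedding = semi_inner_space scale V ip
  for scale :: "complex \<Rightarrow> 'v::ab_group_add \<Rightarrow> 'v" and V ip +
  fixes f :: "'v \<Rightarrow> 'i ell2" and J :: "'i set"
  assumes f_add: "\<And>v w. v \<in> V \<Longrightarrow> w \<in> V \<Longrightarrow> f (v + w) = f v + f w"
    and f_scale: "\<And>v c. v \<in> V \<Longrightarrow> f (scale c v) = c *\<^sub>C f v"
    and f_ip: "\<And>v w. v \<in> V \<Longrightarrow> w \<in> V \<Longrightarrow> cinner (f v) (f w) = ip v w"
    and f_support: "\<And>v. v \<in> V \<Longrightarrow> ell2_restrict J (f v) = f v"
    and f_dense: "\<And>x. ell2_restrict J x \<in> closure (f ` V)"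
begin

lemma f_diff: "\<lbrakk>v \<in> V; w \<in> V\<rbrakk> \<Longrightarrow> f (v - w) = f v - f w"
  using f_add[of "v - w" w] by (simp add: V_closed)

lemma f_norm: "v \<in> V \<Longrightarrow> (norm (f v))\<^sup>2 = Re (ip v v)"
  using f_ip[of v v] cinner_self[of "f v"] by (metis Re_complex_of_real)

lemma f_sum: "(\<And>k. k \<in> I \<Longrightarrow> v k \<in> V) \<Longrightarrow> f (\<Sum>k\<in>I. v k) = (\<Sum>k\<in>I. f (v k))"
proof (induction I rule: infinite_finite_induct)
  case (insert k I)
  thus ?case by (simp add: f_add subspace_sum[OF subspace_V])
qed (use f_scale[of 0 0] V_closed(1) in simp_all)

lemma subspace_range: "hilbert.subspace (f ` V)"
  unfolding hilbert.subspace_def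
proof (intro conjI ballI allI)
  show "0 \<in> f ` V" using f_sum[of "{}"] V_closed(1) by (metis empty_iff image_eqI sum.empty)
  fix x c assume x: "x \<in> f ` V"
  thus "c *\<^sub>C x \<in> f ` V" using V_closed by (auto simp flip: f_scale)
  fix y assume "y \<in> f ` V"
  thus "x + y \<in> f ` V" using x V_closed by (auto simp flip: f_add)
qed

text \<open>
  A map \<open>L\<close> that is bounded for the semi-inner product respects the null vectors, so it induces an
  operator on the range of the embedding, which then extends by continuity.
\<close>

lemma induced_operator:
  assumes L: "\<And>v. v \<in> V \<Longrightarrow> L v \<in> V"
    and L_add: "\<And>v w. v \<in> V \<Longrightarrow> w \<in> V \<Longrightarrow> L (v + w) = L v + L w"
    and L_scale: "\<And>v c. v \<in> V \<Longrightarrow> L (scale c v) = scale c (L v)"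
    and L_bound: "\<And>v. v \<in> V \<Longrightarrow> Re (ip (L v) (L v)) \<le> C\<^sup>2 * Re (ip v v)" and C: "C \<ge> 0"
  obtains S where "S \<in> BH" "\<And>v. v \<in> V \<Longrightarrow> blinfun_apply S (f v) = f (L v)"
    "\<And>x. blinfun_apply S x = blinfun_apply S (ell2_restrict J x)"
proof -
  have bound: "norm (f (L v)) \<le> C * norm (f v)" if "v \<in> V" for v
  proof -
    have "(norm (f (L v)))\<^sup>2 \<le> (C * norm (f v))\<^sup>2"
      using L_bound[OF that] that L by (simp add: f_norm power_mult_distrib)
    thus ?thesis by (rule power2_le_imp_le) (use C in simp)
  qed
  have welldef: "f (L v) = f (L w)" if "v \<in> V" "w \<in> V" "f v = f w" for v w
  proof -
    have L_diff: "L (v - w) = L v - L w"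
      using L_add[of "v - w" w] that by (simp add: V_closed)
    have "norm (f (L (v - w))) \<le> 0" using bound[of "v - w"] that by (simp add: f_diff V_closed)
    thus ?thesis using that L by (simp add: L_diff f_diff)
  qed
  define T where "T x = f (L (SOME v. v \<in> V \<and> f v = x))" for x
  have T: "T (f v) = f (L v)" if "v \<in> V" for v
    unfolding T_def using someI_ex[of "\<lambda>w. w \<in> V \<and> f w = f v"] that by (intro welldef) auto
  have "ell2_restrict J (ell2_restrict J x) = ell2_restrict J x" for x
    by (rule ell2_restrict_ident) (simp add: ell2_restrict.rep_eq)
  note idem = this
  show ?thesis
  proof (rule bounded_extension_from_subspace[of "f ` V" T C "ell2_restrict J"])
    fix x assume "x \<in> f ` V"
    then obtain v where v: "v \<in> V" "x = f v" by blast
    show "T (c *\<^sub>C x) = c *\<^sub>C T x" for c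
      using v T[OF V_closed(3)[OF v(1)], of c] by (simp add: f_scale L L_scale T)
    show "norm (T x) \<le> C * norm x" using v by (simp add: T bound)
    show "ell2_restrict J x = x" using v by (simp add: f_support)
    fix y assume "y \<in> f ` V"
    then obtain w where w: "w \<in> V" "y = f w" by blast
    show "T (x + y) = T x + T y"
      using v w T[OF V_closed(2)[OF v(1) w(1)]] by (simp add: f_add L L_add T)
  next
    fix S assume "S \<in> BH" "\<And>x. x \<in> f ` V \<Longrightarrow> blinfun_apply S x = T x"
      "\<And>x. blinfun_apply S x = blinfun_apply S (ell2_restrict J x)"
    thus ?thesis using that[of S] T by simp
  qed (fact subspace_range C f_dense ell2_restrict_add ell2_restrict_scaleC norm_ell2_restrict idem)+
qed

lemma approximate_by_range:
  obtains v where "\<And>n::nat. v n \<in> V" "(\<lambda>n. f (v n)) \<longlonglongrightarrow> ell2_restrict J x"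
proof -
  obtain X where X: "\<And>n::nat. X n \<in> f ` V" "X \<longlonglongrightarrow> ell2_restrict J x"
    using f_dense[of x] by (auto simp: closure_sequential)
  hence "\<forall>n. \<exists>v. v \<in> V \<and> X n = f v" by blast
  then obtain v where v: "\<forall>n. v n \<in> V \<and> X n = f (v n)" by metis
  hence "X = (\<lambda>n. f (v n))" by auto
  thus ?thesis using that[of v] v X(2) by simp
qed

lemma operator_eqI:
  assumes "\<And>v. v \<in> V \<Longrightarrow> blinfun_apply S (f v) = blinfun_apply T (f v)"
    and "\<And>x. blinfun_apply S x = blinfun_apply S (ell2_restrict J x)"
    and "\<And>x. blinfun_apply T x = blinfun_apply T (ell2_restrict J x)"
  shows "S = T"
proof (rule blinfun_eqI)
  fix x
  obtain v where v: "\<And>n::nat. v n \<in> V" "(\<lambda>n. f (v n)) \<longlonglongrightarrow> ell2_restrict J x"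
    using approximate_by_range[of x] by blast
  have "blinfun_apply S (ell2_restrict J x) = blinfun_apply T (ell2_restrict J x)"
  proof (rule LIMSEQ_unique)
    show "(\<lambda>n. blinfun_apply S (f (v n))) \<longlonglongrightarrow> blinfun_apply S (ell2_restrict J x)"
      by (intro blinfun.tendsto tendsto_const v)
    show "(\<lambda>n. blinfun_apply S (f (v n))) \<longlonglongrightarrow> blinfun_apply T (ell2_restrict J x)"
      unfolding assms(1)[OF v(1)] by (intro blinfun.tendsto tendsto_const v)
  qed
  thus "blinfun_apply S x = blinfun_apply T x" using assms(2,3) by metis
qed

text \<open>
  Bounds of operator matrices may be checked on the range of the embedding, which is dense in the
  vectors supported on \<open>J\<close>; the remaining coordinates are annihilated.
\<close>

lemma matrix_bound_from_range:
  fixes S :: "nat \<Rightarrow> nat \<Rightarrow> 'i ell2 \<Rightarrow>\<^sub>L 'i ell2"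
  assumes range: "\<And>v. (\<And>j. v j \<in> V) \<Longrightarrow>
      L2_set (\<lambda>i. norm (\<Sum>j<n. blinfun_apply (S i j) (f (v j)))) {..<n}
        \<le> C * L2_set (\<lambda>j. norm (f (v j))) {..<n}"
    and S: "\<And>i j x. i < n \<Longrightarrow> j < n \<Longrightarrow>
      blinfun_apply (S i j) x = blinfun_apply (S i j) (ell2_restrict J x)"
    and "C \<ge> 0"
  shows "L2_set (\<lambda>i. norm (\<Sum>j<n. blinfun_apply (S i j) (x j))) {..<n}
    \<le> C * L2_set (\<lambda>j. norm (x j)) {..<n}"
proof -
  have "\<exists>v. (\<forall>k::nat. v k \<in> V) \<and> (\<lambda>k. f (v k)) \<longlonglongrightarrow> ell2_restrict J (x j)" for j
    using approximate_by_range[of "x j"] by metis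
  then obtain v where v: "\<And>j k. v j k \<in> V" "\<And>j. (\<lambda>k. f (v j k)) \<longlonglongrightarrow> ell2_restrict J (x j)"
    by metis
  let ?r = "\<lambda>j. ell2_restrict J (x j)"
  have "L2_set (\<lambda>i. norm (\<Sum>j<n. blinfun_apply (S i j) (x j))) {..<n}
      = L2_set (\<lambda>i. norm (\<Sum>j<n. blinfun_apply (S i j) (?r j))) {..<n}"
    by (intro L2_set_cong refl arg_cong[of _ _ norm] sum.cong S) simp_all
  also have "\<dots> \<le> C * L2_set (\<lambda>j. norm (?r j)) {..<n}"
  proof (rule LIMSEQ_le)
    show "(\<lambda>k. L2_set (\<lambda>i. norm (\<Sum>j<n. blinfun_apply (S i j) (f (v j k)))) {..<n})
        \<longlonglongrightarrow> L2_set (\<lambda>i. norm (\<Sum>j<n. blinfun_apply (S i j) (?r j))) {..<n}"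
      unfolding L2_set_def by (intro tendsto_intros blinfun.tendsto v)
    show "(\<lambda>k. C * L2_set (\<lambda>j. norm (f (v j k))) {..<n}) \<longlonglongrightarrow> C * L2_set (\<lambda>j. norm (?r j)) {..<n}"
      unfolding L2_set_def by (intro tendsto_intros v)
  qed (use range[of "\<lambda>j. v j k" for k] v(1) in blast)
  also have "\<dots> \<le> C * L2_set (\<lambda>j. norm (x j)) {..<n}"
    using \<open>C \<ge> 0\<close> by (intro mult_left_mono L2_set_mono) (auto simp: norm_ell2_restrict)
  finally show ?thesis .
qed

end

section \<open>Norms of operator matrices\<close>

lemma sum_lessThan_add:
  "sum f {..<a + b :: nat} = sum f {..<a} + sum (\<lambda>i. f (a + i)) {..<b}" for f :: "nat \<Rightarrow> 'a::comm_monoid_add"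
  by (induction b) (simp_all add: add.assoc)

lemma L2_set_power2: "(L2_set f I)\<^sup>2 = (\<Sum>i\<in>I. (f i)\<^sup>2)"
  by (simp add: L2_set_def sum_nonneg)

lemma matnorm_upper:
  "L2_set (\<lambda>j. norm (v j)) {..<n} \<le> 1 \<Longrightarrow>
    L2_set (\<lambda>i. norm (\<Sum>j<n. blinfun_apply (x i j) (v j))) {..<n} \<le> matnorm n x"
  unfolding matnorm_def by (intro cSup_upper matnorm_bdd_above) auto

lemma matnorm_nonneg: "0 \<le> matnorm n x"
  by (rule order_trans[OF _ matnorm_upper[of "\<lambda>_. 0"]]) (simp_all add: L2_set_def)

lemma matnorm_bound:
  "L2_set (\<lambda>i. norm (\<Sum>j<n. blinfun_apply (x i j) (v j))) {..<n}
    \<le> matnorm n x * L2_set (\<lambda>j. norm (v j)) {..<n}"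
proof (cases "L2_set (\<lambda>j. norm (v j)) {..<n} = 0")
  case True
  hence "\<And>j. j < n \<Longrightarrow> v j = 0" by (simp add: L2_set_eq_0_iff)
  thus ?thesis using True by (simp add: L2_set_def)
next
  case False
  let ?r = "L2_set (\<lambda>j. norm (v j)) {..<n}"
  have r: "?r > 0" using False L2_set_nonneg[of "\<lambda>j. norm (v j)" "{..<n}"] by linarith
  let ?u = "\<lambda>j. inverse ?r *\<^sub>R v j"
  have "L2_set (\<lambda>j. norm (?u j)) {..<n} = inverse ?r * ?r"
    using r by (simp add: L2_set_right_distrib)
  hence "L2_set (\<lambda>i. norm (\<Sum>j<n. blinfun_apply (x i j) (?u j))) {..<n} \<le> matnorm n x"
    using r by (intro matnorm_upper) simp
  also have "L2_set (\<lambda>i. norm (\<Sum>j<n. blinfun_apply (x i j) (?u j))) {..<n}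
      = inverse ?r * L2_set (\<lambda>i. norm (\<Sum>j<n. blinfun_apply (x i j) (v j))) {..<n}"
    using r by (simp add: blinfun.scaleR_right L2_set_right_distrib flip: scaleR_sum_right)
  finally show ?thesis using r by (simp add: field_simps)
qed

lemma matnorm_le_ballI:
  assumes "\<And>v. L2_set (\<lambda>j. norm (v j)) {..<n} \<le> 1 \<Longrightarrow>
      L2_set (\<lambda>i. norm (\<Sum>j<n. blinfun_apply (x i j) (v j))) {..<n} \<le> C"
  shows "matnorm n x \<le> C"
  unfolding matnorm_def
proof (rule cSup_least)
  have "L2_set (\<lambda>j. norm (0 :: 'a)) {..<n} \<le> 1" by (simp add: L2_set_def)
  thus "{L2_set (\<lambda>i. norm (\<Sum>j<n. blinfun_apply (x i j) (v j))) {..<n} |v.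
      L2_set (\<lambda>j. norm (v j)) {..<n} \<le> 1} \<noteq> {}" by fast
qed (use assms in blast)

lemma matnorm_leI:
  assumes bound: "\<And>v. L2_set (\<lambda>i. norm (\<Sum>j<n. blinfun_apply (x i j) (v j))) {..<n}
      \<le> C * L2_set (\<lambda>j. norm (v j)) {..<n}" and "C \<ge> 0"
  shows "matnorm n x \<le> C"
  using order_trans[OF bound mult_left_le[OF _ \<open>C \<ge> 0\<close>]] by (rule matnorm_le_ballI)

lemma matnorm_cong:
  "(\<And>i j. i < n \<Longrightarrow> j < n \<Longrightarrow> x i j = y i j) \<Longrightarrow> matnorm n x = matnorm n y"
  unfolding matnorm_def by (intro arg_cong[of _ _ Sup] Collect_cong ex_cong1 conj_cong refl
      arg_cong2[of _ _ _ _ "(=)"] L2_set_cong arg_cong[of _ _ norm] sum.cong) auto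

lemma matnorm_1: "matnorm 1 (\<lambda>_ _. T) = norm T"
proof (rule antisym)
  show "matnorm 1 (\<lambda>_ _. T) \<le> norm T"
    by (rule matnorm_leI) (simp_all add: L2_set_def norm_blinfun)
  show "norm T \<le> matnorm 1 (\<lambda>_ _. T)"
    using norm_entry_le_matnorm[of 0 1 0 "\<lambda>_ _. T"] by simp
qed

lemma scaleC_op_apply [simp]: "blinfun_apply (scaleC_op c T) x = c *\<^sub>C blinfun_apply T x"
  by transfer simp

lemma vector_space_scaleC_op:
  "vector_space (scaleC_op :: complex \<Rightarrow> ('h::complex_hilbert \<Rightarrow>\<^sub>L 'h) \<Rightarrow> _)"
  by unfold_locales
    (auto intro!: blinfun_eqI simp: blinfun.add_left scaleC_add_left scaleC_add_right scaleC_scaleC)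

interpretation op: vector_space "scaleC_op :: complex \<Rightarrow> ('h::complex_hilbert \<Rightarrow>\<^sub>L 'h) \<Rightarrow> _"
  by (rule vector_space_scaleC_op)

lemma matnorm_scaleC_op_le:
  "matnorm n (\<lambda>i j. scaleC_op c (x i j)) \<le> cmod c * matnorm n x"
proof (rule matnorm_leI)
  fix v
  have "L2_set (\<lambda>i. norm (\<Sum>j<n. blinfun_apply (scaleC_op c (x i j)) (v j))) {..<n}
      = cmod c * L2_set (\<lambda>i. norm (\<Sum>j<n. blinfun_apply (x i j) (v j))) {..<n}"
    by (simp add: norm_scaleC L2_set_right_distrib flip: hilbert.scale_sum_right)
  also have "\<dots> \<le> cmod c * (matnorm n x * L2_set (\<lambda>j. norm (v j)) {..<n})"
    by (intro mult_left_mono matnorm_bound) simp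
  finally show "L2_set (\<lambda>i. norm (\<Sum>j<n. blinfun_apply (scaleC_op c (x i j)) (v j))) {..<n}
      \<le> cmod c * matnorm n x * L2_set (\<lambda>j. norm (v j)) {..<n}" by (simp add: mult.assoc)
qed (simp add: matnorm_nonneg)

section \<open>Columns over an operator space and the vectors they act on\<close>

definition row_apply :: "nat \<Rightarrow> (nat \<Rightarrow> 'h::complex_hilbert \<Rightarrow>\<^sub>L 'h) \<Rightarrow> (nat \<Rightarrow> 'h) \<Rightarrow> 'h" where
  "row_apply p u \<xi> = (\<Sum>j<p. blinfun_apply (u j) (\<xi> j))"

text \<open>
  The function \<open>\<xi> \<mapsto> s\<^sub>\<xi>(w)\<close>: the squared length of the image of \<open>\<xi>\<close> under the \<open>N \<times> p\<close> matrix \<open>w\<close>.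
\<close>

definition column_square ::
  "nat \<Rightarrow> nat \<Rightarrow> (nat \<Rightarrow> nat \<Rightarrow> 'h::complex_hilbert \<Rightarrow>\<^sub>L 'h) \<Rightarrow> (nat \<Rightarrow> 'h) \<Rightarrow> real" where
  "column_square p N w \<xi> = (\<Sum>i<N. (norm (row_apply p (w i) \<xi>))\<^sup>2)"

definition unit_ball :: "nat \<Rightarrow> (nat \<Rightarrow> 'h::complex_hilbert) set" where
  "unit_ball p = {\<xi>. L2_set (\<lambda>j. norm (\<xi> j)) {..<p} \<le> 1}"

definition stack :: "nat \<Rightarrow> (nat \<Rightarrow> nat \<Rightarrow> 'a) \<Rightarrow> nat \<Rightarrow> (nat \<Rightarrow> nat \<Rightarrow> 'a) \<Rightarrow> nat \<Rightarrow> nat \<Rightarrow> 'a::zero" where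
  "stack n v N w = (\<lambda>i j. if i < n then v i j else if i < n + N then w (i - n) j else 0)"

lemma row_apply_add: "row_apply p (\<lambda>j. u j + v j) \<xi> = row_apply p u \<xi> + row_apply p v \<xi>"
  by (simp add: row_apply_def blinfun.add_left sum.distrib)

lemma row_apply_diff: "row_apply p (\<lambda>j. u j - v j) \<xi> = row_apply p u \<xi> - row_apply p v \<xi>"
  by (simp add: row_apply_def blinfun.diff_left sum_subtractf)

lemma row_apply_scale: "row_apply p (\<lambda>j. scaleC_op c (u j)) \<xi> = c *\<^sub>C row_apply p u \<xi>"
  by (simp add: row_apply_def hilbert.scale_sum_right)

lemma norm_row_apply_le:
  assumes "\<xi> \<in> unit_ball p"
  shows "norm (row_apply p u \<xi>) \<le> (\<Sum>j<p. norm (u j))"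
  unfolding row_apply_def
proof (rule sum_norm_le)
  fix j assume "j \<in> {..<p}"
  hence "norm (\<xi> j) \<le> L2_set (\<lambda>j. norm (\<xi> j)) {..<p}"
    using member_le_L2_set[of "{..<p}" j "\<lambda>j. norm (\<xi> j)"] by simp
  hence "norm (\<xi> j) \<le> 1" using assms by (simp add: unit_ball_def)
  thus "norm (blinfun_apply (u j) (\<xi> j)) \<le> norm (u j)"
    using norm_blinfun[of "u j" "\<xi> j"] mult_left_le[of "norm (\<xi> j)" "norm (u j)"] by simp
qed

lemma row_apply_single:
  assumes "l < p"
  shows "row_apply p (\<lambda>j. if j = l then e else 0) \<xi> = blinfun_apply e (\<xi> l)"
proof -
  have "row_apply p (\<lambda>j. if j = l then e else 0) \<xi> = (\<Sum>j<p. if j = l then blinfun_apply e (\<xi> j) else 0)"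
    unfolding row_apply_def by (rule sum.cong) auto
  thus ?thesis using assms by simp
qed

lemma column_square_nonneg: "0 \<le> column_square p N w \<xi>"
  by (simp add: column_square_def sum_nonneg)

lemma column_square_stack:
  "column_square p (n + (N + r)) (stack n v N w) \<xi> = column_square p n v \<xi> + column_square p N w \<xi>"
  unfolding column_square_def sum_lessThan_add
  by (simp add: stack_def row_apply_def)

lemma column_square_scale:
  "column_square p N (\<lambda>i j. scaleC_op c (w i j)) \<xi> = (cmod c)\<^sup>2 * column_square p N w \<xi>"
  by (simp add: column_square_def row_apply_scale norm_scaleC power_mult_distrib sum_distrib_left)

lemma column_square_matrix:
  assumes "p \<le> M"
  shows "(L2_set (\<lambda>i. norm (\<Sum>j<M. blinfun_apply (if j < p then Y i j else 0) (\<xi> j))) {..<M})\<^sup>2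
    = column_square p M Y \<xi>"
proof -
  have "(\<Sum>j<M. blinfun_apply (if j < p then Y i j else 0) (\<xi> j)) = row_apply p (Y i) \<xi>" for i
    unfolding row_apply_def by (rule sum.mono_neutral_cong_right) (use assms in auto)
  thus ?thesis by (simp add: L2_set_power2 column_square_def)
qed

lemma column_square_cong:
  "(\<And>j. j < p \<Longrightarrow> \<xi> j = \<zeta> j) \<Longrightarrow> column_square p N w \<xi> = column_square p N w \<zeta>"
  by (simp add: column_square_def row_apply_def)

lemma column_square_le_matnorm:
  assumes "\<xi> \<in> unit_ball p"
  shows "column_square p p x \<xi> \<le> (matnorm p x)\<^sup>2"
proof -
  have "column_square p p x \<xi> = (L2_set (\<lambda>i. norm (\<Sum>j<p. blinfun_apply (x i j) (\<xi> j))) {..<p})\<^sup>2"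
    by (simp add: L2_set_power2 column_square_def row_apply_def)
  also have "\<dots> \<le> (matnorm p x)\<^sup>2"
    using assms by (intro power_mono matnorm_upper) (auto simp: unit_ball_def)
  finally show ?thesis .
qed

text \<open>
  The limes superior along a principal filter is the supremum, here of \<open>\<parallel>x \<xi>\<parallel>\<^sup>2\<close> over the unit ball.
\<close>

lemma upper_limit_matnorm:
  "upper_limit (column_square p p x) (principal (unit_ball p)) ((matnorm p x)\<^sup>2)"
  unfolding upper_limit_def
proof (intro allI impI conjI)
  fix e :: real assume "e > 0"
  show "\<forall>\<^sub>F \<xi> in principal (unit_ball p). column_square p p x \<xi> \<le> (matnorm p x)\<^sup>2 + e"
    unfolding eventually_principal
  proof
    fix \<xi> :: "nat \<Rightarrow> 'a" assume "\<xi> \<in> unit_ball p"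
    thus "column_square p p x \<xi> \<le> (matnorm p x)\<^sup>2 + e"
      using column_square_le_matnorm[of \<xi> p x] \<open>e > 0\<close> by linarith
  qed
  show "\<exists>\<^sub>F \<xi> in principal (unit_ball p). (matnorm p x)\<^sup>2 - e \<le> column_square p p x \<xi>"
  proof (rule ccontr)
    assume "\<not> (\<exists>\<^sub>F \<xi> in principal (unit_ball p). (matnorm p x)\<^sup>2 - e \<le> column_square p p x \<xi>)"
    hence low: "column_square p p x \<xi> \<le> (matnorm p x)\<^sup>2 - e" if "\<xi> \<in> unit_ball p" for \<xi>
      using that by (auto simp: frequently_def eventually_principal not_le intro: less_imp_le)
    have c: "0 \<le> (matnorm p x)\<^sup>2 - e"
      by (rule order_trans[OF column_square_nonneg low[of "\<lambda>_. 0"]]) (simp add: unit_ball_def L2_set_def)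
    have "matnorm p x \<le> sqrt ((matnorm p x)\<^sup>2 - e)"
    proof (rule matnorm_le_ballI)
      fix v :: "nat \<Rightarrow> 'a" assume "L2_set (\<lambda>j. norm (v j)) {..<p} \<le> 1"
      hence "column_square p p x v \<le> (matnorm p x)\<^sup>2 - e" by (intro low) (simp add: unit_ball_def)
      hence "(L2_set (\<lambda>i. norm (\<Sum>j<p. blinfun_apply (x i j) (v j))) {..<p})\<^sup>2 \<le> (matnorm p x)\<^sup>2 - e"
        by (simp add: L2_set_power2 column_square_def row_apply_def)
      thus "L2_set (\<lambda>i. norm (\<Sum>j<p. blinfun_apply (x i j) (v j))) {..<p} \<le> sqrt ((matnorm p x)\<^sup>2 - e)"
        by (rule real_le_rsqrt)
    qed
    hence "(matnorm p x)\<^sup>2 \<le> (sqrt ((matnorm p x)\<^sup>2 - e))\<^sup>2"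
      by (intro power_mono matnorm_nonneg)
    thus False using c \<open>e > 0\<close> by simp
  qed
qed

section \<open>Contractive forms on rows over the algebra\<close>

locale algebra_in_operator_space =
  fixes A :: "('k::complex_hilbert \<Rightarrow>\<^sub>L 'k) set" and mul
  assumes operator_space: "operator_space A" and algebra: "algebra_on A mul"
begin

lemma A_zero: "0 \<in> A" and A_add: "a \<in> A \<Longrightarrow> b \<in> A \<Longrightarrow> a + b \<in> A"
  and A_scale: "a \<in> A \<Longrightarrow> scaleC_op c a \<in> A"
  using operator_space by (auto simp: operator_space_def)

lemma A_subspace: "op.subspace A"
  unfolding op.subspace_def using A_zero A_add A_scale by blast

lemmas A_diff = op.subspace_diff[OF A_subspace] and A_sum = op.subspace_sum[OF A_subspace]

lemma mul_closed: "a \<in> A \<Longrightarrow> b \<in> A \<Longrightarrow> mul a b \<in> A"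
  and mul_add_left: "a \<in> A \<Longrightarrow> b \<in> A \<Longrightarrow> c \<in> A \<Longrightarrow> mul (a + b) c = mul a c + mul b c"
  and mul_add_right: "a \<in> A \<Longrightarrow> b \<in> A \<Longrightarrow> c \<in> A \<Longrightarrow> mul a (b + c) = mul a b + mul a c"
  and mul_scale_left: "a \<in> A \<Longrightarrow> b \<in> A \<Longrightarrow> mul (scaleC_op z a) b = scaleC_op z (mul a b)"
  and mul_scale_right: "a \<in> A \<Longrightarrow> b \<in> A \<Longrightarrow> mul a (scaleC_op z b) = scaleC_op z (mul a b)"
  and mul_assoc: "a \<in> A \<Longrightarrow> b \<in> A \<Longrightarrow> c \<in> A \<Longrightarrow> mul (mul a b) c = mul a (mul b c)"
  using algebra by (auto simp: algebra_on_def)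

lemma mul_zero_right: "a \<in> A \<Longrightarrow> mul a 0 = 0"
  using mul_scale_right[of a 0 0] A_zero by simp

lemma mul_zero_left: "a \<in> A \<Longrightarrow> mul 0 a = 0"
  using mul_scale_left[of 0 a 0] A_zero by simp

definition mat_mul_row :: "nat \<Rightarrow> (nat \<Rightarrow> 'k \<Rightarrow>\<^sub>L 'k) \<Rightarrow> (nat \<Rightarrow> nat \<Rightarrow> 'k \<Rightarrow>\<^sub>L 'k) \<Rightarrow> nat \<Rightarrow> 'k \<Rightarrow>\<^sub>L 'k" where
  "mat_mul_row n a v = (\<lambda>j. \<Sum>k<n. mul (a k) (v k j))"

text \<open>
  The test functions. Stacking two columns adds their functions, and scaling a column multiplies its
  function by a positive number, so they form a convex cone.
\<close>

definition column_squares :: "nat \<Rightarrow> ((nat \<Rightarrow> 'k) \<Rightarrow> real) set" where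
  "column_squares p = {column_square p N w | N w. \<forall>i j. w i j \<in> A}"

definition contraction_pairs :: "nat \<Rightarrow> (((nat \<Rightarrow> 'k) \<Rightarrow> real) \<times> ((nat \<Rightarrow> 'k) \<Rightarrow> real)) set" where
  "contraction_pairs p = {(column_square p n (\<lambda>i. mat_mul_row n (x i) v), column_square p n v) | n x v.
     n \<ge> 1 \<and> x \<in> Mat n A \<and> matnorm n x \<le> 1 \<and> (\<forall>i j. v i j \<in> A)}"

lemma mat_mul_row_closed:
  "x \<in> Mat n A \<Longrightarrow> i < n \<Longrightarrow> (\<And>k j. v k j \<in> A) \<Longrightarrow> mat_mul_row n (x i) v j \<in> A"
  unfolding mat_mul_row_def Mat_def by (intro A_sum mul_closed) auto

lemma column_square_mat_mul_row_in:
  assumes "x \<in> Mat n A" "\<And>i j. v i j \<in> A"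
  shows "column_square p n (\<lambda>i. mat_mul_row n (x i) v) \<in> column_squares p"
proof -
  have "column_square p n (\<lambda>i. mat_mul_row n (x i) v)
      = column_square p n (\<lambda>i. if i < n then mat_mul_row n (x i) v else (\<lambda>_. 0))"
    by (simp add: column_square_def fun_eq_iff)
  thus ?thesis unfolding column_squares_def
    using mat_mul_row_closed[OF assms(1) _ assms(2)] A_zero by fastforce
qed

lemma contraction_pairs_subset: "contraction_pairs p \<subseteq> column_squares p \<times> column_squares p"
  unfolding contraction_pairs_def using column_square_mat_mul_row_in
  by (auto simp: column_squares_def)

lemma column_squares_cone:
  assumes "k \<in> column_squares p" "w \<in> column_squares p" "t \<ge> 0"
  shows "(\<lambda>\<xi>. k \<xi> + t * w \<xi>) \<in> column_squares p"
proof -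
  obtain N u N' u' where u: "k = column_square p N u" "\<forall>i j. u i j \<in> A"
    "w = column_square p N' u'" "\<forall>i j. u' i j \<in> A"
    using assms by (auto simp: column_squares_def)
  have "(\<lambda>\<xi>. k \<xi> + t * w \<xi>) =
      column_square p (N + (N' + 0)) (stack N u N' (\<lambda>i j. scaleC_op (of_real (sqrt t)) (u' i j)))"
    unfolding column_square_stack column_square_scale u using assms(3) by simp
  moreover have "stack N u N' (\<lambda>i j. scaleC_op (of_real (sqrt t)) (u' i j)) i j \<in> A" for i j
    using u A_zero A_scale by (simp add: stack_def)
  ultimately show ?thesis unfolding column_squares_def by blast
qed

lemma column_squares_bounded:
  assumes "k \<in> column_squares p"
  shows "\<exists>M. \<forall>\<^sub>F \<xi> in principal (unit_ball p). \<bar>k \<xi>\<bar> \<le> M"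
proof -
  obtain N w where k: "k = column_square p N w" using assms by (auto simp: column_squares_def)
  have "\<bar>k \<xi>\<bar> \<le> (\<Sum>i<N. (\<Sum>j<p. norm (w i j))\<^sup>2)" if "\<xi> \<in> unit_ball p" for \<xi>
  proof -
    have "\<bar>k \<xi>\<bar> = k \<xi>" by (simp add: k column_square_nonneg)
    also have "\<dots> \<le> (\<Sum>i<N. (\<Sum>j<p. norm (w i j))\<^sup>2)"
      unfolding k column_square_def by (intro sum_mono power_mono norm_row_apply_le that) simp
    finally show ?thesis .
  qed
  thus ?thesis by (auto simp: eventually_principal)
qed

text \<open>
  The only place where the bound enters. Rows of length \<open>p\<close> become rows of a square matrix by
  padding with zeros: the matrix \<open>y\<close> has the rows of \<open>v\<close> on top, those of \<open>w\<close> below, and enough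
  zero rows to have at least \<open>p\<close> columns. Its squared norm is the supremum of \<open>h + k\<close>, and that of
  \<open>(x \<oplus> Id) y\<close> is the supremum of \<open>g + k\<close>.
\<close>

lemma majorizing_unit_ball:
  assumes bound: "oplus_Id_bound A mul"
  shows "majorizing (column_squares p) (contraction_pairs p) (principal (unit_ball p))"
  unfolding majorizing_def
proof (clarify)
  fix g h k and c c' :: real
  assume "(g, h) \<in> contraction_pairs p" "k \<in> column_squares p" and "c < c'"
    and ev: "\<forall>\<^sub>F \<xi> in principal (unit_ball p). h \<xi> + k \<xi> \<le> c"
  then obtain n x v N w where gh: "g = column_square p n (\<lambda>i. mat_mul_row n (x i) v)"
    "h = column_square p n v" and n: "n \<ge> 1" and x: "x \<in> Mat n A" "matnorm n x \<le> 1"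
    and v: "\<And>i j. v i j \<in> A" and k: "k = column_square p N w" and w: "\<And>i j. w i j \<in> A"
    by (auto simp: column_squares_def contraction_pairs_def)
  \<comment> \<open>The summand \<open>p\<close> makes room for \<open>p\<close> columns, and the last one keeps the lower block nonempty.\<close>
  define M where "M = n + (N + (p + 1))"
  have pM: "p \<le> M" by (simp add: M_def)
  define trunc :: "(nat \<Rightarrow> nat \<Rightarrow> 'k \<Rightarrow>\<^sub>L 'k) \<Rightarrow> nat \<Rightarrow> nat \<Rightarrow> 'k \<Rightarrow>\<^sub>L 'k"
    where "trunc Y = (\<lambda>i j. if j < p then Y i j else 0)" for Y
  define y where "y = trunc (stack n v N w)"
  have y: "y \<in> Mat M A" using v w A_zero by (simp add: Mat_def y_def trunc_def stack_def)
  have c: "column_square p n v \<xi> + column_square p N w \<xi> \<le> c" if "\<xi> \<in> unit_ball p" for \<xi>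
    using ev that by (simp add: gh k eventually_principal)
  have "c \<ge> 0"
    by (rule order_trans[OF _ c[of "\<lambda>_. 0"]])
      (simp_all add: column_square_nonneg unit_ball_def L2_set_def)
  have norm_y: "matnorm M y \<le> sqrt c"
  proof (rule matnorm_le_ballI)
    fix \<zeta> :: "nat \<Rightarrow> 'k" assume "L2_set (\<lambda>j. norm (\<zeta> j)) {..<M} \<le> 1"
    moreover have "L2_set (\<lambda>j. norm (\<zeta> j)) {..<p} \<le> L2_set (\<lambda>j. norm (\<zeta> j)) {..<M}"
      unfolding L2_set_def using pM by (intro real_sqrt_le_mono sum_mono2) auto
    ultimately have "\<zeta> \<in> unit_ball p" by (simp add: unit_ball_def)
    from c[OF this]
    have "(L2_set (\<lambda>i. norm (\<Sum>j<M. blinfun_apply (y i j) (\<zeta> j))) {..<M})\<^sup>2 \<le> c"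
      unfolding y_def trunc_def column_square_matrix[OF pM] by (simp only: M_def column_square_stack)
    thus "L2_set (\<lambda>i. norm (\<Sum>j<M. blinfun_apply (y i j) (\<zeta> j))) {..<M} \<le> sqrt c"
      by (rule real_le_rsqrt)
  qed
  have product: "oplus_Id_mult mul n x y = trunc (stack n (\<lambda>i. mat_mul_row n (x i) v) N w)"
  proof (intro ext)
    fix i j
    show "oplus_Id_mult mul n x y i j = trunc (stack n (\<lambda>i. mat_mul_row n (x i) v) N w) i j"
      using x(1) mul_zero_right
      by (auto simp: oplus_Id_mult_def y_def trunc_def stack_def mat_mul_row_def Mat_def
          intro!: sum.neutral)
  qed
  have "matnorm M (oplus_Id_mult mul n x y) \<le> max (matnorm n x) 1 * matnorm M y"
  proof -
    have "N + (p + 1) \<ge> 1" by simp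
    thus ?thesis using bound n x(1) y unfolding oplus_Id_bound_def M_def by blast
  qed
  also have "\<dots> = matnorm M y" using x(2) by simp
  finally have norm_product: "matnorm M (oplus_Id_mult mul n x y) \<le> sqrt c" using norm_y by simp
  have "g \<xi> + k \<xi> \<le> c" if \<xi>: "\<xi> \<in> unit_ball p" for \<xi>
  proof -
    define \<zeta> where "\<zeta> j = (if j < p then \<xi> j else 0)" for j
    have "L2_set (\<lambda>j. norm (\<zeta> j)) {..<M} = L2_set (\<lambda>j. norm (\<xi> j)) {..<p}"
      unfolding L2_set_def using pM
      by (intro arg_cong[of _ _ sqrt] sum.mono_neutral_cong_right) (auto simp: \<zeta>_def)
    hence ball: "L2_set (\<lambda>j. norm (\<zeta> j)) {..<M} \<le> 1" using \<xi> by (simp add: unit_ball_def)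
    have "g \<xi> + k \<xi> = column_square p M (stack n (\<lambda>i. mat_mul_row n (x i) v) N w) \<xi>"
      by (simp only: gh k M_def column_square_stack)
    also have "\<dots> = column_square p M (stack n (\<lambda>i. mat_mul_row n (x i) v) N w) \<zeta>"
      by (rule column_square_cong) (simp add: \<zeta>_def)
    also have "\<dots> = (L2_set (\<lambda>i. norm (\<Sum>j<M. blinfun_apply (oplus_Id_mult mul n x y i j) (\<zeta> j))) {..<M})\<^sup>2"
      unfolding product trunc_def column_square_matrix[OF pM] ..
    also have "\<dots> \<le> (sqrt c)\<^sup>2"
      by (intro power_mono order_trans[OF matnorm_upper[OF ball] norm_product]) simp
    finally show ?thesis using \<open>c \<ge> 0\<close> by simp
  qed
  thus "\<forall>\<^sub>F \<xi> in principal (unit_ball p). g \<xi> + k \<xi> \<le> c'"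
    unfolding eventually_principal using \<open>c < c'\<close> by force
qed

end

text \<open>
  A positive form on rows over \<open>A\<close> for which left multiplication by matrices is contractive, and
  which attains the norm of one given \<open>p \<times> p\<close> matrix \<open>x0\<close>. The assumptions \<open>bounded\<close> and \<open>unit\<close>
  control the form by the norm of \<open>A\<close>, on single rows and on the diagonal \<open>p \<times> p\<close> matrix with entry
  \<open>e\<close>.
\<close>

locale contractive_form = algebra_in_operator_space A mul
  for A :: "('k::complex_hilbert \<Rightarrow>\<^sub>L 'k) set" and mul +
  fixes p :: nat and x0 :: "nat \<Rightarrow> nat \<Rightarrow> 'k \<Rightarrow>\<^sub>L 'k"
    and s :: "(nat \<Rightarrow> 'k \<Rightarrow>\<^sub>L 'k) \<Rightarrow> (nat \<Rightarrow> 'k \<Rightarrow>\<^sub>L 'k) \<Rightarrow> complex"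
  assumes add: "\<And>u v w. \<lbrakk>\<And>j. u j \<in> A; \<And>j. v j \<in> A; \<And>j. w j \<in> A\<rbrakk> \<Longrightarrow>
      s (\<lambda>j. u j + v j) w = s u w + s v w"
    and scale: "\<And>c u w. \<lbrakk>\<And>j. u j \<in> A; \<And>j. w j \<in> A\<rbrakk> \<Longrightarrow> s (\<lambda>j. scaleC_op c (u j)) w = c * s u w"
    and hermitian: "\<And>u w. \<lbrakk>\<And>j. u j \<in> A; \<And>j. w j \<in> A\<rbrakk> \<Longrightarrow> s u w = cnj (s w u)"
    and nonneg: "\<And>u. (\<And>j. u j \<in> A) \<Longrightarrow> 0 \<le> Re (s u u)"
    and bounded: "\<And>u. (\<And>j. u j \<in> A) \<Longrightarrow> Re (s u u) \<le> (\<Sum>j<p. norm (u j))\<^sup>2"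
    and unit: "\<And>e. e \<in> A \<Longrightarrow>
      (\<Sum>l<p. Re (s (\<lambda>j. if j = l then e else 0) (\<lambda>j. if j = l then e else 0))) \<le> (norm e)\<^sup>2"
    and attains: "x0 \<in> Mat p A \<Longrightarrow>
      (\<Sum>i<p. Re (s (\<lambda>j. if j < p then x0 i j else 0) (\<lambda>j. if j < p then x0 i j else 0)))
        = (matnorm p x0)\<^sup>2"
    and contractive: "\<And>n x v. \<lbrakk>n \<ge> 1; x \<in> Mat n A; \<And>i j. v i j \<in> A\<rbrakk> \<Longrightarrow>
      (\<Sum>i<n. Re (s (mat_mul_row n (x i) v) (mat_mul_row n (x i) v)))
        \<le> (matnorm n x)\<^sup>2 * (\<Sum>i<n. Re (s (v i) (v i)))"

text \<open>
  The form is the limit of \<open>\<langle>u \<xi>, v \<xi>\<rangle>\<close> along a filter on the unit ball that comes from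
  \<open>converging_filter_exists\<close>. Convergence off the diagonal follows by polarization. All its
  properties are limits of properties of the forms at \<open>\<xi>\<close>, except that it is contractive and attains the
  norm of \<open>x0\<close>, which comes from the choice of the filter.
\<close>

theorem (in algebra_in_operator_space) contractive_form_exists:
  assumes bound: "oplus_Id_bound A mul"
  shows "\<exists>s. contractive_form A mul p x0 s"
proof -
  \<comment> \<open>The entries of \<open>x0\<close> outside the \<open>p \<times> p\<close> block need not lie in \<open>A\<close>.\<close>
  define x1 where "x1 i j = (if x0 \<in> Mat p A \<and> i < p \<and> j < p then x0 i j else 0)" for i j
  have x1: "x1 i j \<in> A" for i j by (simp add: x1_def A_zero Mat_def)
  have zero: "(\<lambda>_. 0) \<in> column_squares p"
    unfolding column_squares_def using A_zero
    by (auto intro!: exI[of _ 0] exI[of _ "\<lambda>_ _. 0"] simp: column_square_def)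
  have "unit_ball p \<noteq> ({} :: (nat \<Rightarrow> 'k) set)"
    by (auto simp: unit_ball_def L2_set_def intro!: exI[of _ "\<lambda>_. 0"])
  hence ne: "principal (unit_ball p :: (nat \<Rightarrow> 'k) set) \<noteq> bot" by (simp add: principal_eq_bot_iff)
  have x1_in: "column_square p p x1 \<in> column_squares p"
    unfolding column_squares_def using x1 by blast
  obtain F where F: "F \<le> principal (unit_ball p)" "F \<noteq> bot"
    "(column_square p p x1 \<longlongrightarrow> (matnorm p x1)\<^sup>2) F"
    "\<And>k. k \<in> column_squares p \<Longrightarrow> \<exists>L. (k \<longlongrightarrow> L) F"
    "\<And>g h a b. (g, h) \<in> contraction_pairs p \<Longrightarrow> (g \<longlongrightarrow> a) F \<Longrightarrow> (h \<longlongrightarrow> b) F \<Longrightarrow> a \<le> b"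
    using converging_filter_exists[OF majorizing_unit_ball[OF bound] ne column_squares_cone zero
        contraction_pairs_subset column_squares_bounded x1_in upper_limit_matnorm] by blast
  have in_ball: "\<forall>\<^sub>F \<xi> in F. \<xi> \<in> unit_ball p"
    using F(1) by (simp add: le_principal)
  define f where
    "f u v \<xi> = cinner (row_apply p u \<xi>) (row_apply p v \<xi>)"
    for u v :: "nat \<Rightarrow> 'k \<Rightarrow>\<^sub>L 'k" and \<xi>
  have f_self: "f u u \<xi> = of_real ((norm (row_apply p u \<xi>))\<^sup>2)" for u \<xi>
    by (simp add: f_def cinner_self)
  have conv_square: "\<exists>L. ((\<lambda>\<xi>. (norm (row_apply p u \<xi>))\<^sup>2) \<longlongrightarrow> L) F" if "\<And>j. u j \<in> A" for u
  proof -
    have "column_square p 1 (\<lambda>_. u) \<in> column_squares p"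
      unfolding column_squares_def using that by blast
    from F(4)[OF this] show ?thesis by (simp add: column_square_def[abs_def])
  qed
  have conv_Re: "\<exists>L. ((\<lambda>\<xi>. Re (f u v \<xi>)) \<longlongrightarrow> L) F" if uv: "\<And>j. u j \<in> A" "\<And>j. v j \<in> A" for u v
  proof -
    obtain a b c where "((\<lambda>\<xi>. (norm (row_apply p u \<xi>))\<^sup>2) \<longlongrightarrow> a) F"
      "((\<lambda>\<xi>. (norm (row_apply p v \<xi>))\<^sup>2) \<longlongrightarrow> b) F"
      "((\<lambda>\<xi>. (norm (row_apply p (\<lambda>j. u j - v j) \<xi>))\<^sup>2) \<longlongrightarrow> c) F"
      using conv_square[of u, OF uv(1)] conv_square[of v, OF uv(2)]
        conv_square[of "\<lambda>j. u j - v j", OF A_diff[OF uv]] by blast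
    hence "((\<lambda>\<xi>. ((norm (row_apply p u \<xi>))\<^sup>2 + (norm (row_apply p v \<xi>))\<^sup>2
        - (norm (row_apply p (\<lambda>j. u j - v j) \<xi>))\<^sup>2) / 2) \<longlongrightarrow> (a + b - c) / 2) F"
      by (intro tendsto_intros) simp_all
    moreover have "((norm (row_apply p u \<xi>))\<^sup>2 + (norm (row_apply p v \<xi>))\<^sup>2
        - (norm (row_apply p (\<lambda>j. u j - v j) \<xi>))\<^sup>2) / 2 = Re (f u v \<xi>)" for \<xi>
      by (simp add: f_def row_apply_diff norm_diff_square)
    ultimately show ?thesis by auto
  qed
  have conv: "\<exists>L. (f u v \<longlongrightarrow> L) F" if uv: "\<And>j. u j \<in> A" "\<And>j. v j \<in> A" for u v
  proof -
    obtain a where a: "((\<lambda>\<xi>. Re (f u v \<xi>)) \<longlongrightarrow> a) F" using conv_Re[of u v, OF uv] by blast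
    obtain b where b: "((\<lambda>\<xi>. Re (f u (\<lambda>j. scaleC_op \<i> (v j)) \<xi>)) \<longlongrightarrow> b) F"
      using conv_Re[of u "\<lambda>j. scaleC_op \<i> (v j)"] uv A_scale by blast
    have "Re (f u (\<lambda>j. scaleC_op \<i> (v j)) \<xi>) = Im (f u v \<xi>)" for \<xi>
      by (simp add: f_def row_apply_scale hilbert.ip_scale_right)
    hence "((\<lambda>\<xi>. Im (f u v \<xi>)) \<longlongrightarrow> b) F" using b by simp
    from tendsto_Complex[OF a this] show ?thesis by auto
  qed
  define s where "s u v = Lim F (f u v)" for u v
  have s: "(f u v \<longlongrightarrow> s u v) F" if uv: "\<And>j. u j \<in> A" "\<And>j. v j \<in> A" for u v
    unfolding s_def using conv[of u v, OF uv] F(2) tendsto_Lim by metis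
  have s_eq: "s u v = L" if "(f u v \<longlongrightarrow> L) F" for u v L
    unfolding s_def using tendsto_Lim[OF F(2) that] .
  have s_square: "((\<lambda>\<xi>. (norm (row_apply p u \<xi>))\<^sup>2) \<longlongrightarrow> Re (s u u)) F" if "\<And>j. u j \<in> A" for u
    using tendsto_Re[OF s[of u u, OF that that]] by (simp add: f_self)
  have s_column: "(column_square p N w \<longlongrightarrow> (\<Sum>i<N. Re (s (w i) (w i)))) F"
    if "\<And>i j. i < N \<Longrightarrow> w i j \<in> A" for N w
    unfolding column_square_def[abs_def] by (intro tendsto_sum s_square that) simp
  have scale: "s (\<lambda>j. scaleC_op c (u j)) w = c * s u w" if "\<And>j. u j \<in> A" "\<And>j. w j \<in> A" for c u w
    by (rule s_eq) (use tendsto_mult_left[OF s[of u w, OF that], of c] in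
        \<open>simp add: f_def[abs_def] row_apply_scale cinner_scaleC_left\<close>)
  have hermitian: "s u w = cnj (s w u)" if "\<And>j. u j \<in> A" "\<And>j. w j \<in> A" for u w
  proof (rule s_eq)
    have "((\<lambda>\<xi>. cnj (f w u \<xi>)) \<longlongrightarrow> cnj (s w u)) F"
      by (intro tendsto_cnj s that)
    thus "(f u w \<longlongrightarrow> cnj (s w u)) F"
      by (simp add: f_def[abs_def] flip: cinner_commute)
  qed
  \<comment> \<open>Only matrices of norm at most 1 enter the comparison of suprema; the others are rescaled.\<close>
  have Re_scale: "Re (s (\<lambda>j. scaleC_op c (u j)) (\<lambda>j. scaleC_op c (u j))) = (cmod c)\<^sup>2 * Re (s u u)"
    if u: "\<And>j. u j \<in> A" for c u
  proof (rule tendsto_unique[OF F(2) s_square])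
    show "((\<lambda>\<xi>. (norm (row_apply p (\<lambda>j. scaleC_op c (u j)) \<xi>))\<^sup>2) \<longlongrightarrow> (cmod c)\<^sup>2 * Re (s u u)) F"
      by (simp add: row_apply_scale norm_scaleC power_mult_distrib) (intro tendsto_mult_left s_square u)
  qed (use u A_scale in simp)
  have "contractive_form A mul p x0 s"
  proof
    show "s (\<lambda>j. u j + v j) w = s u w + s v w" if "\<And>j. u j \<in> A" "\<And>j. v j \<in> A" "\<And>j. w j \<in> A" for u v w
      by (rule s_eq) (use tendsto_add[OF s[of u w, OF that(1,3)] s[of v w, OF that(2,3)]] in
          \<open>simp add: f_def[abs_def] row_apply_add cinner_add_left\<close>)
    show "0 \<le> Re (s u u)" if "\<And>j. u j \<in> A" for u
      by (rule tendsto_lowerbound[OF s_square[of u, OF that] _ F(2)]) simp_all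
    show "Re (s u u) \<le> (\<Sum>j<p. norm (u j))\<^sup>2" if "\<And>j. u j \<in> A" for u
    proof (rule tendsto_upperbound[OF s_square[of u, OF that] _ F(2)])
      show "\<forall>\<^sub>F \<xi> in F. (norm (row_apply p u \<xi>))\<^sup>2 \<le> (\<Sum>j<p. norm (u j))\<^sup>2"
        using in_ball by eventually_elim (intro power_mono norm_row_apply_le, auto)
    qed
    show "(\<Sum>l<p. Re (s (\<lambda>j. if j = l then e else 0) (\<lambda>j. if j = l then e else 0))) \<le> (norm e)\<^sup>2"
      if e: "e \<in> A" for e
    proof (rule tendsto_upperbound[OF s_column[of p "\<lambda>l j. if j = l then e else 0"] _ F(2)])
      show "\<forall>\<^sub>F \<xi> in F. column_square p p (\<lambda>l j. if j = l then e else 0) \<xi> \<le> (norm e)\<^sup>2"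
        using in_ball
      proof eventually_elim
        case (elim \<xi>)
        have "column_square p p (\<lambda>l j. if j = l then e else 0) \<xi> = (\<Sum>l<p. (norm (blinfun_apply e (\<xi> l)))\<^sup>2)"
          by (simp add: column_square_def row_apply_single)
        also have "\<dots> \<le> (\<Sum>l<p. (norm e)\<^sup>2 * (norm (\<xi> l))\<^sup>2)"
          using norm_blinfun[of e] by (intro sum_mono) (simp add: power_mono flip: power_mult_distrib)
        also have "\<dots> = (norm e)\<^sup>2 * (L2_set (\<lambda>l. norm (\<xi> l)) {..<p})\<^sup>2"
          by (simp add: L2_set_power2 sum_distrib_left)
        also have "\<dots> \<le> (norm e)\<^sup>2 * 1"
          using elim by (intro mult_left_mono power_le_one) (auto simp: unit_ball_def)
        finally show ?case by simp
      qed
    qed (use e A_zero in simp)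
    show "(\<Sum>i<p. Re (s (\<lambda>j. if j < p then x0 i j else 0) (\<lambda>j. if j < p then x0 i j else 0)))
        = (matnorm p x0)\<^sup>2" if x0: "x0 \<in> Mat p A"
    proof -
      have "(\<Sum>i<p. Re (s (x1 i) (x1 i))) = (matnorm p x1)\<^sup>2"
        by (rule tendsto_unique[OF F(2) s_column F(3)]) (rule x1)
      moreover have "x1 i = (\<lambda>j. if j < p then x0 i j else 0)" if "i < p" for i
        using x0 that by (simp add: x1_def fun_eq_iff)
      moreover have "matnorm p x1 = matnorm p x0"
        by (rule matnorm_cong) (use x0 in \<open>simp add: x1_def\<close>)
      ultimately show ?thesis by simp
    qed
    show "(\<Sum>i<n. Re (s (mat_mul_row n (x i) v) (mat_mul_row n (x i) v)))
        \<le> (matnorm n x)\<^sup>2 * (\<Sum>i<n. Re (s (v i) (v i)))"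
      if n: "n \<ge> 1" and x: "x \<in> Mat n A" and v: "\<And>i j. v i j \<in> A" for n x v
    proof -
      define r where "r = matnorm n x"
      have xA: "x i k \<in> A" if "i < n" "k < n" for i k using x that by (simp add: Mat_def)
      show ?thesis
      proof (cases "r = 0")
        case True
        have "x i k = 0" if "i < n" "k < n" for i k
          using norm_entry_le_matnorm[OF that, of x] True by (simp add: r_def)
        hence "mat_mul_row n (x i) v = (\<lambda>j. scaleC_op 0 (0 :: 'k \<Rightarrow>\<^sub>L 'k))" if "i < n" for i
          using that v by (simp add: mat_mul_row_def mul_zero_left)
        moreover have "Re (s (\<lambda>j. scaleC_op 0 (0 :: 'k \<Rightarrow>\<^sub>L 'k)) (\<lambda>j. scaleC_op 0 0)) = 0"
          by (subst Re_scale[of "\<lambda>_. 0" 0]) (simp_all add: A_zero)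
        ultimately show ?thesis using True by (simp add: r_def)
      next
        case False
        hence r: "r > 0" using matnorm_nonneg[of n x] by (simp add: r_def)
        define c :: complex where "c = of_real (inverse r)"
        define x' where "x' = (\<lambda>i k. scaleC_op c (x i k))"
        have x': "x' \<in> Mat n A" using x A_scale by (auto simp: Mat_def x'_def)
        have "matnorm n x' \<le> cmod c * r" unfolding x'_def r_def by (rule matnorm_scaleC_op_le)
        hence x'_norm: "matnorm n x' \<le> 1" using r by (simp add: c_def norm_inverse)
        have row: "mat_mul_row n (x' i) v = (\<lambda>j. scaleC_op c (mat_mul_row n (x i) v j))" if "i < n" for i
          using that by (simp add: mat_mul_row_def x'_def xA v mul_scale_left op.scale_sum_right)
        have "(\<Sum>i<n. Re (s (mat_mul_row n (x' i) v) (mat_mul_row n (x' i) v))) \<le> (\<Sum>i<n. Re (s (v i) (v i)))"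
        proof (rule F(5))
          show "(column_square p n (\<lambda>i. mat_mul_row n (x' i) v), column_square p n v) \<in> contraction_pairs p"
            unfolding contraction_pairs_def using n x' x'_norm v by blast
          show "(column_square p n (\<lambda>i. mat_mul_row n (x' i) v) \<longlongrightarrow>
              (\<Sum>i<n. Re (s (mat_mul_row n (x' i) v) (mat_mul_row n (x' i) v)))) F"
            by (rule s_column) (rule mat_mul_row_closed[OF x' _ v])
          show "(column_square p n v \<longlongrightarrow> (\<Sum>i<n. Re (s (v i) (v i)))) F"
            by (rule s_column) (rule v)
        qed
        moreover have "(\<Sum>i<n. Re (s (mat_mul_row n (x' i) v) (mat_mul_row n (x' i) v)))
            = (\<Sum>i<n. (inverse r)\<^sup>2 * Re (s (mat_mul_row n (x i) v) (mat_mul_row n (x i) v)))"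
          using Re_scale[OF mat_mul_row_closed[OF x _ v], of _ c] r
          by (intro sum.cong refl) (simp add: row c_def norm_inverse)
        ultimately have "r\<^sup>2 * ((inverse r)\<^sup>2 *
            (\<Sum>i<n. Re (s (mat_mul_row n (x i) v) (mat_mul_row n (x i) v)))) \<le> r\<^sup>2 * (\<Sum>i<n. Re (s (v i) (v i)))"
          by (intro mult_left_mono) (simp_all add: sum_distrib_left)
        moreover have "r\<^sup>2 * (inverse r)\<^sup>2 = 1" using r by (simp add: power_inverse)
        ultimately show ?thesis by (simp only: r_def[symmetric] mult.assoc[symmetric] mult_1)
      qed
    qed
  qed (fact scale hermitian)+
  thus ?thesis by blast
qed

section \<open>The direct sum of the contractive forms\<close>

lemma lookup_map_zero: "h 0 = 0 \<Longrightarrow> poly_mapping.lookup (Poly_Mapping.map h u) l = h (poly_mapping.lookup u l)"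
  by (cases "poly_mapping.lookup u l = 0") (simp_all add: Poly_Mapping.map.rep_eq)

abbreviation pm_scale ::
  "complex \<Rightarrow> ('l \<Rightarrow>\<^sub>0 ('h::complex_hilbert \<Rightarrow>\<^sub>L 'h)) \<Rightarrow> ('l \<Rightarrow>\<^sub>0 ('h \<Rightarrow>\<^sub>L 'h))"
  where "pm_scale c \<equiv> Poly_Mapping.map (scaleC_op c)"

lemma vector_space_pm_scale: "vector_space (pm_scale :: complex \<Rightarrow> ('l \<Rightarrow>\<^sub>0 ('h::complex_hilbert \<Rightarrow>\<^sub>L 'h)) \<Rightarrow> _)"
  by unfold_locales
    (rule poly_mapping_eqI;
      simp add: lookup_map_zero lookup_add op.scale_right_distrib op.scale_left_distrib)+

text \<open>
  The elements of the direct sum of the spaces of rows over all labels \<open>(p, x0)\<close>. They are encoded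
  as finitely supported functions of a label and a position, which makes the sum of the forms finite.
\<close>

type_synonym 'x vectors = "((nat \<times> (nat \<Rightarrow> nat \<Rightarrow> 'x \<Rightarrow>\<^sub>L 'x)) \<times> nat) \<Rightarrow>\<^sub>0 ('x \<Rightarrow>\<^sub>L 'x)"

definition row_at :: "'l \<Rightarrow> ('l \<times> nat \<Rightarrow>\<^sub>0 'b::zero) \<Rightarrow> nat \<Rightarrow> 'b" where
  "row_at l u = (\<lambda>j. poly_mapping.lookup u (l, j))"

definition row_labels :: "('l \<times> nat \<Rightarrow>\<^sub>0 'b::zero) \<Rightarrow> 'l set" where
  "row_labels u = fst ` Poly_Mapping.keys u"

lemma finite_row_labels [simp]: "finite (row_labels u)"
  by (simp add: row_labels_def)

lemma row_at_outside: "l \<notin> row_labels u \<Longrightarrow> row_at l u = (\<lambda>_. 0)"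
proof
  fix j assume "l \<notin> row_labels u"
  hence "(l, j) \<notin> Poly_Mapping.keys u" unfolding row_labels_def by (metis fst_conv imageI)
  thus "row_at l u j = 0" by (simp add: row_at_def in_keys_iff)
qed

context algebra_in_operator_space
begin

definition A_valued :: "('l \<Rightarrow>\<^sub>0 ('k \<Rightarrow>\<^sub>L 'k)) set" where
  "A_valued = {u. \<forall>l. poly_mapping.lookup u l \<in> A}"

definition lmul :: "('k \<Rightarrow>\<^sub>L 'k) \<Rightarrow> ('l \<Rightarrow>\<^sub>0 ('k \<Rightarrow>\<^sub>L 'k)) \<Rightarrow> ('l \<Rightarrow>\<^sub>0 ('k \<Rightarrow>\<^sub>L 'k))" where
  "lmul a = Poly_Mapping.map (mul a)"

lemma lookup_lmul: "a \<in> A \<Longrightarrow> poly_mapping.lookup (lmul a u) l = mul a (poly_mapping.lookup u l)"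
  by (simp add: lmul_def lookup_map_zero mul_zero_right)

lemma lmul_closed: "a \<in> A \<Longrightarrow> u \<in> A_valued \<Longrightarrow> lmul a u \<in> A_valued"
  by (simp add: A_valued_def lookup_lmul mul_closed)

lemma lookup_in: "u \<in> A_valued \<Longrightarrow> poly_mapping.lookup u l \<in> A"
  by (simp add: A_valued_def)

lemma row_at_in: "u \<in> A_valued \<Longrightarrow> row_at l u j \<in> A"
  by (simp add: row_at_def lookup_in)

end

locale contractive_forms = algebra_in_operator_space A mul
  for A :: "('k::complex_hilbert \<Rightarrow>\<^sub>L 'k) set" and mul +
  fixes s :: "nat \<times> (nat \<Rightarrow> nat \<Rightarrow> 'k \<Rightarrow>\<^sub>L 'k) \<Rightarrow>
    (nat \<Rightarrow> 'k \<Rightarrow>\<^sub>L 'k) \<Rightarrow> (nat \<Rightarrow> 'k \<Rightarrow>\<^sub>L 'k) \<Rightarrow> complex"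
  assumes contractive_form: "\<And>l. contractive_form A mul (fst l) (snd l) (s l)"
begin

lemmas s_add = contractive_form.add[OF contractive_form]
  and s_scale = contractive_form.scale[OF contractive_form]
  and s_hermitian = contractive_form.hermitian[OF contractive_form]
  and s_nonneg = contractive_form.nonneg[OF contractive_form]
  and s_bounded = contractive_form.bounded[OF contractive_form[of "(p, x)" for p x], unfolded fst_conv snd_conv]
  and s_unit = contractive_form.unit[OF contractive_form[of "(p, x)" for p x], unfolded fst_conv snd_conv]
  and s_attains = contractive_form.attains[OF contractive_form[of "(p, x)" for p x], unfolded fst_conv snd_conv]
  and s_contractive = contractive_form.contractive[OF contractive_form]

definition form :: "'k vectors \<Rightarrow> 'k vectors \<Rightarrow> complex" where
  "form u v = (\<Sum>l\<in>row_labels u. s l (row_at l u) (row_at l v))"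

lemma s_zero_left: "(\<And>j. w j \<in> A) \<Longrightarrow> s l (\<lambda>_. 0) w = 0"
  using s_scale[of "\<lambda>_. 0" w l 0] A_zero by simp

lemma form_eq:
  assumes "finite I" "row_labels u \<subseteq> I" "v \<in> A_valued"
  shows "form u v = (\<Sum>l\<in>I. s l (row_at l u) (row_at l v))"
  unfolding form_def
proof (rule sum.mono_neutral_left[OF assms(1,2)], rule ballI)
  fix l assume "l \<in> I - row_labels u"
  hence "row_at l u = (\<lambda>_. 0)" by (simp add: row_at_outside)
  thus "s l (row_at l u) (row_at l v) = 0"
    using s_zero_left[of "row_at l v" l, OF row_at_in[OF assms(3)]] by (simp only:)
qed

lemma semi_inner_space_form: "semi_inner_space pm_scale (A_valued :: 'k vectors set) form"
proof -
  interpret vector_space "pm_scale :: complex \<Rightarrow> 'k vectors \<Rightarrow> _" by (rule vector_space_pm_scale)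
  have sub: "subspace (A_valued :: 'k vectors set)"
    unfolding subspace_def A_valued_def
    by (auto simp: A_zero lookup_add A_add lookup_map_zero A_scale)
  show ?thesis
  proof
    show "subspace (A_valued :: 'k vectors set)" by (rule sub)
    fix u v w :: "'k vectors" assume uv: "u \<in> A_valued" "v \<in> A_valued"
    show "form (pm_scale c u) v = c * form u v" for c
    proof -
      have "row_labels (pm_scale c u) \<subseteq> row_labels u"
        by (force simp: row_labels_def in_keys_iff lookup_map_zero)
      hence "form (pm_scale c u) v = (\<Sum>l\<in>row_labels u. s l (row_at l (pm_scale c u)) (row_at l v))"
        by (intro form_eq uv) simp
      moreover have "row_at l (pm_scale c u) = (\<lambda>j. scaleC_op c (row_at l u j))" for l
        by (simp add: row_at_def lookup_map_zero)
      ultimately show ?thesis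
        using uv by (simp add: form_def s_scale row_at_in sum_distrib_left)
    qed
    show "form u v = cnj (form v u)"
    proof -
      let ?I = "row_labels u \<union> row_labels v"
      have "form u v = (\<Sum>l\<in>?I. s l (row_at l u) (row_at l v))"
        "form v u = (\<Sum>l\<in>?I. s l (row_at l v) (row_at l u))"
        by (rule form_eq; use uv in simp)+
      moreover have "s l (row_at l u) (row_at l v) = cnj (s l (row_at l v) (row_at l u))" for l
        using uv by (intro s_hermitian row_at_in)
      ultimately show ?thesis by simp
    qed
    show "0 \<le> Re (form u u)"
      unfolding form_def Re_sum using uv by (intro sum_nonneg s_nonneg row_at_in)
    assume w: "w \<in> A_valued"
    show "form (u + v) w = form u w + form v w"
    proof -
      let ?I = "row_labels u \<union> row_labels v"
      have "row_labels (u + v) \<subseteq> ?I" using Poly_Mapping.keys_add[of u v] by (force simp: row_labels_def)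
      hence "form (u + v) w = (\<Sum>l\<in>?I. s l (row_at l (u + v)) (row_at l w))"
        using w by (intro form_eq) simp_all
      moreover have "form u w = (\<Sum>l\<in>?I. s l (row_at l u) (row_at l w))"
        "form v w = (\<Sum>l\<in>?I. s l (row_at l v) (row_at l w))"
        by (rule form_eq; use w in simp)+
      moreover have "row_at l (u + v) = (\<lambda>j. row_at l u j + row_at l v j)" for l
        by (simp add: row_at_def lookup_add)
      ultimately show ?thesis
        using uv w by (simp add: s_add row_at_in sum.distrib)
    qed
  qed
qed

sublocale semi_inner_space pm_scale "A_valued :: 'k vectors set" form
  by (rule semi_inner_space_form)

text \<open>
  The action of a matrix respects the summands, so contractivity may be added up over the finitely
  many labels involved.
\<close>

lemma form_contractive:
  assumes n: "n \<ge> 1" and x: "x \<in> Mat n A" and v: "\<And>k. v k \<in> A_valued"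
  shows "(\<Sum>i<n. Re (form (\<Sum>k<n. lmul (x i k) (v k)) (\<Sum>k<n. lmul (x i k) (v k))))
    \<le> (matnorm n x)\<^sup>2 * (\<Sum>i<n. Re (form (v i) (v i)))"
proof -
  have xA: "x i k \<in> A" if "i < n" "k < n" for i k using x that by (simp add: Mat_def)
  define y where "y i = (\<Sum>k<n. lmul (x i k) (v k))" for i
  have yV: "y i \<in> A_valued" if "i < n" for i
    unfolding y_def by (intro subspace_sum[OF subspace_V] lmul_closed xA v that) simp
  have row_y: "row_at l (y i) = mat_mul_row n (x i) (\<lambda>k. row_at l (v k))" if "i < n" for i l
    using that by (simp add: row_at_def y_def mat_mul_row_def lookup_sum lookup_lmul xA)
  define I where "I = (\<Union>i<n. row_labels (v i)) \<union> (\<Union>i<n. row_labels (y i))"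
  have form_I: "form u u = (\<Sum>l\<in>I. s l (row_at l u) (row_at l u))"
    if "u \<in> A_valued" "row_labels u \<subseteq> I" for u
    using that by (intro form_eq) (simp_all add: I_def)
  have "(\<Sum>i<n. Re (form (y i) (y i))) = (\<Sum>i<n. \<Sum>l\<in>I. Re (s l (row_at l (y i)) (row_at l (y i))))"
    by (intro sum.cong refl, subst form_I) (auto simp: yV I_def)
  also have "\<dots> = (\<Sum>l\<in>I. \<Sum>i<n. Re (s l (mat_mul_row n (x i) (\<lambda>k. row_at l (v k)))
      (mat_mul_row n (x i) (\<lambda>k. row_at l (v k)))))"
    by (subst sum.swap) (simp add: row_y)
  also have "\<dots> \<le> (\<Sum>l\<in>I. (matnorm n x)\<^sup>2 * (\<Sum>i<n. Re (s l (row_at l (v i)) (row_at l (v i)))))"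
    by (intro sum_mono s_contractive n x row_at_in v)
  also have "\<dots> = (matnorm n x)\<^sup>2 * (\<Sum>i<n. \<Sum>l\<in>I. Re (s l (row_at l (v i)) (row_at l (v i))))"
    by (subst sum.swap) (simp add: sum_distrib_left)
  also have "(\<Sum>i<n. \<Sum>l\<in>I. Re (s l (row_at l (v i)) (row_at l (v i)))) = (\<Sum>i<n. Re (form (v i) (v i)))"
    by (intro sum.cong refl, subst form_I) (auto simp: v I_def)
  finally show ?thesis by (simp add: y_def)
qed

definition row_vector :: "nat \<times> (nat \<Rightarrow> nat \<Rightarrow> 'k \<Rightarrow>\<^sub>L 'k) \<Rightarrow> nat \<Rightarrow> (nat \<Rightarrow> 'k \<Rightarrow>\<^sub>L 'k) \<Rightarrow> 'k vectors" where
  "row_vector l p r = (\<Sum>j<p. Poly_Mapping.single (l, j) (r j))"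

lemma single_in_V: "e \<in> A \<Longrightarrow> Poly_Mapping.single k e \<in> A_valued"
  by (auto simp: A_valued_def lookup_single when_def A_zero)

lemma row_vector_in_V: "(\<And>j. j < p \<Longrightarrow> r j \<in> A) \<Longrightarrow> row_vector l p r \<in> A_valued"
  unfolding row_vector_def by (intro subspace_sum[OF subspace_V] single_in_V) auto

lemma row_at_single: "row_at l (Poly_Mapping.single (l, i) e) = (\<lambda>j. if j = i then e else 0)"
  by (auto simp: row_at_def lookup_single when_def)

lemma row_at_row_vector: "row_at l (row_vector l p r) = (\<lambda>j. if j < p then r j else 0)"
proof
  fix j
  have "row_at l (row_vector l p r) j = (\<Sum>i<p. if j = i then r i else 0)"
    unfolding row_at_def row_vector_def lookup_sum
    by (intro sum.cong) (auto simp: lookup_single when_def)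
  thus "row_at l (row_vector l p r) j = (if j < p then r j else 0)" by simp
qed

lemma form_single_label:
  assumes "u \<in> A_valued" "\<And>l' j. l' \<noteq> l \<Longrightarrow> poly_mapping.lookup u (l', j) = 0"
  shows "form u u = s l (row_at l u) (row_at l u)"
proof -
  have "row_labels u \<subseteq> {l}" using assms(2) by (force simp: row_labels_def in_keys_iff)
  thus ?thesis using form_eq[of "{l}" u u] assms(1) by simp
qed

lemma form_row_vector:
  assumes "\<And>j. j < p \<Longrightarrow> r j \<in> A"
  shows "form (row_vector l p r) (row_vector l p r) =
    s l (\<lambda>j. if j < p then r j else 0) (\<lambda>j. if j < p then r j else 0)"
proof -
  have "form (row_vector l p r) (row_vector l p r) =
      s l (row_at l (row_vector l p r)) (row_at l (row_vector l p r))"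
    by (rule form_single_label[OF row_vector_in_V[OF assms]])
      (auto simp: row_vector_def lookup_sum lookup_single when_def)
  thus ?thesis by (simp only: row_at_row_vector)
qed

lemma form_single:
  assumes "e \<in> A"
  shows "form (Poly_Mapping.single (l, i) e) (Poly_Mapping.single (l, i) e) =
    s l (\<lambda>j. if j = i then e else 0) (\<lambda>j. if j = i then e else 0)"
proof -
  let ?u = "Poly_Mapping.single (l, i) e"
  have "form ?u ?u = s l (row_at l ?u) (row_at l ?u)"
    by (rule form_single_label[OF single_in_V[OF assms]]) (auto simp: lookup_single when_def)
  thus ?thesis by (simp only: row_at_single)
qed

end

section \<open>The left regular representation\<close>

locale left_representation = contractive_forms A mul s +
  ell2_embedding pm_scale "A_valued :: 'k vectors set" form f J
  for A :: "('k::complex_hilbert \<Rightarrow>\<^sub>L 'k) set" and mul s and f :: "'k vectors \<Rightarrow> 'i ell2" and J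
begin

lemma lmul_add_left: "a \<in> A \<Longrightarrow> b \<in> A \<Longrightarrow> u \<in> A_valued \<Longrightarrow> lmul (a + b) u = lmul a u + lmul b u"
  by (rule poly_mapping_eqI) (simp add: lookup_lmul lookup_add A_add mul_add_left lookup_in)

lemma lmul_scale_left: "a \<in> A \<Longrightarrow> u \<in> A_valued \<Longrightarrow> lmul (scaleC_op c a) u = pm_scale c (lmul a u)"
  by (rule poly_mapping_eqI) (simp add: lookup_lmul lookup_map_zero A_scale mul_scale_left lookup_in)

lemma lmul_mul: "a \<in> A \<Longrightarrow> b \<in> A \<Longrightarrow> u \<in> A_valued \<Longrightarrow> lmul (mul a b) u = lmul a (lmul b u)"
  by (rule poly_mapping_eqI) (simp add: lookup_lmul mul_closed mul_assoc lookup_in)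

lemma lmul_single: "a \<in> A \<Longrightarrow> lmul a (Poly_Mapping.single k e) = Poly_Mapping.single k (mul a e)"
  by (rule poly_mapping_eqI) (simp add: lookup_lmul lookup_single when_def mul_zero_right)

text \<open>
  Annihilating the coordinates outside \<open>J\<close> makes the representing operator unique, hence the
  representation linear and multiplicative.
\<close>

definition represents :: "('k \<Rightarrow>\<^sub>L 'k) \<Rightarrow> ('i ell2 \<Rightarrow>\<^sub>L 'i ell2) \<Rightarrow> bool" where
  "represents a S \<longleftrightarrow> S \<in> BH \<and> (\<forall>v\<in>A_valued. blinfun_apply S (f v) = f (lmul a v)) \<and>
     (\<forall>x. blinfun_apply S x = blinfun_apply S (ell2_restrict J x))"

lemma represents_exists:
  assumes a: "a \<in> A"
  shows "\<exists>S. represents a S"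
proof -
  have bound: "Re (form (lmul a v) (lmul a v)) \<le> (norm a)\<^sup>2 * Re (form v v)" if "v \<in> A_valued" for v
    using form_contractive[of 1 "\<lambda>_ _. a" "\<lambda>_. v"] a that matnorm_1[of a] by (simp add: Mat_def)
  obtain S where "S \<in> BH" "\<And>v. v \<in> A_valued \<Longrightarrow> blinfun_apply S (f v) = f (lmul a v)"
    "\<And>x. blinfun_apply S x = blinfun_apply S (ell2_restrict J x)"
  proof (rule induced_operator[of "lmul a" "norm a"])
    fix v w :: "'k vectors" assume vw: "v \<in> A_valued" "w \<in> A_valued"
    show "lmul a v \<in> A_valued" by (rule lmul_closed) fact+
    show "Re (form (lmul a v) (lmul a v)) \<le> (norm a)\<^sup>2 * Re (form v v)" by (rule bound) fact
    show "lmul a (v + w) = lmul a v + lmul a w"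
      by (rule poly_mapping_eqI) (use a vw in \<open>simp add: lookup_lmul lookup_add mul_add_right lookup_in\<close>)
    show "lmul a (pm_scale c v) = pm_scale c (lmul a v)" for c
      by (rule poly_mapping_eqI) (use a vw in \<open>simp add: lookup_lmul lookup_map_zero mul_scale_right lookup_in\<close>)
  qed simp_all
  thus ?thesis unfolding represents_def by blast
qed

lemma represents_unique: "represents a S \<Longrightarrow> represents a T \<Longrightarrow> S = T"
  unfolding represents_def by (rule operator_eqI) metis+

definition rep :: "('k \<Rightarrow>\<^sub>L 'k) \<Rightarrow> ('i ell2 \<Rightarrow>\<^sub>L 'i ell2)" where
  "rep a = (SOME S. represents a S)"

lemma represents_rep: "a \<in> A \<Longrightarrow> represents a (rep a)"
  unfolding rep_def by (rule someI_ex) (rule represents_exists)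

lemma rep_BH: "a \<in> A \<Longrightarrow> rep a \<in> BH"
  and rep_f: "a \<in> A \<Longrightarrow> v \<in> A_valued \<Longrightarrow> blinfun_apply (rep a) (f v) = f (lmul a v)"
  and rep_restrict: "a \<in> A \<Longrightarrow> blinfun_apply (rep a) x = blinfun_apply (rep a) (ell2_restrict J x)"
  using represents_rep unfolding represents_def by blast+

lemma rep_eqI: "a \<in> A \<Longrightarrow> represents a S \<Longrightarrow> rep a = S"
  using represents_unique represents_rep by blast

lemma rep_add:
  assumes a: "a \<in> A" and b: "b \<in> A"
  shows "rep (a + b) = rep a + rep b"
proof (rule rep_eqI[OF A_add[OF a b]], unfold represents_def, intro conjI ballI allI)
  show "rep a + rep b \<in> BH"
    using rep_BH[OF a] rep_BH[OF b] by (simp add: BH_def blinfun.add_left scaleC_add_right)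
  show "blinfun_apply (rep a + rep b) (f v) = f (lmul (a + b) v)" if "v \<in> A_valued" for v
    using that a b by (simp add: blinfun.add_left rep_f lmul_add_left f_add lmul_closed)
  show "blinfun_apply (rep a + rep b) x = blinfun_apply (rep a + rep b) (ell2_restrict J x)" for x
    unfolding blinfun.add_left by (intro arg_cong2[of _ _ _ _ "(+)"] rep_restrict a b)
qed

lemma rep_scale:
  assumes a: "a \<in> A"
  shows "rep (scaleC_op c a) = scaleC_op c (rep a)"
proof (rule rep_eqI[OF A_scale[OF a]], unfold represents_def, intro conjI ballI allI)
  show "scaleC_op c (rep a) \<in> BH"
    using rep_BH[OF a] by (simp add: BH_def scaleC_scaleC mult.commute)
  show "blinfun_apply (scaleC_op c (rep a)) (f v) = f (lmul (scaleC_op c a) v)" if "v \<in> A_valued" for v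
    using that a by (simp add: rep_f lmul_scale_left f_scale lmul_closed)
  show "blinfun_apply (scaleC_op c (rep a)) x = blinfun_apply (scaleC_op c (rep a)) (ell2_restrict J x)" for x
    unfolding scaleC_op_apply by (intro arg_cong[of _ _ "(*\<^sub>C) c"] rep_restrict a)
qed

lemma rep_mul:
  assumes a: "a \<in> A" and b: "b \<in> A"
  shows "rep (mul a b) = rep a o\<^sub>L rep b"
proof (rule rep_eqI[OF mul_closed[OF a b]], unfold represents_def, intro conjI ballI allI)
  show "rep a o\<^sub>L rep b \<in> BH"
    using rep_BH[OF a] rep_BH[OF b] by (simp add: BH_def)
  show "blinfun_apply (rep a o\<^sub>L rep b) (f v) = f (lmul (mul a b) v)" if "v \<in> A_valued" for v
    using that a b by (simp add: rep_f lmul_mul lmul_closed)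
  show "blinfun_apply (rep a o\<^sub>L rep b) x = blinfun_apply (rep a o\<^sub>L rep b) (ell2_restrict J x)" for x
    unfolding blinfun_apply_blinfun_compose by (intro arg_cong[of _ _ "blinfun_apply (rep a)"] rep_restrict b)
qed

lemma matnorm_rep_le:
  assumes n: "n \<ge> 1" and x: "x \<in> Mat n A"
  shows "matnorm n (\<lambda>i j. rep (x i j)) \<le> matnorm n x"
proof (rule matnorm_leI[OF matrix_bound_from_range])
  have xA: "x i k \<in> A" if "i < n" "k < n" for i k using x that by (simp add: Mat_def)
  fix i j y assume "i < n" "j < n"
  thus "blinfun_apply (rep (x i j)) y = blinfun_apply (rep (x i j)) (ell2_restrict J y)"
    by (intro rep_restrict xA)
next
  have xA: "x i k \<in> A" if "i < n" "k < n" for i k using x that by (simp add: Mat_def)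
  fix v :: "nat \<Rightarrow> 'k vectors" assume v: "\<And>j. v j \<in> A_valued"
  have terms: "lmul (x i j) (v j) \<in> A_valued" if "i < n" "j < n" for i j
    by (intro lmul_closed xA v that)
  have sums: "(\<Sum>j<n. blinfun_apply (rep (x i j)) (f (v j))) = f (\<Sum>j<n. lmul (x i j) (v j))"
    if "i < n" for i
  proof -
    have "(\<Sum>j<n. blinfun_apply (rep (x i j)) (f (v j))) = (\<Sum>j<n. f (lmul (x i j) (v j)))"
      using that by (intro sum.cong refl rep_f xA v) simp_all
    also have "\<dots> = f (\<Sum>j<n. lmul (x i j) (v j))"
      by (rule f_sum[symmetric]) (use terms that in simp)
    finally show ?thesis .
  qed
  have sums_V: "(\<Sum>j<n. lmul (x i j) (v j)) \<in> A_valued" if "i < n" for i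
    by (rule subspace_sum[OF subspace_V]) (use terms that in simp)
  have "(L2_set (\<lambda>i. norm (\<Sum>j<n. blinfun_apply (rep (x i j)) (f (v j)))) {..<n})\<^sup>2
      = (\<Sum>i<n. Re (form (\<Sum>k<n. lmul (x i k) (v k)) (\<Sum>k<n. lmul (x i k) (v k))))"
    by (simp add: L2_set_power2 sums sums_V f_norm)
  also have "\<dots> \<le> (matnorm n x * L2_set (\<lambda>j. norm (f (v j))) {..<n})\<^sup>2"
    using form_contractive[OF n x v] by (simp add: power_mult_distrib L2_set_power2 f_norm v)
  finally show "L2_set (\<lambda>i. norm (\<Sum>j<n. blinfun_apply (rep (x i j)) (f (v j)))) {..<n}
      \<le> matnorm n x * L2_set (\<lambda>j. norm (f (v j))) {..<n}"
    by (rule power2_le_imp_le) (simp add: matnorm_nonneg)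
qed (simp_all add: matnorm_nonneg)

text \<open>
  In the summand with label \<open>(n, x)\<close> the matrix \<open>x\<close> is applied to the vector whose \<open>j\<close>-th component
  is the row with single entry \<open>e\<close> at position \<open>j\<close>. This vector has norm at most \<open>\<parallel>e\<parallel> \<le> 1\<close>, and
  its image consists of the rows of \<open>x\<close> multiplied by \<open>e\<close> from the right. As \<open>e\<close> runs through the
  approximate identity they tend to the rows of \<open>x\<close>, on which the form attains \<open>\<parallel>x\<parallel>\<^sup>2\<close>.
\<close>

lemma matnorm_rep_ge:
  assumes x: "x \<in> Mat n A" and cai: "has_right_cai A mul"
  shows "matnorm n x \<le> matnorm n (\<lambda>i j. rep (x i j))"
proof -
  obtain F where F: "F \<noteq> bot" "\<forall>\<^sub>F e in F. e \<in> A \<and> norm e \<le> 1"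
    "\<And>a. a \<in> A \<Longrightarrow> ((\<lambda>e. mul a e) \<longlongrightarrow> a) F"
    using cai by (auto simp: has_right_cai_def)
  have xA: "x i k \<in> A" if "i < n" "k < n" for i k using x that by (simp add: Mat_def)
  define l where "l = (n, x)"
  define w where "w i = row_vector l n (x i)" for i
  define we where "we e i = row_vector l n (\<lambda>j. mul (x i j) e)" for e i
  have w: "w i \<in> A_valued" if "i < n" for i
    unfolding w_def by (intro row_vector_in_V xA that)
  have we: "we e i \<in> A_valued" if "i < n" "e \<in> A" for i e
    unfolding we_def by (intro row_vector_in_V mul_closed xA that)
  have norm_w: "L2_set (\<lambda>i. norm (f (w i))) {..<n} = matnorm n x"
  proof -
    have "(norm (f (w i)))\<^sup>2 = Re (s (n, x) (\<lambda>j. if j < n then x i j else 0) (\<lambda>j. if j < n then x i j else 0))"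
      if "i < n" for i
      using f_norm[OF w[OF that]] form_row_vector[of n "x i" l, OF xA[OF that]]
      by (simp only: w_def l_def)
    hence "(L2_set (\<lambda>i. norm (f (w i))) {..<n})\<^sup>2 = (matnorm n x)\<^sup>2"
      using s_attains[OF x] by (simp add: L2_set_power2)
    thus ?thesis by (simp add: matnorm_nonneg)
  qed
  have upper: "L2_set (\<lambda>i. norm (f (we e i))) {..<n} \<le> matnorm n (\<lambda>i j. rep (x i j))"
    if e: "e \<in> A" "norm e \<le> 1" for e
  proof -
    let ?E = "\<lambda>j. Poly_Mapping.single (l, j) e"
    have "(\<Sum>j<n. blinfun_apply (rep (x i j)) (f (?E j))) = f (we e i)" if "i < n" for i
    proof -
      have "(\<Sum>j<n. blinfun_apply (rep (x i j)) (f (?E j)))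
          = (\<Sum>j<n. f (Poly_Mapping.single (l, j) (mul (x i j) e)))"
        using that e(1) by (intro sum.cong refl) (simp add: rep_f xA single_in_V lmul_single)
      also have "\<dots> = f (\<Sum>j<n. Poly_Mapping.single (l, j) (mul (x i j) e))"
        by (rule f_sum[symmetric]) (use that e(1) xA in \<open>simp add: single_in_V mul_closed\<close>)
      finally show ?thesis by (simp only: we_def row_vector_def)
    qed
    hence "L2_set (\<lambda>i. norm (f (we e i))) {..<n}
        = L2_set (\<lambda>i. norm (\<Sum>j<n. blinfun_apply (rep (x i j)) (f (?E j)))) {..<n}"
      by (intro L2_set_cong) simp_all
    also have "\<dots> \<le> matnorm n (\<lambda>i j. rep (x i j))"
    proof (rule matnorm_upper)
      have "(L2_set (\<lambda>j. norm (f (?E j))) {..<n})\<^sup>2 \<le> (norm e)\<^sup>2"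
        using s_unit[OF e(1), of n x] by (simp add: L2_set_power2 f_norm single_in_V e(1) form_single l_def)
      hence "L2_set (\<lambda>j. norm (f (?E j))) {..<n} \<le> norm e" by (rule power2_le_imp_le) simp
      thus "L2_set (\<lambda>j. norm (f (?E j))) {..<n} \<le> 1" using e(2) by simp
    qed
    finally show ?thesis .
  qed
  have lim: "((\<lambda>e. f (we e i)) \<longlongrightarrow> f (w i)) F" if i: "i < n" for i
  proof (rule Lim_transform2[OF tendsto_const], rule Lim_null_comparison)
    show "\<forall>\<^sub>F e in F. norm (f (w i) - f (we e i)) \<le> (\<Sum>j<n. norm (x i j - mul (x i j) e))"
      using F(2)
    proof eventually_elim
      case (elim e)
      have diff: "w i - we e i = row_vector l n (\<lambda>j. x i j - mul (x i j) e)"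
        by (rule poly_mapping_eqI)
          (simp add: w_def we_def row_vector_def lookup_minus lookup_sum lookup_single when_def
            flip: sum_subtractf, intro sum.cong, auto)
      have dA: "x i j - mul (x i j) e \<in> A" if "j < n" for j
        using elim that i by (intro A_diff mul_closed xA) auto
      have "(norm (f (w i) - f (we e i)))\<^sup>2 = Re (form (w i - we e i) (w i - we e i))"
        using elim i w we by (simp add: f_norm V_closed flip: f_diff)
      also have "\<dots> = Re (s l (\<lambda>j. if j < n then x i j - mul (x i j) e else 0)
          (\<lambda>j. if j < n then x i j - mul (x i j) e else 0))"
        unfolding diff by (subst form_row_vector) (use dA in auto)
      also have "\<dots> \<le> (\<Sum>j<n. norm (if j < n then x i j - mul (x i j) e else 0))\<^sup>2"
        unfolding l_def by (rule s_bounded) (use dA A_zero in auto)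
      finally have "(norm (f (w i) - f (we e i)))\<^sup>2 \<le> (\<Sum>j<n. norm (x i j - mul (x i j) e))\<^sup>2"
        by simp
      thus ?case by (rule power2_le_imp_le) (simp add: sum_nonneg)
    qed
    have "((\<lambda>e. \<Sum>j<n. norm (x i j - mul (x i j) e)) \<longlongrightarrow> (\<Sum>j<n. norm (x i j - x i j))) F"
      by (intro tendsto_intros F(3) xA i) simp
    thus "((\<lambda>e. \<Sum>j<n. norm (x i j - mul (x i j) e)) \<longlongrightarrow> 0) F" by simp
  qed
  have "((\<lambda>e. L2_set (\<lambda>i. norm (f (we e i))) {..<n}) \<longlongrightarrow> L2_set (\<lambda>i. norm (f (w i))) {..<n}) F"
    unfolding L2_set_def by (intro tendsto_intros lim) simp
  hence "L2_set (\<lambda>i. norm (f (w i))) {..<n} \<le> matnorm n (\<lambda>i j. rep (x i j))"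
    by (rule tendsto_upperbound) (use F(1,2) upper in \<open>auto elim: eventually_mono\<close>)
  thus ?thesis by (simp add: norm_w)
qed

end

text \<open>
  The image is complete because the representation is isometric, and it inherits the right
  approximate identity.
\<close>

lemma (in left_representation) is_operator_algebra:
  assumes cai: "has_right_cai A mul"
  shows "is_operator_algebra_on TYPE('i ell2) A mul"
proof -
  have matnorm_rep: "matnorm n (\<lambda>i j. rep (x i j)) = matnorm n x" if "n \<ge> 1" "x \<in> Mat n A" for n x
    using matnorm_rep_le[OF that] matnorm_rep_ge[OF that(2) cai] by (rule antisym)
  have rep_norm: "norm (rep a) = norm a" if "a \<in> A" for a
    using matnorm_rep[of 1 "\<lambda>_ _. a"] that matnorm_1[of a] matnorm_1[of "rep a"] by (simp add: Mat_def)
  have rep_diff: "rep (a - b) = rep a - rep b" if "a \<in> A" "b \<in> A" for a b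
    using rep_add[OF A_diff[OF that] that(2)] by simp
  have inj: "inj_on rep A"
  proof (rule inj_onI)
    fix a b assume "a \<in> A" "b \<in> A" "rep a = rep b"
    thus "a = b" using rep_norm[OF A_diff, of a b] by (simp add: rep_diff)
  qed
  have complete: "complete (rep ` A)"
    unfolding complete_def
  proof (intro allI impI, elim conjE)
    fix X assume "\<forall>n. X n \<in> rep ` A" and "Cauchy X"
    hence "\<forall>n. \<exists>a. a \<in> A \<and> X n = rep a" by blast
    then obtain Y where "\<forall>n. Y n \<in> A \<and> X n = rep (Y n)" by metis
    hence Y: "\<And>n. Y n \<in> A" "\<And>n. X n = rep (Y n)" by simp_all
    have dist_rep: "dist (rep a) (rep b) = dist a b" if "a \<in> A" "b \<in> A" for a b
      using that rep_norm[OF A_diff, of a b] by (simp add: dist_norm rep_diff)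
    have "Cauchy Y" using \<open>Cauchy X\<close> by (simp add: Cauchy_def Y dist_rep)
    moreover have "complete A" using operator_space by (simp add: operator_space_def)
    ultimately obtain a where a: "a \<in> A" "Y \<longlonglongrightarrow> a" using Y(1) unfolding complete_def by blast
    have "X \<longlonglongrightarrow> rep a" using a unfolding tendsto_iff by (simp add: Y dist_rep)
    thus "\<exists>l\<in>rep ` A. X \<longlonglongrightarrow> l" using a(1) by blast
  qed
  have "operator_space (rep ` A)"
    unfolding operator_space_def
  proof (intro conjI ballI allI)
    show "rep ` A \<subseteq> BH" using rep_BH by blast
    have "rep 0 = 0" using rep_diff[OF A_zero A_zero] by simp
    thus "0 \<in> rep ` A" using A_zero by (metis imageI)
    show "complete (rep ` A)" by (rule complete)
    show "S + T \<in> rep ` A" if "S \<in> rep ` A" "T \<in> rep ` A" for S T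
      using that A_add by (auto simp flip: rep_add)
    show "scaleC_op c T \<in> rep ` A" if "T \<in> rep ` A" for c T
      using that A_scale by (auto simp flip: rep_scale)
  qed
  moreover have "S o\<^sub>L T \<in> rep ` A" if "S \<in> rep ` A" "T \<in> rep ` A" for S T
    using that mul_closed by (auto simp flip: rep_mul)
  moreover have "has_right_cai (rep ` A) (o\<^sub>L)"
  proof -
    obtain F where F: "F \<noteq> bot" "\<forall>\<^sub>F e in F. e \<in> A \<and> norm e \<le> 1"
      "\<And>a. a \<in> A \<Longrightarrow> ((\<lambda>e. mul a e) \<longlongrightarrow> a) F"
      using cai by (auto simp: has_right_cai_def)
    have "((\<lambda>e. rep a o\<^sub>L e) \<longlongrightarrow> rep a) (filtermap rep F)" if a: "a \<in> A" for a
    proof -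
      have "((\<lambda>e. rep a o\<^sub>L rep e) \<longlongrightarrow> rep a) F"
      proof (rule Lim_transform2[OF tendsto_const], rule Lim_null_comparison)
        show "\<forall>\<^sub>F e in F. norm (rep a - (rep a o\<^sub>L rep e)) \<le> norm (a - mul a e)"
          using F(2)
        proof eventually_elim
          case (elim e)
          hence e: "mul a e \<in> A" using a mul_closed by blast
          have "rep a - (rep a o\<^sub>L rep e) = rep (a - mul a e)"
            using elim a e by (simp add: rep_diff rep_mul)
          thus ?case using rep_norm[OF A_diff[OF a e]] by simp
        qed
        have "((\<lambda>e. norm (a - mul a e)) \<longlongrightarrow> norm (a - a)) F" by (intro tendsto_intros F(3) a)
        thus "((\<lambda>e. norm (a - mul a e)) \<longlongrightarrow> 0) F" by simp
      qed
      thus ?thesis by (simp add: filterlim_filtermap)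
    qed
    thus ?thesis
      unfolding has_right_cai_def using F(1,2)
      by (intro exI[of _ "filtermap rep F"])
        (auto simp: eventually_filtermap filtermap_bot_iff rep_norm elim!: eventually_mono)
  qed
  ultimately have "concrete_operator_algebra (rep ` A)"
    by (simp add: concrete_operator_algebra_def)
  moreover have "completely_isometric_isomorphism A mul (rep ` A) rep"
    unfolding completely_isometric_isomorphism_def
    by (intro conjI ballI allI impI bij_betw_imageI inj refl rep_add rep_scale rep_mul matnorm_rep)
  ultimately show ?thesis unfolding is_operator_algebra_on_def by blast
qed

theorem (in algebra_in_operator_space) is_operator_algebra_if_oplus_Id_bound:
  assumes "oplus_Id_bound A mul" and cai: "has_right_cai A mul"
    and inj: "inj_on (\<iota> :: 'k vectors \<Rightarrow> 'i) A_valued"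
  shows "is_operator_algebra_on TYPE('i ell2) A mul"
proof -
  have "\<forall>l. \<exists>s. contractive_form A mul (fst l) (snd l) s"
    using contractive_form_exists[OF assms(1)] by blast
  then obtain s where "\<And>l. contractive_form A mul (fst l) (snd l) (s l)" by metis
  hence "contractive_forms_axioms A mul s" by (rule contractive_forms_axioms.intro)
  then interpret contractive_forms A mul s
    by (intro contractive_forms.intro algebra_in_operator_space_axioms)
  obtain f :: "'k vectors \<Rightarrow> 'i ell2" and J where f:
    "\<And>v w. v \<in> A_valued \<Longrightarrow> w \<in> A_valued \<Longrightarrow> f (v + w) = f v + f w"
    "\<And>v c. v \<in> A_valued \<Longrightarrow> f (pm_scale c v) = c *\<^sub>C f v"
    "\<And>v w. v \<in> A_valued \<Longrightarrow> w \<in> A_valued \<Longrightarrow> cinner (f v) (f w) = form v w"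
    "\<And>v. v \<in> A_valued \<Longrightarrow> ell2_restrict J (f v) = f v"
    "\<And>x. ell2_restrict J x \<in> closure (f ` A_valued)"
    using isometric_embedding[OF inj] by blast
  interpret left_representation A mul s f J
    by unfold_locales (fact f)+
  show ?thesis by (rule is_operator_algebra[OF cai])
qed

section \<open>The size of the representation space\<close>

lemma inj_Times_into_infinite:
  fixes f :: "'a \<Rightarrow> 'c" and g :: "'b \<Rightarrow> 'c"
  assumes "infinite (UNIV :: 'c set)" "inj f" "inj g"
  shows "\<exists>h :: 'a \<times> 'b \<Rightarrow> 'c. inj h"
proof -
  obtain h :: "'c \<times> 'c \<Rightarrow> 'c" where "bij_betw h (UNIV \<times> UNIV) UNIV"
    using card_of_Times_same_infinite[OF assms(1)] card_of_ordIso by blast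
  hence h: "inj h" by (simp add: bij_betw_def)
  have "inj (\<lambda>(a, b). h (f a, g b))"
    using assms(2,3) by (auto intro!: injI dest!: injD[OF h] dest: injD)
  thus ?thesis by blast
qed

text \<open>
  Functions are encoded by their graphs.
\<close>

lemma inj_functions_into_sets:
  assumes "inj (h :: 'd \<times> 'x \<Rightarrow> 'c)"
  shows "\<exists>g :: ('d \<Rightarrow> 'x) \<Rightarrow> 'c set. inj g"
proof
  show "inj (\<lambda>u. h ` {(d, u d) | d. True})"
  proof (rule injI)
    fix u v :: "'d \<Rightarrow> 'x"
    assume "h ` {(d, u d) | d. True} = h ` {(d, v d) | d. True}"
    hence "{(d, u d) | d. True} = {(d, v d) | d. True}" using assms by (simp add: inj_image_eq_iff)
    thus "u = v" by auto
  qed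
qed

lemma infinite_sets: "infinite (UNIV :: 'a set) \<Longrightarrow> infinite (UNIV :: 'a set set)"
  by (simp add: Finite_Set.finite_set)

text \<open>
  Let \<open>\<kappa>\<close> be the cardinality of the space of operators. An infinite matrix is a set of triples of a
  row, a column and an operator; there are \<open>\<kappa>\<close> such triples, hence at most \<open>2\<^sup>\<kappa>\<close> labels. A vector
  is a set of triples of a label, a position and an operator; there are at most \<open>2\<^sup>\<kappa>\<close> such triples.
\<close>

lemma vectors_inject_into_sets_of_sets:
  assumes "infinite (UNIV :: ('k::complex_hilbert \<Rightarrow>\<^sub>L 'k) set)"
  shows "\<exists>\<iota> :: 'k vectors \<Rightarrow> ('k \<Rightarrow>\<^sub>L 'k) set set. inj \<iota>"
proof -
  note sets = infinite_sets[OF assms]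
  obtain nat_in :: "nat \<Rightarrow> 'k \<Rightarrow>\<^sub>L 'k" where nat_in: "inj nat_in"
    using infinite_countable_subset[OF assms] by blast
  have sing: "inj (\<lambda>x :: 'k \<Rightarrow>\<^sub>L 'k. {x})" by (rule injI) simp
  have nat_in': "inj (\<lambda>n. {nat_in n})" using nat_in by (auto simp: inj_def)
  obtain h1 :: "(nat \<times> nat) \<times> ('k \<Rightarrow>\<^sub>L 'k) \<Rightarrow> 'k \<Rightarrow>\<^sub>L 'k" where "inj h1"
    using inj_Times_into_infinite[OF assms _ inj_on_id2] inj_Times_into_infinite[OF assms nat_in nat_in] by blast
  then obtain g1 :: "(nat \<times> nat \<Rightarrow> 'k \<Rightarrow>\<^sub>L 'k) \<Rightarrow> ('k \<Rightarrow>\<^sub>L 'k) set" where "inj g1"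
    using inj_functions_into_sets by blast
  have "inj (\<lambda>x. g1 (\<lambda>(i, j). x i j))"
  proof (rule injI)
    fix x y :: "nat \<Rightarrow> nat \<Rightarrow> 'k \<Rightarrow>\<^sub>L 'k"
    assume "g1 (\<lambda>(i, j). x i j) = g1 (\<lambda>(i, j). y i j)"
    hence "(\<lambda>(i, j). x i j) = (\<lambda>(i, j). y i j)" using \<open>inj g1\<close> by (rule injD[rotated])
    thus "x = y" by (auto simp: fun_eq_iff)
  qed
  then obtain h2 :: "nat \<times> (nat \<Rightarrow> nat \<Rightarrow> 'k \<Rightarrow>\<^sub>L 'k) \<Rightarrow> ('k \<Rightarrow>\<^sub>L 'k) set" where "inj h2"
    using inj_Times_into_infinite[OF sets nat_in'] by blast
  then obtain h3 :: "(nat \<times> (nat \<Rightarrow> nat \<Rightarrow> 'k \<Rightarrow>\<^sub>L 'k)) \<times> nat \<Rightarrow> ('k \<Rightarrow>\<^sub>L 'k) set" where "inj h3"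
    using inj_Times_into_infinite[OF sets _ nat_in'] by blast
  then obtain h4 :: "((nat \<times> (nat \<Rightarrow> nat \<Rightarrow> 'k \<Rightarrow>\<^sub>L 'k)) \<times> nat) \<times> ('k \<Rightarrow>\<^sub>L 'k) \<Rightarrow> ('k \<Rightarrow>\<^sub>L 'k) set" where "inj h4"
    using inj_Times_into_infinite[OF sets _ sing] by blast
  then obtain g4 :: "((nat \<times> (nat \<Rightarrow> nat \<Rightarrow> 'k \<Rightarrow>\<^sub>L 'k)) \<times> nat \<Rightarrow> 'k \<Rightarrow>\<^sub>L 'k) \<Rightarrow> ('k \<Rightarrow>\<^sub>L 'k) set set" where "inj g4"
    using inj_functions_into_sets by blast
  have "inj (\<lambda>u :: 'k vectors. g4 (poly_mapping.lookup u))"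
  proof (rule injI)
    fix u v :: "'k vectors" assume "g4 (poly_mapping.lookup u) = g4 (poly_mapping.lookup v)"
    hence "poly_mapping.lookup u = poly_mapping.lookup v" using \<open>inj g4\<close> by (rule injD[rotated])
    thus "u = v" by simp
  qed
  thus ?thesis by blast
qed

lemma infinite_operators:
  assumes "T \<noteq> (0 :: 'k::complex_hilbert \<Rightarrow>\<^sub>L 'k)"
  shows "infinite (UNIV :: ('k \<Rightarrow>\<^sub>L 'k) set)"
proof -
  have "inj (\<lambda>r :: real. r *\<^sub>R T)" using assms by (auto simp: inj_def)
  thus ?thesis using infinite_UNIV_char_0[where 'a = real] finite_imageD
    by (metis finite_subset subset_UNIV)
qed

text \<open>
  If \<open>A\<close> is zero, then so is the direct sum, and one coordinate suffices even if the space of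
  operators is finite. Otherwise this space contains a real line, so it is infinite.
\<close>

lemma (in algebra_in_operator_space) vectors_index:
  "\<exists>\<iota> :: 'k vectors \<Rightarrow> ('k \<Rightarrow>\<^sub>L 'k) set set. inj_on \<iota> A_valued"
proof (cases "A = {0}")
  case True
  have "u = 0" if "u \<in> A_valued" for u :: "'k vectors"
    by (rule poly_mapping_eqI) (use lookup_in[OF that] True in \<open>simp only: singleton_iff lookup_zero\<close>)
  hence "A_valued \<subseteq> {0 :: 'k vectors}" by blast
  hence "inj_on (\<lambda>_. {}) (A_valued :: 'k vectors set)" by (auto simp: inj_on_def)
  thus ?thesis by blast
next
  case False
  then obtain T where "T \<in> A" "T \<noteq> 0" using A_zero by blast
  thus ?thesis using vectors_inject_into_sets_of_sets[OF infinite_operators] inj_on_subset by blast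
qed

section \<open>The characterization\<close>

text \<open>
  In the image algebra the first \<open>n\<close> rows of the product are multiplied by an operator of
  norm \<open>\<parallel>x\<parallel>\<close> and the others by the identity; with \<open>r = max \<parallel>x\<parallel> 1\<close> the squares of both parts are at most
  \<open>r\<^sup>2\<close> times the original ones.
\<close>

lemma (in algebra_in_operator_space) oplus_Id_bound_if_operator_algebra:
  assumes "is_operator_algebra_on TYPE('h::complex_hilbert) A mul"
  shows "oplus_Id_bound A mul"
proof -
  obtain B :: "('h \<Rightarrow>\<^sub>L 'h) set" and \<phi> where iso: "completely_isometric_isomorphism A mul B \<phi>"
    using assms by (auto simp: is_operator_algebra_on_def)
  have add: "\<phi> (a + b) = \<phi> a + \<phi> b" and mul: "\<phi> (mul a b) = \<phi> a o\<^sub>L \<phi> b" if "a \<in> A" "b \<in> A" for a b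
    using iso that by (auto simp: completely_isometric_isomorphism_def)
  have isometric: "matnorm n (\<lambda>i j. \<phi> (x i j)) = matnorm n x" if "n \<ge> 1" "x \<in> Mat n A" for n x
    using iso that by (auto simp: completely_isometric_isomorphism_def)
  have sum: "\<phi> (\<Sum>k<n. a k) = (\<Sum>k<n. \<phi> (a k))" if "\<And>k. k < n \<Longrightarrow> a k \<in> A" for a and n :: nat
    using that
  proof (induction n)
    case 0
    show ?case using add[OF A_zero A_zero] by simp
  next
    case (Suc n)
    have "(\<Sum>k<n. a k) \<in> A" using Suc.prems by (intro A_sum) simp
    thus ?case using Suc by (simp add: add)
  qed
  show ?thesis
    unfolding oplus_Id_bound_def
  proof (intro allI impI ballI)
    fix n m x y assume n: "(1::nat) \<le> n" and x: "x \<in> Mat n A" and y: "y \<in> Mat (n + m) A"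
    define z where "z = oplus_Id_mult mul n x y"
    let ?M = "n + m" and ?X = "\<lambda>i j. \<phi> (x i j)" and ?Y = "\<lambda>i j. \<phi> (y i j)"
    have xA: "x i k \<in> A" if "i < n" "k < n" for i k using x that by (simp add: Mat_def)
    have yA: "y i k \<in> A" if "i < ?M" "k < ?M" for i k using y that by (simp add: Mat_def)
    have z: "z \<in> Mat ?M A"
      unfolding Mat_def z_def oplus_Id_mult_def using xA yA by (auto intro!: A_sum mul_closed)
    have upper: "\<phi> (z i j) = (\<Sum>k<n. \<phi> (x i k) o\<^sub>L \<phi> (y k j))" if "i < n" "j < ?M" for i j
    proof -
      have "\<phi> (z i j) = (\<Sum>k<n. \<phi> (mul (x i k) (y k j)))"
        using that by (simp add: z_def oplus_Id_mult_def) (rule sum, simp add: mul_closed xA yA)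
      also have "\<dots> = (\<Sum>k<n. \<phi> (x i k) o\<^sub>L \<phi> (y k j))"
        by (intro sum.cong refl mul xA yA) (use that in auto)
      finally show ?thesis .
    qed
    have lower: "\<phi> (z (n + i) j) = \<phi> (y (n + i) j)" for i j
      by (simp add: z_def oplus_Id_mult_def)
    have "matnorm ?M (\<lambda>i j. \<phi> (z i j)) \<le> max (matnorm n ?X) 1 * matnorm ?M ?Y"
    proof (rule matnorm_leI)
      fix v :: "nat \<Rightarrow> 'h"
      define r where "r = max (matnorm n ?X) 1"
      define w where "w k = (\<Sum>j<?M. blinfun_apply (?Y k j) (v j))" for k
      have r: "r \<ge> 0" "matnorm n ?X \<le> r" "1 \<le> r" by (auto simp: r_def)
      have up: "(\<Sum>j<?M. blinfun_apply (\<phi> (z i j)) (v j)) = (\<Sum>k<n. blinfun_apply (?X i k) (w k))"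
        if "i < n" for i
      proof -
        have "(\<Sum>j<?M. blinfun_apply (\<phi> (z i j)) (v j))
            = (\<Sum>j<?M. \<Sum>k<n. blinfun_apply (?X i k) (blinfun_apply (?Y k j) (v j)))"
          by (intro sum.cong refl) (use that in \<open>simp add: upper blinfun.sum_left\<close>)
        also have "\<dots> = (\<Sum>k<n. \<Sum>j<?M. blinfun_apply (?X i k) (blinfun_apply (?Y k j) (v j)))"
          by (rule sum.swap)
        finally show ?thesis by (simp only: w_def blinfun.sum_right)
      qed
      have low: "(\<Sum>j<?M. blinfun_apply (\<phi> (z (n + i) j)) (v j)) = w (n + i)" for i
        by (simp add: lower w_def)
      have "(L2_set (\<lambda>i. norm (\<Sum>j<?M. blinfun_apply (\<phi> (z i j)) (v j))) {..<?M})\<^sup>2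
          = (L2_set (\<lambda>i. norm (\<Sum>k<n. blinfun_apply (?X i k) (w k))) {..<n})\<^sup>2 + (\<Sum>i<m. (norm (w (n + i)))\<^sup>2)"
        unfolding L2_set_power2
          sum_lessThan_add[of "\<lambda>i. (norm (\<Sum>j<?M. blinfun_apply (\<phi> (z i j)) (v j)))\<^sup>2"]
        by (intro arg_cong2[of _ _ _ _ "(+)"] sum.cong refl) (simp_all only: low up lessThan_iff)
      also have "\<dots> \<le> (r * L2_set (\<lambda>k. norm (w k)) {..<n})\<^sup>2 + r\<^sup>2 * (\<Sum>i<m. (norm (w (n + i)))\<^sup>2)"
      proof (rule add_mono)
        have "L2_set (\<lambda>i. norm (\<Sum>k<n. blinfun_apply (?X i k) (w k))) {..<n} \<le> r * L2_set (\<lambda>k. norm (w k)) {..<n}"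
          by (rule order_trans[OF matnorm_bound]) (intro mult_right_mono r L2_set_nonneg)
        thus "(L2_set (\<lambda>i. norm (\<Sum>k<n. blinfun_apply (?X i k) (w k))) {..<n})\<^sup>2 \<le> (r * L2_set (\<lambda>k. norm (w k)) {..<n})\<^sup>2"
          by (intro power_mono) simp_all
        have "1 \<le> r\<^sup>2" using r by simp
        thus "(\<Sum>i<m. (norm (w (n + i)))\<^sup>2) \<le> r\<^sup>2 * (\<Sum>i<m. (norm (w (n + i)))\<^sup>2)"
          using mult_right_mono[of 1 "r\<^sup>2" "\<Sum>i<m. (norm (w (n + i)))\<^sup>2"] by (simp add: sum_nonneg)
      qed
      also have "\<dots> = (r * L2_set (\<lambda>k. norm (w k)) {..<?M})\<^sup>2"
        by (simp only: power_mult_distrib L2_set_power2 distrib_left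
            sum_lessThan_add[of "\<lambda>k. (norm (w k))\<^sup>2"])
      finally have "L2_set (\<lambda>i. norm (\<Sum>j<?M. blinfun_apply (\<phi> (z i j)) (v j))) {..<?M}
          \<le> r * L2_set (\<lambda>k. norm (w k)) {..<?M}"
        by (rule power2_le_imp_le) (use r in simp)
      also have "\<dots> \<le> r * (matnorm ?M ?Y * L2_set (\<lambda>j. norm (v j)) {..<?M})"
        unfolding w_def by (intro mult_left_mono matnorm_bound r)
      finally show "L2_set (\<lambda>i. norm (\<Sum>j<?M. blinfun_apply (\<phi> (z i j)) (v j))) {..<?M}
          \<le> max (matnorm n ?X) 1 * matnorm ?M ?Y * L2_set (\<lambda>j. norm (v j)) {..<?M}"
        by (simp only: r_def mult.assoc)
    qed (simp add: matnorm_nonneg)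
    thus "matnorm ?M (oplus_Id_mult mul n x y) \<le> max (matnorm n x) 1 * matnorm ?M y"
      using isometric[of ?M z] isometric[of n x] isometric[of ?M y] n x y z by (simp add: z_def)
  qed
qed

lemma has_right_cai_of_identity: "has_right_identity A mul \<Longrightarrow> has_right_cai A mul"
  unfolding has_right_identity_def has_right_cai_def
proof (elim bexE conjE)
  fix e assume e: "e \<in> A" "norm e = 1" "\<forall>a\<in>A. mul a e = a"
  have "((\<lambda>e. mul a e) \<longlongrightarrow> a) (principal {e})" if "a \<in> A" for a
    by (rule tendsto_eventually) (use e that in \<open>simp add: eventually_principal\<close>)
  thus "\<exists>F. F \<noteq> bot \<and> (\<forall>\<^sub>F e in F. e \<in> A \<and> norm e \<le> 1) \<and> (\<forall>a\<in>A. ((\<lambda>e. mul a e) \<longlongrightarrow> a) F)"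
    using e by (intro exI[of _ "principal {e}"]) (simp add: eventually_principal principal_eq_bot_iff)
qed

theorem theorem1p11:
  fixes A :: "('k::complex_hilbert \<Rightarrow>\<^sub>L 'k) set"
    and mul :: "('k \<Rightarrow>\<^sub>L 'k) \<Rightarrow> ('k \<Rightarrow>\<^sub>L 'k) \<Rightarrow> ('k \<Rightarrow>\<^sub>L 'k)"
  assumes "operator_space A"
    and "algebra_on A mul"
    and "has_right_identity A mul \<or> has_right_cai A mul"
  shows "(is_operator_algebra_on TYPE('k host) A mul \<longleftrightarrow> oplus_Id_bound A mul) \<and>
         (is_operator_algebra_on TYPE('h::complex_hilbert) A mul \<longrightarrow> oplus_Id_bound A mul)"
proof -
  interpret algebra_in_operator_space A mul by unfold_locales fact+
  have cai: "has_right_cai A mul" using assms(3) has_right_cai_of_identity by blast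
  obtain \<iota> :: "'k vectors \<Rightarrow> ('k \<Rightarrow>\<^sub>L 'k) set set" where "inj_on \<iota> A_valued" using vectors_index by blast
  hence "is_operator_algebra_on TYPE('k host) A mul" if "oplus_Id_bound A mul"
    by (rule is_operator_algebra_if_oplus_Id_bound[OF that cai])
  thus ?thesis
    using oplus_Id_bound_if_operator_algebra[where 'h = "('k \<Rightarrow>\<^sub>L 'k) set set ell2"]
      oplus_Id_bound_if_operator_algebra[where 'h = 'h] by blast
qed

end
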